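(* Every $K$-trivial sequence $a\in\{0,1\}^{\mathbb{N}}$ is $K$-low.
   Context: $K$ denotes prefix-free Kolmogorov complexity and $K^a$ prefix-free complexity relative to oracle $a$. For $a=a_0a_1a_2\ldots$ write $(a)_n=a_0\ldots a_{n-1}$. $a$ is $K$-trivial if $K((a)_n)=K(n)+O(1)$, i.e. there is a constant $c$ with $K((a)_n)\le K(n)+c$ for all $n$. $a$ is $K$-low if $K^a(x)=K(x)+O(1)$ for all strings $x$ (equivalently $K(x)\le K^a(x)+c$ for some constant $c$). *)

theory Defs
  imports Main
begin

datatype recf = Zero | Succ | Proj nat | Comp recf "recf list" | Prec recf recf | Mn recf | Orc

definition arg :: "nat list \<Rightarrow> nat \<Rightarrow> nat" where
  "arg xs i = (if i < length xs then xs ! i else 0)"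

inductive eval :: "(nat \<Rightarrow> bool) \<Rightarrow> recf \<Rightarrow> nat list \<Rightarrow> nat \<Rightarrow> bool" for a where
  ev_zero: "eval a Zero xs 0"
| ev_succ: "eval a Succ xs (Suc (arg xs 0))"
| ev_proj: "eval a (Proj i) xs (arg xs i)"
| ev_orc: "eval a Orc xs (if a (arg xs 0) then 1 else 0)"
| ev_comp: "\<lbrakk>length ys = length gs; \<forall>i<length gs. eval a (gs ! i) xs (ys ! i); eval a f ys z\<rbrakk>
            \<Longrightarrow> eval a (Comp f gs) xs z"
| ev_prec0: "eval a f xs y \<Longrightarrow> eval a (Prec f g) (0 # xs) y"
| ev_precS: "\<lbrakk>eval a (Prec f g) (n # xs) y; eval a g (y # n # xs) z\<rbrakk>
             \<Longrightarrow> eval a (Prec f g) (Suc n # xs) z"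
| ev_mn: "\<lbrakk>eval a f (n # xs) 0; \<forall>m<n. \<exists>k. eval a f (m # xs) (Suc k)\<rbrakk>
          \<Longrightarrow> eval a (Mn f) xs n"

section \<open>Binary strings coded as natural numbers (bijectively)\<close>

fun enc :: "bool list \<Rightarrow> nat" where
  "enc [] = 0"
| "enc (b # xs) = 2 * enc xs + (if b then 2 else 1)"

definition dec :: "nat \<Rightarrow> bool list" where
  "dec = inv enc"

definition runs :: "(nat \<Rightarrow> bool) \<Rightarrow> recf \<Rightarrow> bool list \<Rightarrow> bool list \<Rightarrow> bool" where
  "runs a M p x \<longleftrightarrow> eval a M [enc p] (enc x)"

definition prefix_free_machine :: "recf \<Rightarrow> bool" where
  "prefix_free_machine M \<longleftrightarrow>
     (\<forall>a p q x y r. runs a M p x \<longrightarrow> runs a M q y \<longrightarrow> q = p @ r \<longrightarrow> r = [])"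

definition optimal_machine :: "recf \<Rightarrow> bool" where
  "optimal_machine U \<longleftrightarrow> prefix_free_machine U \<and>
     (\<forall>M. prefix_free_machine M \<longrightarrow>
        (\<exists>c. \<forall>a p x. runs a M p x \<longrightarrow> (\<exists>q. runs a U q x \<and> length q \<le> length p + c)))"

definition Krel :: "recf \<Rightarrow> (nat \<Rightarrow> bool) \<Rightarrow> bool list \<Rightarrow> nat" where
  "Krel U a x = (LEAST n. \<exists>p. runs a U p x \<and> length p = n)"

definition Kc :: "recf \<Rightarrow> bool list \<Rightarrow> nat" where
  "Kc U x = Krel U (\<lambda>_. False) x"

definition initseg :: "(nat \<Rightarrow> bool) \<Rightarrow> nat \<Rightarrow> bool list" where
  "initseg a n = map a [0..<n]"

text \<open>K(n) is K of the string coding n.\<close>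
definition K_trivial :: "recf \<Rightarrow> (nat \<Rightarrow> bool) \<Rightarrow> bool" where
  "K_trivial U a \<longleftrightarrow> (\<exists>c. \<forall>n. Kc U (initseg a n) \<le> Kc U (dec n) + c)"

definition K_low :: "recf \<Rightarrow> (nat \<Rightarrow> bool) \<Rightarrow> bool" where
  "K_low U a \<longleftrightarrow> (\<exists>c. \<forall>x. Kc U x \<le> Krel U a x + c)"

end

(*
  Fix a computable approximation A_0, A_1, ... of the K-trivial sequence a by strings with
  K(A_j|n) <= K(n) + b at every stage; it exists because, by the coding theorem for lengths, a is an
  isolated path of a tree of bounded width.  We enumerate requests "make K(n) small".  Whenever a
  request is granted, K-triviality forces a short description of A_j|n, and whenever the
  approximation changes below n afterwards, it forces one more.

  A procedure of level i tries to collect requests of a prescribed total weight for whose lengths i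
  different strings have received short descriptions.  For i > 1 it does so by calling procedures of
  level i - 1 on behalf of computations U^a(y) = x seen along A_j, until each such computation is
  backed by weight proportional to 2^-|y|; if the approximation then leaves the use of the
  computation, the weight backing it is released and has gained one more string.  For large k a
  procedure of level k cannot finish, by Kraft's inequality.  Hence at some level a procedure runs
  forever although all its calls end (a golden run).  Its total weight is finite, and it backs every
  computation that uses a true prefix of a, which gives descriptions of x of length |y| + O(1)
  without oracle.

  The strategy needs the constant d of the machine it builds.  The strategies for d = 2e
  are combined into one machine, the e-th discounted by 2^-(e+1), so that e can be chosen afterwards.
*)
theory Submission
  imports Defs Complex_Main "HOL-Library.Nat_Bijection"
begin

section \<open>Computable functions\<close>

text \<open>The obstacle is waste. When the use of a served computation changes, the running call is
  abandoned; what it has requested backs nothing, yet it counts against the total weight that may be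
  requested. Two devices bound this. A procedure with goal 2^-g backs a computation with program y
  by weight about 2^-(g+h+|y|) only, so by Kraft's inequality the computations live at one stage
  hold about a 2^-h share of the goal; and the weight of a call is halved for each call dropped
  before. Spending then exceeds the goal by a factor of at most 1 + 4 * 2^-h per level, and h is so
  large compared with k that these factors multiply to at most 2. The outermost goal is therefore
  1/2. Both k and h depend on d, which is why d has to be guessed.

  The golden run is not found effectively: its position and a starting stage enter the last machine
  as finite information. That machine also describes outputs of computations that use wrong prefixes
  of a. Once such a prefix is left, the weight behind it is released, and released weight stays
  below the goal that the golden run never reaches.\<close>

definition pr_on :: "nat list set \<Rightarrow> (nat list \<Rightarrow> nat) \<Rightarrow> bool" where
  "pr_on D f \<longleftrightarrow> (\<exists>R. \<forall>a. \<forall>xs\<in>D. eval a R xs (f xs))"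

abbreviation pr :: "nat \<Rightarrow> (nat list \<Rightarrow> nat) \<Rightarrow> bool" where
  "pr k \<equiv> pr_on {xs. length xs = k}"

lemma pr_onI: "(\<And>a xs. xs \<in> D \<Longrightarrow> eval a R xs (f xs)) \<Longrightarrow> pr_on D f"
  unfolding pr_on_def by blast

lemma pr_on_subset: "pr_on D f \<Longrightarrow> D' \<subseteq> D \<Longrightarrow> pr_on D' f"
  unfolding pr_on_def by blast

lemma pr_zero: "pr_on D (\<lambda>_. 0)"
  by (rule pr_onI[where R = Zero]) (rule ev_zero)

lemma eval_proj: "i < length xs \<Longrightarrow> eval a (Proj i) xs (xs ! i)"
  using ev_proj[of a i xs] by (simp add: arg_def)

lemma pr_on_proj: "(\<And>xs. xs \<in> D \<Longrightarrow> i < length xs) \<Longrightarrow> pr_on D (\<lambda>xs. xs ! i)"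
  by (rule pr_onI[where R = "Proj i"]) (auto intro: eval_proj)

lemma pr_proj: "i < k \<Longrightarrow> pr k (\<lambda>xs. xs ! i)"
  by (rule pr_on_proj) auto

lemma pr_on_comp:
  assumes "pr_on E f" "\<And>xs. xs \<in> D \<Longrightarrow> map (\<lambda>g. g xs) gs \<in> E" "\<And>g. g \<in> set gs \<Longrightarrow> pr_on D g"
  shows "pr_on D (\<lambda>xs. f (map (\<lambda>g. g xs) gs))"
proof -
  obtain F where F: "\<And>a xs. xs \<in> E \<Longrightarrow> eval a F xs (f xs)"
    using assms(1) unfolding pr_on_def by blast
  obtain G where G: "\<And>g a xs. g \<in> set gs \<Longrightarrow> xs \<in> D \<Longrightarrow> eval a (G g) xs (g xs)"
    using assms(3) unfolding pr_on_def by metis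
  show ?thesis
    by (rule pr_onI[where R = "Comp F (map G gs)"], rule ev_comp[where ys = "map (\<lambda>g. g xs) gs" for xs])
       (auto simp: assms(2) intro!: F G)
qed

lemma pr_on_comp1:
  assumes "pr_on E f" "pr_on D g" "\<And>xs. xs \<in> D \<Longrightarrow> [g xs] \<in> E"
  shows "pr_on D (\<lambda>xs. f [g xs])"
  using pr_on_comp[of E f D "[g]"] assms by force

lemma pr_comp1: "pr 1 f \<Longrightarrow> pr_on D g \<Longrightarrow> pr_on D (\<lambda>xs. f [g xs])"
  by (erule pr_on_comp1) auto

lemma pr_comp2:
  assumes "pr 2 f" "pr_on D g" "pr_on D h" shows "pr_on D (\<lambda>xs. f [g xs, h xs])"
  using pr_on_comp[of "{xs. length xs = 2}" f D "[g, h]"] assms by force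

lemma pr_suc: assumes "pr_on D f" shows "pr_on D (\<lambda>xs. Suc (f xs))"
proof -
  have "eval a Succ xs (Suc (xs ! 0))" if "length xs = 1" for a xs
    using ev_succ[of a xs] that by (simp add: arg_def)
  then have "pr 1 (\<lambda>xs. Suc (xs ! 0))" by (intro pr_onI) auto
  from pr_comp1[OF this, of D f] assms show ?thesis by simp
qed

text \<open>\<open>s\<close> needs a program only on the argument lists that occur during the
  recursion. Intermediate values will be codes, and programs are specified on codes only. The fixed
  length \<open>k\<close> lets projections rebuild the argument list behind the counter.\<close>

lemma pr_on_rec:
  fixes z s :: "nat list \<Rightarrow> nat"
  defines "r \<equiv> \<lambda>xs. rec_nat (z xs) (\<lambda>m y. s (y # m # xs))"
  assumes z: "pr_on D z" and n: "pr_on D n"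
    and s: "pr_on {r xs m # m # xs | xs m. xs \<in> D} s"
    and D: "\<And>xs. xs \<in> D \<Longrightarrow> length xs = k"
  shows "pr_on D (\<lambda>xs. r xs (n xs))"
proof -
  obtain Z where Z: "\<And>a xs. xs \<in> D \<Longrightarrow> eval a Z xs (z xs)"
    using z unfolding pr_on_def by blast
  obtain S where S: "\<And>a xs m. xs \<in> D \<Longrightarrow> eval a S (r xs m # m # xs) (s (r xs m # m # xs))"
    using s unfolding pr_on_def by blast
  obtain N where N: "\<And>a xs. xs \<in> D \<Longrightarrow> eval a N xs (n xs)"
    using n unfolding pr_on_def by blast
  have rec: "eval a (Prec Z S) (m # xs) (r xs m)" if "xs \<in> D" for a m xs
  proof (induction m)
    case (Suc m)
    from ev_precS[OF Suc S[OF that]] show ?case by (simp add: r_def)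
  qed (use that in \<open>auto simp: r_def intro: ev_prec0 Z\<close>)
  show ?thesis
  proof (rule pr_onI[where R = "Comp (Prec Z S) (N # map Proj [0..<k])"])
    fix a and xs :: "nat list" assume l: "xs \<in> D"
    show "eval a (Comp (Prec Z S) (N # map Proj [0..<k])) xs (r xs (n xs))"
    proof (rule ev_comp[where ys = "n xs # xs"])
      show "\<forall>i<length (N # map Proj [0..<k]). eval a ((N # map Proj [0..<k]) ! i) xs ((n xs # xs) ! i)"
        using l D[OF l] by (auto simp: nth_Cons N eval_proj split: nat.splits)
    qed (use l D rec in auto)
  qed
qed

lemma pr_rec:
  assumes "pr k z" "pr (Suc (Suc k)) s" "pr k n"
  shows "pr k (\<lambda>xs. rec_nat (z xs) (\<lambda>m y. s (y # m # xs)) (n xs))"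
  by (rule pr_on_rec) (use assms in \<open>auto elim: pr_on_subset\<close>)

lemma pr_on_mn:
  assumes p: "pr_on {n # xs | n xs. xs \<in> D} p" and ex: "\<And>xs. xs \<in> D \<Longrightarrow> \<exists>n. p (n # xs) = 0"
  shows "pr_on D (\<lambda>xs. LEAST n. p (n # xs) = 0)"
proof -
  obtain P where P: "\<And>a n xs. xs \<in> D \<Longrightarrow> eval a P (n # xs) (p (n # xs))"
    using p unfolding pr_on_def by blast
  show ?thesis
  proof (rule pr_onI[where R = "Mn P"])
    fix a and xs :: "nat list" assume l: "xs \<in> D"
    let ?n = "LEAST n. p (n # xs) = 0"
    have 0: "p (?n # xs) = 0" by (rule LeastI_ex[OF ex[OF l]])
    show "eval a (Mn P) xs ?n"
    proof (rule ev_mn)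
      show "eval a P (?n # xs) 0" using P[OF l, of _ ?n] 0 by simp
      show "\<forall>m<?n. \<exists>k. eval a P (m # xs) (Suc k)"
      proof (intro allI impI)
        fix m assume "m < ?n"
        then have "p (m # xs) \<noteq> 0" by (rule not_less_Least)
        then show "\<exists>k. eval a P (m # xs) (Suc k)"
          using P[OF l, of a m] by (metis not0_implies_Suc)
      qed
    qed
  qed
qed

lemma pr_const: "pr_on D (\<lambda>_. c)"
  by (induction c) (auto intro: pr_zero pr_suc)

lemma pr_add: assumes "pr_on D f" "pr_on D g" shows "pr_on D (\<lambda>xs. f xs + g xs)"
proof -
  have "pr 2 (\<lambda>xs. rec_nat (xs ! 0) (\<lambda>m y. Suc ((y # m # xs) ! 0)) (xs ! 1))"
    by (intro pr_rec pr_suc pr_proj) auto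
  moreover have "rec_nat a (\<lambda>m y. Suc y) b = a + b" for a b :: nat by (induction b) auto
  ultimately have "pr 2 (\<lambda>xs. xs ! 0 + xs ! 1)" by simp
  from pr_comp2[OF this assms] show ?thesis by simp
qed

lemma pr_diff: assumes "pr_on D f" "pr_on D g" shows "pr_on D (\<lambda>xs. f xs - g xs)"
proof -
  have "pr 1 (\<lambda>xs. rec_nat 0 (\<lambda>m y. (y # m # xs) ! 1) (xs ! 0))"
    by (intro pr_rec pr_zero pr_proj) auto
  moreover have "rec_nat 0 (\<lambda>m y. m) b = b - 1" for b :: nat by (cases b) auto
  ultimately have pred: "pr 1 (\<lambda>xs. xs ! 0 - 1)" by simp
  have "pr 2 (\<lambda>xs. rec_nat (xs ! 0) (\<lambda>m y. (\<lambda>zs. [zs ! 0] ! 0 - 1) (y # m # xs)) (xs ! 1))"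
    by (intro pr_rec pr_comp1[OF pred] pr_proj) auto
  moreover have "rec_nat a (\<lambda>m y. y - Suc 0) b = a - b" for a b :: nat by (induction b) auto
  ultimately have "pr 2 (\<lambda>xs. xs ! 0 - xs ! 1)" by simp
  from pr_comp2[OF this assms] show ?thesis by simp
qed

lemma pr_triangle: assumes "pr_on D f" shows "pr_on D (\<lambda>xs. triangle (f xs))"
proof -
  have "pr 1 (\<lambda>xs. rec_nat 0 (\<lambda>m y. (\<lambda>zs. zs ! 0 + Suc (zs ! 1)) (y # m # xs)) (xs ! 0))"
    by (intro pr_rec pr_zero pr_add pr_suc pr_proj) auto
  moreover have "rec_nat 0 (\<lambda>m y. y + Suc m) b = triangle b" for b :: nat
    by (induction b) (auto simp: triangle_Suc)
  ultimately have "pr 1 (\<lambda>xs. triangle (xs ! 0))" by simp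
  from pr_comp1[OF this assms] show ?thesis by simp
qed

text \<open>The number m + n of the diagonal of the pair coded by \<open>z\<close>: the least s with
  z < triangle (s + 1). The truncated difference is 0 exactly then, which is the form of condition
  that \<open>Mn\<close> searches for.\<close>

definition diag :: "nat \<Rightarrow> nat" where "diag z = (LEAST s. Suc z - triangle (Suc s) = 0)"

lemma triangle_mono: "m \<le> n \<Longrightarrow> triangle m \<le> triangle n"
  by (induction rule: dec_induct) auto

lemma diag_prod_encode: "diag (prod_encode (m, n)) = m + n"
  unfolding diag_def prod_encode_def
proof (rule Least_equality)
  show "Suc (case (m, n) of (m, n) \<Rightarrow> triangle (m + n) + m) - triangle (Suc (m + n)) = 0"
    by (simp add: triangle_Suc)
  fix s assume *: "Suc (case (m, n) of (m, n) \<Rightarrow> triangle (m + n) + m) - triangle (Suc s) = 0"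
  show "m + n \<le> s"
  proof (rule ccontr)
    assume "\<not> m + n \<le> s"
    then have "triangle (Suc s) \<le> triangle (m + n)" by (intro triangle_mono) simp
    with * show False by simp
  qed
qed

lemma pr_diag: assumes "pr_on D f" shows "pr_on D (\<lambda>xs. diag (f xs))"
proof -
  have "pr 1 (\<lambda>xs. LEAST n. (\<lambda>zs. Suc (zs ! 1) - triangle (Suc (zs ! 0))) (n # xs) = 0)"
  proof (rule pr_on_mn)
    fix xs :: "nat list"
    have "n \<le> triangle n" for n by (induction n) auto
    then show "\<exists>n. Suc ((n # xs) ! 1) - triangle (Suc ((n # xs) ! 0)) = 0"
      by (intro exI[of _ "xs ! 0"]) (metis diff_is_0_eq nth_Cons_0 nth_Cons_Suc One_nat_def)
  qed (intro pr_diff pr_suc pr_triangle pr_on_proj; auto)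
  then have "pr 1 (\<lambda>xs. diag (xs ! 0))" by (simp add: diag_def)
  from pr_comp1[OF this assms] show ?thesis by simp
qed

lemma pr_prod_encode: "pr_on D f \<Longrightarrow> pr_on D g \<Longrightarrow> pr_on D (\<lambda>xs. prod_encode (f xs, g xs))"
  unfolding prod_encode_def by (simp, intro pr_add pr_triangle)

lemma fst_prod_decode: "fst (prod_decode z) = z - triangle (diag z)"
  and snd_prod_decode: "snd (prod_decode z) = diag z - (z - triangle (diag z))"
proof -
  obtain m n where z: "z = prod_encode (m, n)" by (metis prod_decode_inverse surj_pair)
  show "fst (prod_decode z) = z - triangle (diag z)"
    "snd (prod_decode z) = diag z - (z - triangle (diag z))"
    using prod_encode_inverse[of "(m, n)"] unfolding z diag_prod_encode by (simp_all add: prod_encode_def)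
qed

lemma pr_fst: "pr_on D f \<Longrightarrow> pr_on D (\<lambda>xs. fst (prod_decode (f xs)))"
  unfolding fst_prod_decode by (intro pr_diff pr_triangle pr_diag)

lemma pr_snd: "pr_on D f \<Longrightarrow> pr_on D (\<lambda>xs. snd (prod_decode (f xs)))"
  unfolding snd_prod_decode by (intro pr_diff pr_triangle pr_diag)

text \<open>Codes need not exhaust the natural numbers; a program for \<open>f\<close> is constrained on codes only,
  and it must not depend on the sequence given to \<open>Orc\<close>.\<close>

class encd =
  fixes code :: "'a \<Rightarrow> nat"
  assumes inj_code: "inj code"

lemma code_eq_iff [simp]: "code x = code y \<longleftrightarrow> x = y"
  by (meson inj_code injD)

instantiation nat :: encd
begin
definition code_nat :: "nat \<Rightarrow> nat" where "code_nat n = n"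
instance by standard (simp add: inj_def code_nat_def)
end

instantiation bool :: encd
begin
definition code_bool :: "bool \<Rightarrow> nat" where "code_bool b = (if b then 1 else 0)"
instance by standard (simp add: inj_def code_bool_def)
end

instantiation prod :: (encd, encd) encd
begin
definition code_prod :: "'a \<times> 'b \<Rightarrow> nat" where
  "code_prod p = prod_encode (code (fst p), code (snd p))"
instance by standard (auto simp: inj_def code_prod_def)
end

instantiation option :: (encd) encd
begin
definition code_option :: "'a option \<Rightarrow> nat" where
  "code_option x = (case x of None \<Rightarrow> 0 | Some y \<Rightarrow> Suc (code y))"
instance by standard (auto simp: inj_def code_option_def split: option.splits)
end

instantiation list :: (encd) encd
begin
definition code_list :: "'a list \<Rightarrow> nat" where
  "code_list xs = list_encode (map code xs)"
instance proof
  have "inj (map (code :: 'a \<Rightarrow> nat))" by (simp add: inj_code)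
  then show "inj (code :: 'a list \<Rightarrow> nat)"
    unfolding inj_def code_list_def by (simp add: list_encode_eq)
qed
end

section \<open>Computability of functions between encoded types\<close>

definition computable :: "('a::encd \<Rightarrow> 'b::encd) \<Rightarrow> bool" where
  "computable f \<longleftrightarrow> (\<exists>R. \<forall>a x. eval a R [code x] (code (f x)))"

abbreviation codes :: "'a::encd itself \<Rightarrow> nat list set" where
  "codes _ \<equiv> range (\<lambda>x::'a. [code x])"

lemma comp_pr:
  fixes f :: "'a::encd \<Rightarrow> 'b::encd"
  assumes "pr_on (codes TYPE('a)) F" "\<And>x. F [code x] = code (f x)"
  shows "computable f"
  using assms unfolding computable_def pr_on_def by (metis rangeI)

text \<open>Composition with the inverse of \<open>code\<close> turns a typed function into one on
  argument lists, so the closure properties of \<open>pr_on\<close> apply to it.\<close>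

lemma comp_obtain:
  fixes f :: "'a::encd \<Rightarrow> 'b::encd"
  assumes "computable f"
  obtains F where "pr_on (codes TYPE('a)) F" "\<And>x. F [code x] = code (f x)"
proof -
  obtain R where R: "\<And>a x. eval a R [code x] (code (f x))"
    using assms unfolding computable_def by blast
  show ?thesis
  proof (rule that)
    show eq: "(\<lambda>xs. code (f (inv code (hd xs)))) [code x] = code (f x)" for x
      by (simp add: inv_f_f[OF inj_code])
    show "pr_on (codes TYPE('a)) (\<lambda>xs. code (f (inv code (hd xs))))"
      by (rule pr_onI[where R = R]) (use R eq in auto)
  qed
qed

named_theorems comp_intros

lemma comp_comp:
  fixes f :: "'a::encd \<Rightarrow> 'c::encd" and g :: "'c \<Rightarrow> 'b::encd"
  assumes "computable g" "computable f" shows "computable (\<lambda>x. g (f x))"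
proof -
  obtain F where F: "pr_on (codes TYPE('a)) F" "\<And>x. F [code x] = code (f x)"
    using comp_obtain[OF assms(2)] by blast
  obtain G where G: "pr_on (codes TYPE('c)) G" "\<And>x. G [code x] = code (g x)"
    using comp_obtain[OF assms(1)] by blast
  show ?thesis
  proof (rule comp_pr)
    show "pr_on (codes TYPE('a)) (\<lambda>xs. G [F xs])"
      by (rule pr_on_comp1[OF G(1) F(1)]) (auto simp: F(2))
    show "G [F [code x]] = code (g (f x))" for x by (simp add: F(2) G(2))
  qed
qed

lemma comp_codes: "computable f \<longleftrightarrow> computable (\<lambda>x. code (f x))"
  unfolding computable_def by (simp add: code_nat_def)

lemma comp_id [comp_intros]: "computable (\<lambda>x. x)"
  by (rule comp_pr[where F = "\<lambda>xs. xs ! 0"]) (auto intro!: pr_on_proj)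

lemma comp_const [comp_intros]: "computable (\<lambda>x. c)"
  by (rule comp_pr[where F = "\<lambda>xs. code c"]) (auto intro!: pr_const)

lemma comp_code [comp_intros]: "computable f \<Longrightarrow> computable (\<lambda>x. code (f x))"
  using comp_codes by blast

lemma comp_lift1:
  assumes "pr 1 F" "\<And>y. F [code y] = code (h y)" "computable f"
  shows "computable (\<lambda>x. h (f x))"
  by (rule comp_comp[OF comp_pr[of F h] assms(3)]) (auto intro: assms pr_on_subset[OF assms(1)])

lemma comp_lift2:
  fixes f :: "'a::encd \<Rightarrow> 'b::encd" and g :: "'a \<Rightarrow> 'c::encd" and h :: "'b \<Rightarrow> 'c \<Rightarrow> 'd::encd"
  assumes "pr 2 H" "\<And>y z. H [code y, code z] = code (h y z)" "computable f" "computable g"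
  shows "computable (\<lambda>x. h (f x) (g x))"
proof -
  obtain F where F: "pr_on (codes TYPE('a)) F" "\<And>x. F [code x] = code (f x)"
    using comp_obtain[OF assms(3)] by blast
  obtain G where G: "pr_on (codes TYPE('a)) G" "\<And>x. G [code x] = code (g x)"
    using comp_obtain[OF assms(4)] by blast
  show ?thesis
    by (rule comp_pr[OF pr_comp2[OF assms(1) F(1) G(1)]]) (simp add: F(2) G(2) assms(2))
qed

lemma comp_Pair [comp_intros]: "computable f \<Longrightarrow> computable g \<Longrightarrow> computable (\<lambda>x. (f x, g x))"
  by (rule comp_lift2[where H = "\<lambda>xs. prod_encode (xs ! 0, xs ! 1)" and h = "Pair" and f = f and g = g])
     (auto simp: code_prod_def intro!: pr_prod_encode pr_proj)

lemma comp_fst [comp_intros]: "computable f \<Longrightarrow> computable (\<lambda>x. fst (f x))"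
  by (rule comp_lift1[where F = "\<lambda>xs. fst (prod_decode (xs ! 0))" and h = "fst" and f = f])
     (auto simp: code_prod_def intro!: pr_fst pr_proj)

lemma comp_snd [comp_intros]: "computable f \<Longrightarrow> computable (\<lambda>x. snd (f x))"
  by (rule comp_lift1[where F = "\<lambda>xs. snd (prod_decode (xs ! 0))" and h = "snd" and f = f])
     (auto simp: code_prod_def intro!: pr_snd pr_proj)

lemma comp_Suc [comp_intros]: "computable f \<Longrightarrow> computable (\<lambda>x. Suc (f x))"
  by (rule comp_lift1[where F = "\<lambda>xs. Suc (xs ! 0)" and h = "Suc" and f = f])
     (auto simp: code_nat_def intro!: pr_suc pr_proj)

lemma comp_plus [comp_intros]: "computable f \<Longrightarrow> computable g \<Longrightarrow> computable (\<lambda>x. f x + g x :: nat)"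
  by (rule comp_lift2[where H = "\<lambda>xs. xs ! 0 + xs ! 1" and h = "(+)" and f = f and g = g])
     (auto simp: code_nat_def intro!: pr_add pr_proj)

lemma comp_minus [comp_intros]: "computable f \<Longrightarrow> computable g \<Longrightarrow> computable (\<lambda>x. f x - g x :: nat)"
  by (rule comp_lift2[where H = "\<lambda>xs. xs ! 0 - xs ! 1" and h = "(-)" and f = f and g = g])
     (auto simp: code_nat_def intro!: pr_diff pr_proj)

lemma comp_prod_decode [comp_intros]: "computable f \<Longrightarrow> computable (\<lambda>x. prod_decode (f x))"
  by (rule comp_lift1[where F = "\<lambda>xs. xs ! 0" and h = "prod_decode" and f = f])
     (auto simp: code_prod_def code_nat_def intro!: pr_proj)

lemma comp_eq [comp_intros]:
  fixes f :: "'a::encd \<Rightarrow> 'b::encd"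
  shows "computable f \<Longrightarrow> computable g \<Longrightarrow> computable (\<lambda>x. f x = g x)"
proof (rule comp_lift2[where H = "\<lambda>xs. 1 - ((xs ! 0 - xs ! 1) + (xs ! 1 - xs ! 0))"
      and h = "(=)" and f = f and g = g])
  fix y z :: 'b
  show "1 - (([code y, code z] ! 0 - [code y, code z] ! 1) + ([code y, code z] ! 1 - [code y, code z] ! 0)) =
        code (y = z)"
    using code_eq_iff[of y z] by (cases "code y" "code z" rule: linorder_cases) (auto simp: code_bool_def)
qed (auto intro!: pr_add pr_diff pr_const pr_proj)

lemma comp_le [comp_intros]: "computable f \<Longrightarrow> computable g \<Longrightarrow> computable (\<lambda>x. f x \<le> (g x :: nat))"
  by (rule comp_lift2[where H = "\<lambda>xs. 1 - (xs ! 0 - xs ! 1)" and h = "(\<le>)" and f = f and g = g])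
     (auto simp: code_nat_def code_bool_def intro!: pr_diff pr_const pr_proj)

lemma comp_less [comp_intros]: "computable f \<Longrightarrow> computable g \<Longrightarrow> computable (\<lambda>x. f x < (g x :: nat))"
  unfolding less_eq_Suc_le by (intro comp_intros)

text \<open>\<open>S\<close> repacks the list [y, m, code x] into the code of (x, m, y). Every list
  met in the recursion has this shape with y a code, so a specification of \<open>G\<close> on codes
  suffices.\<close>

lemma comp_rec_nat [comp_intros]:
  fixes g :: "'a::encd \<Rightarrow> nat \<Rightarrow> 'b::encd \<Rightarrow> 'b"
  assumes "computable (\<lambda>p. g (fst p) (fst (snd p)) (snd (snd p)))" "computable z" "computable n"
  shows "computable (\<lambda>x. rec_nat (z x) (g x) (n x))"
proof -
  let ?D = "codes TYPE('a)"
  obtain Z where Z: "pr_on ?D Z" "\<And>x. Z [code x] = code (z x)"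
    using comp_obtain[OF assms(2)] by blast
  obtain N where N: "pr_on ?D N" "\<And>x. N [code x] = n x"
    using comp_obtain[OF assms(3)] unfolding code_nat_def by blast
  obtain G where G: "pr_on (codes TYPE('a \<times> nat \<times> 'b)) G"
    "\<And>x. G [code x] = code (g (fst x) (fst (snd x)) (snd (snd x)))"
    using comp_obtain[OF assms(1)] by blast
  define S where "S zs = G [prod_encode (zs ! 2, prod_encode (zs ! 1, zs ! 0))]" for zs
  have S: "S [code y, m, code x] = code (g x m y)" for x m y
    using G(2)[of "(x, m, y)"] by (simp add: S_def code_prod_def code_nat_def)
  have r: "rec_nat (Z [code x]) (\<lambda>m y. S (y # m # [code x])) m = code (rec_nat (z x) (g x) m)" for x m
    by (induction m) (auto simp: Z S)
  have "pr_on {rec_nat (Z xs) (\<lambda>m y. S (y # m # xs)) m # m # xs | xs m. xs \<in> ?D} S"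
    unfolding S_def
  proof (rule pr_on_comp1[OF G(1)])
    fix xs assume "xs \<in> {rec_nat (Z xs) (\<lambda>m y. G [prod_encode ((y # m # xs) ! 2,
        prod_encode ((y # m # xs) ! 1, (y # m # xs) ! 0))]) m # m # xs | xs m. xs \<in> ?D}"
    then obtain x m where "xs = [code (rec_nat (z x) (g x) m), m, code x]"
      using r by (fastforce simp: S_def)
    then have "[prod_encode (xs ! 2, prod_encode (xs ! 1, xs ! 0))] = [code (x, m, rec_nat (z x) (g x) m)]"
      by (simp add: code_prod_def code_nat_def)
    then show "[prod_encode (xs ! 2, prod_encode (xs ! 1, xs ! 0))] \<in> codes TYPE('a \<times> nat \<times> 'b)"
      by blast
  qed (auto intro!: pr_prod_encode pr_on_proj)
  then have "pr_on ?D (\<lambda>xs. rec_nat (Z xs) (\<lambda>m y. S (y # m # xs)) (N xs))"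
    by (rule pr_on_rec[OF Z(1) N(1), where k = 1]) auto
  then show ?thesis by (rule comp_pr) (simp add: r N)
qed

lemma comp_Least [comp_intros]:
  fixes P :: "'a::encd \<Rightarrow> nat \<Rightarrow> bool"
  assumes "computable (\<lambda>p. P (fst p) (snd p))" "\<And>x. \<exists>n. P x n"
  shows "computable (\<lambda>x. LEAST n. P x n)"
proof -
  let ?D = "codes TYPE('a)"
  obtain F where F: "pr_on (codes TYPE('a \<times> nat)) F" "\<And>x. F [code x] = code (P (fst x) (snd x))"
    using comp_obtain[OF assms(1)] by blast
  define G where "G zs = 1 - F [prod_encode (zs ! 1, zs ! 0)]" for zs
  have G: "G [n, code x] = 0 \<longleftrightarrow> P x n" for x n
    using F(2)[of "(x, n)"] by (simp add: G_def code_prod_def code_nat_def code_bool_def)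
  have "pr_on {n # xs | n xs. xs \<in> ?D} G"
    unfolding G_def
  proof (rule pr_diff[OF pr_const], rule pr_on_comp1[OF F(1)])
    fix xs assume "xs \<in> {n # xs | n xs. xs \<in> ?D}"
    then obtain n and x :: 'a where "xs = [n, code x]" by auto
    then have "[prod_encode (xs ! 1, xs ! 0)] = [code (x, n)]"
      by (simp add: code_prod_def code_nat_def)
    then show "[prod_encode (xs ! 1, xs ! 0)] \<in> codes TYPE('a \<times> nat)" by blast
  qed (auto intro!: pr_prod_encode pr_on_proj)
  then have "pr_on ?D (\<lambda>xs. LEAST n. G (n # xs) = 0)"
    by (rule pr_on_mn) (use assms(2) in \<open>auto simp: G\<close>)
  then show ?thesis by (rule comp_pr) (simp add: G code_nat_def)
qed

lemma comp_If [comp_intros]: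
  fixes f g :: "'a::encd \<Rightarrow> 'b::encd"
  assumes "computable b" "computable f" "computable g"
  shows "computable (\<lambda>x. if b x then f x else g x)"
proof -
  \<comment> \<open>\<open>code (b x)\<close> is 0 or 1, so the recursion either returns
    \<open>g x\<close> at once or makes a single step to \<open>f x\<close>.\<close>
  have "computable (\<lambda>x. rec_nat (g x) (\<lambda>m y. f x) (code (b x)))"
    by (intro comp_intros assms comp_comp[OF assms(2)])
  moreover have "rec_nat (g x) (\<lambda>m y. f x) (code (b x)) = (if b x then f x else g x)" for x
    by (simp add: code_bool_def)
  ultimately show ?thesis by simp
qed

lemma comp_Not [comp_intros]: assumes "computable b" shows "computable (\<lambda>x. \<not> b x)"
proof -
  have "computable (\<lambda>x. if b x then False else True)" by (intro comp_intros assms)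
  moreover have "(if p then False else True) = (\<not> p)" for p by simp
  ultimately show ?thesis by (simp only:)
qed

lemma comp_conj [comp_intros]: assumes "computable b" "computable c" shows "computable (\<lambda>x. b x \<and> c x)"
proof -
  have "computable (\<lambda>x. if b x then c x else False)" by (intro comp_intros assms)
  moreover have "(if p then q else False) = (p \<and> q)" for p q by simp
  ultimately show ?thesis by (simp only:)
qed

lemma comp_disj [comp_intros]: assumes "computable b" "computable c" shows "computable (\<lambda>x. b x \<or> c x)"
proof -
  have "computable (\<lambda>x. if b x then True else c x)" by (intro comp_intros assms)
  moreover have "(if p then True else q) = (p \<or> q)" for p q by simp
  ultimately show ?thesis by (simp only:)
qed

lemma comp_imp [comp_intros]: assumes "computable b" "computable c" shows "computable (\<lambda>x. b x \<longrightarrow> c x)"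
  unfolding imp_conv_disj by (intro comp_intros assms)

lemma comp_mult [comp_intros]: assumes "computable f" "computable g" shows "computable (\<lambda>x. f x * g x :: nat)"
proof -
  have "computable (\<lambda>x. rec_nat 0 (\<lambda>m y. y + f x) (g x))"
    by (intro comp_intros assms comp_comp[OF assms(1)])
  moreover have "rec_nat 0 (\<lambda>m y. y + a) b = a * b" for a b :: nat by (induction b) auto
  ultimately show ?thesis by simp
qed

lemma comp_power [comp_intros]: assumes "computable f" "computable g" shows "computable (\<lambda>x. (f x :: nat) ^ g x)"
proof -
  have "computable (\<lambda>x. rec_nat 1 (\<lambda>m y. y * f x) (g x))"
    by (intro comp_intros assms comp_comp[OF assms(1)])
  moreover have "rec_nat 1 (\<lambda>m y. y * a) b = a ^ b" for a b :: nat by (induction b) auto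
  ultimately show ?thesis by simp
qed

lemma comp_ball [comp_intros]:
  fixes P :: "'a::encd \<Rightarrow> nat \<Rightarrow> bool"
  assumes "computable (\<lambda>p. P (fst p) (snd p))" "computable n"
  shows "computable (\<lambda>x. \<forall>i<n x. P x i)"
proof -
  have "computable (\<lambda>x. rec_nat True (\<lambda>i y. y \<and> P x i) (n x))"
    by (intro comp_intros assms(2) comp_comp[OF assms(1), where f = "\<lambda>p. (fst p, fst (snd p))", simplified])
  moreover have "rec_nat True (\<lambda>i y. y \<and> P x i) n \<longleftrightarrow> (\<forall>i<n. P x i)" for x n
    by (induction n) (auto simp: less_Suc_eq)
  ultimately show ?thesis by simp
qed

lemma comp_bex [comp_intros]:
  fixes P :: "'a::encd \<Rightarrow> nat \<Rightarrow> bool"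
  assumes "computable (\<lambda>p. P (fst p) (snd p))" "computable n"
  shows "computable (\<lambda>x. \<exists>i<n x. P x i)"
proof -
  have "computable (\<lambda>x. \<not> (\<forall>i<n x. \<not> P x i))" by (intro comp_intros assms)
  then show ?thesis by simp
qed

section \<open>Computability of list operations\<close>

lemma comp_Nil_eq: "code [] = 0" "code (x # xs) = Suc (prod_encode (code x, code xs))"
  by (simp_all add: code_list_def)

lemma comp_Cons [comp_intros]: "computable f \<Longrightarrow> computable g \<Longrightarrow> computable (\<lambda>x. f x # g x)"
  by (rule comp_lift2[where H = "\<lambda>xs. Suc (prod_encode (xs ! 0, xs ! 1))" and h = "(#)" and f = f and g = g])
     (auto simp: comp_Nil_eq intro!: pr_suc pr_prod_encode pr_proj)

lemma comp_tl [comp_intros]: assumes "computable l" shows "computable (\<lambda>x. tl (l x))"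
proof -
  have *: "code (tl l) = (if code l = 0 then 0 else snd (prod_decode (code l - 1)))" for l :: "'b list"
    by (cases l) (auto simp: comp_Nil_eq)
  show ?thesis
    by (subst comp_codes, subst *) (intro comp_intros assms)
qed

lemma comp_hd_default:
  assumes "computable l" shows "computable (\<lambda>x. case l x of [] \<Rightarrow> d | h # _ \<Rightarrow> h)"
proof -
  have *: "code (case l of [] \<Rightarrow> d | h # _ \<Rightarrow> h) =
      (if code l = 0 then code d else fst (prod_decode (code l - 1)))" for l
    by (cases l) (auto simp: comp_Nil_eq)
  show ?thesis
    by (subst comp_codes, subst *) (intro comp_intros assms)
qed

lemma comp_case_list [comp_intros]:
  fixes f :: "'a::encd \<Rightarrow> 'b::encd \<Rightarrow> 'b list \<Rightarrow> 'c::encd"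
  assumes "computable (\<lambda>p. f (fst p) (fst (snd p)) (snd (snd p)))" "computable z" "computable l"
  shows "computable (\<lambda>x. case l x of [] \<Rightarrow> z x | h # t \<Rightarrow> f x h t)"
proof -
  \<comment> \<open>Only total functions are composed, so the head of the empty list needs a value:
    \<open>undefined\<close> is some fixed element, and the test for the empty list discards what is
    computed from it.\<close>
  let ?g = "\<lambda>x. (x, case l x of [] \<Rightarrow> undefined | h # _ \<Rightarrow> h, tl (l x))"
  have "computable (\<lambda>x. f (fst (?g x)) (fst (snd (?g x))) (snd (snd (?g x))))"
    by (rule comp_comp[OF assms(1), of ?g]) (intro comp_intros comp_hd_default assms)
  then have "computable (\<lambda>x. if l x = [] then z x else f x (case l x of [] \<Rightarrow> undefined | h # _ \<Rightarrow> h) (tl (l x)))"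
    by (intro comp_intros assms) simp
  moreover have "(if l = [] then a else g (case l of [] \<Rightarrow> undefined | h # _ \<Rightarrow> h) (tl l)) =
      (case l of [] \<Rightarrow> a | h # t \<Rightarrow> g h t)" for l :: "'b list" and a :: 'c and g
    by (cases l) auto
  ultimately show ?thesis by simp
qed

lemma comp_Some [comp_intros]: "computable f \<Longrightarrow> computable (\<lambda>x. Some (f x))"
  by (rule comp_lift1[where F = "\<lambda>xs. Suc (xs ! 0)" and h = "Some" and f = f])
     (auto simp: code_option_def intro!: pr_suc pr_proj)

lemma comp_case_option [comp_intros]:
  fixes f :: "'a::encd \<Rightarrow> 'b::encd \<Rightarrow> 'c::encd"
  assumes "computable (\<lambda>p. f (fst p) (snd p))" "computable z" "computable l"
  shows "computable (\<lambda>x. case l x of None \<Rightarrow> z x | Some h \<Rightarrow> f x h)"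
proof -
  let ?d = "\<lambda>l. case l of None \<Rightarrow> undefined | Some h \<Rightarrow> h"
  have *: "code (?d l) = (if code l = 0 then code (undefined :: 'b) else code l - 1)" for l :: "'b option"
    by (cases l) (auto simp: code_option_def)
  have d: "computable (\<lambda>x. ?d (l x))"
    by (subst comp_codes, subst *) (intro comp_intros assms)
  have "computable (\<lambda>x. f (fst (x, ?d (l x))) (snd (x, ?d (l x))))"
    by (rule comp_comp[OF assms(1), of "\<lambda>x. (x, ?d (l x))"]) (intro comp_intros d)
  then have "computable (\<lambda>x. if l x = None then z x else f x (?d (l x)))"
    by (intro comp_intros assms) simp
  moreover have "(if l = None then a else g (?d l)) = (case l of None \<Rightarrow> a | Some h \<Rightarrow> g h)"
    for l :: "'b option" and a :: 'c and g
    by (cases l) auto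
  ultimately show ?thesis by simp
qed

text \<open>Gives a computable number of iterations that suffices to run through a list.\<close>

lemma length_le_code: "length l \<le> code l"
proof (induction l)
  case (Cons x l)
  then show ?case using le_prod_encode_2[of "code l" "code x"] by (simp add: comp_Nil_eq)
qed simp

lemma comp_foldl [comp_intros]:
  fixes g :: "'a::encd \<Rightarrow> 's::encd \<Rightarrow> 'b::encd \<Rightarrow> 's"
  assumes "computable (\<lambda>p. g (fst p) (fst (snd p)) (snd (snd p)))" "computable z" "computable l"
  shows "computable (\<lambda>x. foldl (g x) (z x) (l x))"
proof -
  \<comment> \<open>The state carries the unread part of the list and no longer changes once that
    part is empty, so iterating \<open>code (l x)\<close> times, possibly far too often, still
    yields the fold.\<close>
  define st where "st = (\<lambda>x (p :: 's \<times> 'b list). case snd p of [] \<Rightarrow> p | h # t \<Rightarrow> (g x (fst p) h, t))"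
  have st: "computable (\<lambda>p. st (fst p) (snd (snd p)))"
    unfolding st_def
    by (intro comp_intros
        comp_comp[OF assms(1), where f = "\<lambda>p. (fst (fst p), fst (snd (snd (fst p))), fst (snd p))", simplified])
  have "computable (\<lambda>x. fst (rec_nat (z x, l x) (\<lambda>m y. st x y) (code (l x))))"
    by (intro comp_intros assms st)
  moreover have "rec_nat (a, k) (\<lambda>m y. st x y) (length k + n) = (foldl (g x) a k, [])" for x a k n
  proof (induction k arbitrary: a)
    case Nil
    show ?case by (induction n) (auto simp: st_def)
  next
    case (Cons h t)
    have shift: "rec_nat c (\<lambda>m y. st x y) (Suc i) = rec_nat (st x c) (\<lambda>m y. st x y) i" for c i
      by (induction i) auto
    show ?case using Cons by (simp add: shift del: nat.rec(2)) (simp add: st_def)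
  qed
  then have "rec_nat (a, k) (\<lambda>m y. st x y) (code k) = (foldl (g x) a k, [])" for x a k
    using length_le_code[of k] by (metis le_Suc_ex)
  ultimately show ?thesis by simp
qed

lemma comp_rev [comp_intros]: assumes "computable l" shows "computable (\<lambda>x. rev (l x))"
proof -
  have "computable (\<lambda>x. foldl (\<lambda>s y. y # s) [] (l x))" by (intro comp_intros assms)
  moreover have "foldl (\<lambda>s y. y # s) t l = rev l @ t" for l t :: "'b list"
    by (induction l arbitrary: t) auto
  ultimately show ?thesis by simp
qed

lemma comp_append [comp_intros]:
  assumes "computable k" "computable l" shows "computable (\<lambda>x. k x @ l x)"
proof -
  have "computable (\<lambda>x. foldl (\<lambda>s y. y # s) (l x) (rev (k x)))" by (intro comp_intros assms)
  moreover have "foldl (\<lambda>s y. y # s) t l = rev l @ t" for l t :: "'b list"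
    by (induction l arbitrary: t) auto
  ultimately show ?thesis by simp
qed

lemma comp_rec_list [comp_intros]:
  fixes g :: "'a::encd \<Rightarrow> 'b::encd \<Rightarrow> 'b list \<Rightarrow> 's::encd \<Rightarrow> 's"
  assumes "computable (\<lambda>p. g (fst p) (fst (snd p)) (fst (snd (snd p))) (snd (snd (snd p))))" "computable z" "computable l"
  shows "computable (\<lambda>x. rec_list (z x) (g x) (l x))"
proof -
  \<comment> \<open>In a fold over the reversed list the part already read is the tail that
    \<open>rec_list\<close> hands to its step, so the state records it.\<close>
  have "computable (\<lambda>x. snd (foldl (\<lambda>s h. (h # fst s, g x h (fst s) (snd s))) ([], z x) (rev (l x))))"
    by (intro comp_intros assms
        comp_comp[OF assms(1), where f = "\<lambda>p. (fst p, snd (snd p), fst (fst (snd p)), snd (fst (snd p)))", simplified])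
  moreover have "foldl (\<lambda>s h. (h # fst s, g x h (fst s) (snd s))) ([], a) (rev k) = (k, rec_list a (g x) k)"
    for x a k
    by (induction k) auto
  ultimately show ?thesis by simp
qed

lemma comp_map [comp_intros]:
  fixes g :: "'a::encd \<Rightarrow> 'b::encd \<Rightarrow> 'c::encd"
  assumes "computable (\<lambda>p. g (fst p) (snd p))" "computable l"
  shows "computable (\<lambda>x. map (g x) (l x))"
proof -
  have "computable (\<lambda>x. rec_list [] (\<lambda>h t r. g x h # r) (l x))"
    by (intro comp_intros assms(2) comp_comp[OF assms(1), where f = "\<lambda>p. (fst p, fst (snd p))", simplified])
  moreover have "rec_list [] (\<lambda>h t r. f h # r) k = map f k" for f :: "'b \<Rightarrow> 'c" and k by (induction k) auto
  ultimately show ?thesis by simp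
qed

lemma comp_filter [comp_intros]:
  fixes g :: "'a::encd \<Rightarrow> 'b::encd \<Rightarrow> bool"
  assumes "computable (\<lambda>p. g (fst p) (snd p))" "computable l"
  shows "computable (\<lambda>x. filter (g x) (l x))"
proof -
  have "computable (\<lambda>x. rec_list [] (\<lambda>h t r. if g x h then h # r else r) (l x))"
    by (intro comp_intros assms(2) comp_comp[OF assms(1), where f = "\<lambda>p. (fst p, fst (snd p))", simplified])
  moreover have "rec_list [] (\<lambda>h t r. if f h then h # r else r) k = filter f k" for f and k :: "'b list"
    by (induction k) auto
  ultimately show ?thesis by simp
qed

lemma comp_concat [comp_intros]:
  assumes "computable l" shows "computable (\<lambda>x. concat (l x))"
proof -
  have "computable (\<lambda>x. rec_list [] (\<lambda>h t r. h @ r) (l x))" by (intro comp_intros assms)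
  moreover have "rec_list [] (\<lambda>h t r. h @ r) k = concat k" for k :: "'b list list" by (induction k) auto
  ultimately show ?thesis by simp
qed

lemma comp_length [comp_intros]:
  assumes "computable l" shows "computable (\<lambda>x. length (l x))"
proof -
  have "computable (\<lambda>x. rec_list 0 (\<lambda>h t r. Suc r) (l x))" by (intro comp_intros assms)
  moreover have "rec_list 0 (\<lambda>h t r. Suc r) k = length k" for k :: "'b list" by (induction k) auto
  ultimately show ?thesis by simp
qed

lemma comp_sum_list [comp_intros]:
  assumes "computable l" shows "computable (\<lambda>x. sum_list (l x) :: nat)"
proof -
  have "computable (\<lambda>x. rec_list 0 (\<lambda>h t r. h + r) (l x))" by (intro comp_intros assms)
  moreover have "rec_list 0 (\<lambda>h t r. h + r) k = sum_list k" for k :: "nat list" by (induction k) auto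
  ultimately show ?thesis by simp
qed

lemma comp_upt [comp_intros]:
  assumes "computable n" shows "computable (\<lambda>x. [0..<n x])"
proof -
  have "computable (\<lambda>x. rec_nat [] (\<lambda>m r. r @ [m]) (n x))" by (intro comp_intros assms)
  moreover have "rec_nat [] (\<lambda>m r. r @ [m]) k = [0..<k]" for k by (induction k) auto
  ultimately show ?thesis by simp
qed

lemma comp_list_ball [comp_intros]:
  fixes P :: "'a::encd \<Rightarrow> 'b::encd \<Rightarrow> bool"
  assumes "computable (\<lambda>p. P (fst p) (snd p))" "computable l"
  shows "computable (\<lambda>x. \<forall>y\<in>set (l x). P x y)"
proof -
  have "computable (\<lambda>x. rec_list True (\<lambda>h t r. P x h \<and> r) (l x))"
    by (intro comp_intros assms(2) comp_comp[OF assms(1), where f = "\<lambda>p. (fst p, fst (snd p))", simplified])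
  moreover have "rec_list True (\<lambda>h t r. f h \<and> r) k \<longleftrightarrow> (\<forall>y\<in>set k. f y)" for f and k :: "'b list"
    by (induction k) auto
  ultimately show ?thesis by simp
qed

subsection \<open>Strings\<close>

text \<open>\<open>enc\<close> is bijective binary numeration with digits 1 and 2, least significant
  digit first, and \<open>inc\<close> is addition of one with carry. Iterating it shows that
  \<open>enc\<close> is surjective and gives a program for \<open>dec\<close>.\<close>

primrec inc :: "bool list \<Rightarrow> bool list" where
  "inc [] = [False]"
| "inc (b # xs) = (if b then False # inc xs else True # xs)"

lemma enc_inc: "enc (inc xs) = Suc (enc xs)"
  by (induction xs) auto

lemma inj_enc: "inj enc"
proof (rule injI)
  fix x y show "enc x = enc y \<Longrightarrow> x = y"
  proof (induction x arbitrary: y)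
    case Nil
    then show ?case by (cases y) (auto split: if_splits)
  next
    case (Cons b x)
    then obtain c z where y: "y = c # z" by (cases y) (auto split: if_splits)
    from Cons.prems have "b = c \<and> enc x = enc z" unfolding y
      by (auto split: if_splits; presburger)
    with Cons.IH y show ?case by auto
  qed
qed

lemma dec_enc [simp]: "dec (enc x) = x"
  by (simp add: dec_def inj_enc)

lemma dec_rec_nat: "dec n = rec_nat [] (\<lambda>_. inc) n"
proof -
  have "enc (rec_nat [] (\<lambda>_. inc) n) = n" by (induction n) (auto simp: enc_inc)
  then show ?thesis by (metis dec_enc)
qed

lemma enc_dec [simp]: "enc (dec n) = n"
  unfolding dec_rec_nat by (induction n) (auto simp: enc_inc)

lemma enc_eq_iff [simp]: "enc x = enc y \<longleftrightarrow> x = y"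
  by (metis dec_enc)

lemma comp_enc [comp_intros]: assumes "computable l" shows "computable (\<lambda>x. enc (l x))"
proof -
  have "computable (\<lambda>x. rec_list 0 (\<lambda>b t r. 2 * r + (if b then 2 else 1 :: nat)) (l x))"
    by (intro comp_intros assms)
  moreover have "rec_list 0 (\<lambda>b t r. 2 * r + (if b then 2 else 1)) k = enc k" for k
    by (induction k) auto
  ultimately show ?thesis by simp
qed

lemma comp_dec [comp_intros]: assumes "computable n" shows "computable (\<lambda>x. dec (n x))"
proof -
  have "computable (\<lambda>x. rec_nat [] (\<lambda>m y. rec_list [False] (\<lambda>b t r. if b then False # r else True # t) y) (n x))"
    by (intro comp_intros assms)
  moreover have "rec_list [False] (\<lambda>b t r. if b then False # r else True # t) y = inc y" for y
    by (induction y) auto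
  ultimately show ?thesis by (simp add: dec_rec_nat)
qed

lemma length_le_enc: "length x \<le> enc x"
  by (induction x) auto

lemma enc_take_le: "enc (take i x) \<le> enc x"
proof (induction x arbitrary: i)
  case (Cons b x)
  then show ?case using Cons[of "i - 1"] by (cases i) auto
qed simp

definition orc :: "bool list \<Rightarrow> nat \<Rightarrow> bool" where
  "orc l i \<longleftrightarrow> i < length l \<and> l ! i"

lemma comp_orc [comp_intros]:
  assumes "computable l" "computable n" shows "computable (\<lambda>x. orc (l x) (n x))"
proof -
  have "computable (\<lambda>x. case rec_nat (l x) (\<lambda>m y. tl y) (n x) of [] \<Rightarrow> False | h # t \<Rightarrow> h)"
    by (intro comp_intros assms comp_comp[OF assms(1)])
  moreover have "rec_nat k (\<lambda>m y. tl y) i = drop i k" for k :: "bool list" and i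
    by (induction i) (auto simp: drop_Suc tl_drop)
  moreover have "(case drop i k of [] \<Rightarrow> False | h # t \<Rightarrow> h) = orc k i" for k i
    by (cases "i < length k") (auto simp: orc_def Cons_nth_drop_Suc[symmetric])
  ultimately show ?thesis by simp
qed

lemma comp_take [comp_intros]:
  fixes l :: "'a::encd \<Rightarrow> 'b::encd list"
  assumes "computable l" "computable n" shows "computable (\<lambda>x. take (n x) (l x))"
proof -
  have "computable (\<lambda>x. rev (foldl (\<lambda>s y. if length s < n x then y # s else s) [] (l x)))"
    by (intro comp_intros assms comp_comp[OF assms(2)])
  moreover have "foldl (\<lambda>s y. if length s < i then y # s else s) t k = rev (take (i - length t) k) @ t"
    for t k :: "'b list" and i
    by (induction k arbitrary: t) (auto simp: take_Cons')
  ultimately show ?thesis by simp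
qed

subsection \<open>Evaluation with bounded use\<close>

text \<open>The bound \<open>u\<close> limits both the queries and the values tried by \<open>Mn\<close>, so a halting computation
  is determined by the first \<open>u\<close> bits of the sequence.\<close>

primrec fe :: "recf \<Rightarrow> nat \<Rightarrow> (nat \<Rightarrow> bool) \<Rightarrow> nat list \<Rightarrow> nat option" where
  "fe Zero = (\<lambda>u a xs. Some 0)"
| "fe Succ = (\<lambda>u a xs. Some (Suc (arg xs 0)))"
| "fe (Proj i) = (\<lambda>u a xs. Some (arg xs i))"
| "fe (Comp f gs) = (\<lambda>u a xs. case those (map (\<lambda>h. h u a xs) (map fe gs)) of
      None \<Rightarrow> None | Some ys \<Rightarrow> fe f u a ys)"
| "fe (Prec f g) = (\<lambda>u a xs. case xs of [] \<Rightarrow> None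
    | n # ys \<Rightarrow> rec_nat (fe f u a ys)
        (\<lambda>m r. case r of None \<Rightarrow> None | Some y \<Rightarrow> fe g u a (y # m # ys)) n)"
| "fe (Mn f) = (\<lambda>u a xs.
    let n = (LEAST n. u \<le> n \<or> (case fe f u a (n # xs) of None \<Rightarrow> True | Some k \<Rightarrow> k = 0))
    in if n < u \<and> fe f u a (n # xs) = Some 0 then Some n else None)"
| "fe Orc = (\<lambda>u a xs. if arg xs 0 < u then Some (if a (arg xs 0) then 1 else 0) else None)"

text \<open>The search in the definition stops at \<open>u\<close> at the latest, and also at an
  undefined value, so its least witness exists and is computable; the test afterwards accepts only a
  genuine zero below \<open>u\<close>.\<close>

lemma fe_Mn_iff:
  "fe (Mn f) u a xs = Some n \<longleftrightarrow>
    n < u \<and> fe f u a (n # xs) = Some 0 \<and> (\<forall>m<n. \<exists>k. fe f u a (m # xs) = Some (Suc k))"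
proof -
  define P where "P n \<longleftrightarrow> u \<le> n \<or> (case fe f u a (n # xs) of None \<Rightarrow> True | Some k \<Rightarrow> k = 0)" for n
  have notP: "\<not> P m \<longleftrightarrow> m < u \<and> (\<exists>k. fe f u a (m # xs) = Some (Suc k))" for m
    unfolding P_def by (auto split: option.splits simp: not_le gr0_conv_Suc)
  have eq: "fe (Mn f) u a xs = (if (LEAST n. P n) < u \<and> fe f u a ((LEAST n. P n) # xs) = Some 0
      then Some (LEAST n. P n) else None)"
    by (simp add: P_def Let_def)
  show ?thesis
  proof
    assume "fe (Mn f) u a xs = Some n"
    then have "n = (LEAST n. P n)" "n < u" "fe f u a (n # xs) = Some 0"
      unfolding eq by (auto split: if_splits)
    moreover have "\<not> P m" if "m < n" for m using that \<open>n = _\<close> not_less_Least by blast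
    ultimately show "n < u \<and> fe f u a (n # xs) = Some 0 \<and> (\<forall>m<n. \<exists>k. fe f u a (m # xs) = Some (Suc k))"
      using notP by blast
  next
    assume *: "n < u \<and> fe f u a (n # xs) = Some 0 \<and> (\<forall>m<n. \<exists>k. fe f u a (m # xs) = Some (Suc k))"
    have "(LEAST n. P n) = n"
    proof (rule Least_equality)
      show "P n" using * by (simp add: P_def)
      show "n \<le> y" if "P y" for y
        using * notP[of y] that by (meson less_trans not_le)
    qed
    with * show "fe (Mn f) u a xs = Some n" unfolding eq by simp
  qed
qed

lemma those_map_iff:
  "those (map h gs) = Some ys \<longleftrightarrow> length ys = length gs \<and> (\<forall>i<length gs. h (gs ! i) = Some (ys ! i))"
proof (induction gs arbitrary: ys)
  case (Cons g gs)
  show ?case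
    by (cases ys) (auto split: option.splits simp: Cons All_less_Suc2 nth_Cons)
qed auto

lemma fe_Comp_iff:
  "fe (Comp f gs) u a xs = Some z \<longleftrightarrow> (\<exists>ys. length ys = length gs \<and>
    (\<forall>i<length gs. fe (gs ! i) u a xs = Some (ys ! i)) \<and> fe f u a ys = Some z)"
proof -
  have eq: "map (\<lambda>h. h u a xs) (map fe gs) = map (\<lambda>g. fe g u a xs) gs" by simp
  show ?thesis
    unfolding fe.simps eq
    by (cases "those (map (\<lambda>g. fe g u a xs) gs)")
       (use those_map_iff[of "\<lambda>g. fe g u a xs" gs] in \<open>fastforce, metis option.sel option.simps(5)\<close>)
qed

lemma fe_Prec_0: "fe (Prec f g) u a (0 # xs) = fe f u a xs"
  and fe_Prec_Suc: "fe (Prec f g) u a (Suc n # xs) = (case fe (Prec f g) u a (n # xs) of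
    None \<Rightarrow> None | Some y \<Rightarrow> fe g u a (y # n # xs))"
  by simp_all

lemma fe_mono:
  assumes "fe f u a xs = Some y" "u \<le> u'" "\<And>i. i < u \<Longrightarrow> a i = a' i"
  shows "fe f u' a' xs = Some y"
  using assms(1)
proof (induction f arbitrary: xs y)
  case (Comp f gs)
  then show ?case unfolding fe_Comp_iff by (metis nth_mem)
next
  case (Prec f g)
  show ?case
  proof (cases xs)
    case (Cons n ys)
    have "fe (Prec f g) u a (n # ys) = Some y \<Longrightarrow> fe (Prec f g) u' a' (n # ys) = Some y" for y
    proof (induction n arbitrary: y)
      case 0
      then show ?case using Prec.IH by (simp only: fe_Prec_0)
    next
      case (Suc n)
      then show ?case using Prec.IH(2) by (auto simp only: fe_Prec_Suc split: option.splits)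
    qed
    with Prec.prems Cons show ?thesis by blast
  qed (use Prec.prems in simp)
next
  case (Mn f)
  then show ?case using assms(2) unfolding fe_Mn_iff by (metis order_less_le_trans)
qed (use assms in \<open>auto split: if_splits\<close>)

lemma fe_max:
  assumes "fe f u a xs = Some y"
  shows "fe f (max u v) a xs = Some y" "fe f (max v u) a xs = Some y"
  by (rule fe_mono[OF assms]; simp)+

lemma fe_eval: "fe f u a xs = Some y \<Longrightarrow> eval a f xs y"
proof (induction f arbitrary: xs y)
  case (Comp f gs)
  then obtain ys where "length ys = length gs" "\<forall>i<length gs. fe (gs ! i) u a xs = Some (ys ! i)"
    "fe f u a ys = Some y" unfolding fe_Comp_iff by blast
  then show ?case using Comp.IH by (intro ev_comp[of ys]) auto
next
  case (Prec f g)
  show ?case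
  proof (cases xs)
    case (Cons n ys)
    have "fe (Prec f g) u a (n # ys) = Some y \<Longrightarrow> eval a (Prec f g) (n # ys) y" for y
    proof (induction n arbitrary: y)
      case 0
      then show ?case using Prec.IH by (auto simp only: fe_Prec_0 intro: ev_prec0)
    next
      case (Suc n)
      then show ?case using Prec.IH(2) by (auto simp only: fe_Prec_Suc split: option.splits intro: ev_precS)
    qed
    with Prec.prems Cons show ?thesis by blast
  qed (use Prec.prems in simp)
next
  case (Mn f)
  then show ?case unfolding fe_Mn_iff by (metis ev_mn)
next
  case Orc
  then show ?case using ev_orc[of a xs] by (auto split: if_splits)
qed (auto intro: ev_zero ev_succ ev_proj)

lemma uniform_bound:
  fixes Q :: "nat \<Rightarrow> nat \<Rightarrow> bool"
  assumes "\<And>i u u'. Q i u \<Longrightarrow> u \<le> u' \<Longrightarrow> Q i u'" "\<forall>i<n. \<exists>u. Q i u"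
  shows "\<exists>u. \<forall>i<n. Q i u"
  using assms(2)
proof (induction n)
  case (Suc n)
  then obtain u v where "\<forall>i<n. Q i u" "Q n v" by auto
  then have "\<forall>i<Suc n. Q i (max u v)" using assms(1) by (metis less_SucE max.cobounded1 max.cobounded2)
  then show ?case by blast
qed simp

lemma eval_fe: "eval a f xs y \<Longrightarrow> \<exists>u. fe f u a xs = Some y"
proof (induction rule: eval.induct)
  case (ev_orc xs)
  show ?case by (intro exI[of _ "Suc (arg xs 0)"]) simp
next
  case (ev_comp ys gs xs f z)
  have "\<exists>u. \<forall>i<length gs. fe (gs ! i) u a xs = Some (ys ! i)"
    by (rule uniform_bound) (use ev_comp fe_mono in blast)+
  then obtain u v where u: "\<forall>i<length gs. fe (gs ! i) u a xs = Some (ys ! i)" and "fe f v a ys = Some z"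
    using ev_comp by blast
  with u have "fe f (max u v) a ys = Some z" "\<forall>i<length gs. fe (gs ! i) (max u v) a xs = Some (ys ! i)"
    using u by (blast intro: fe_max)+
  then show ?case using ev_comp(1) unfolding fe_Comp_iff by blast
next
  case (ev_prec0 f xs y g)
  then show ?case by (simp only: fe_Prec_0)
next
  case (ev_precS f g n xs y z)
  then obtain u v where "fe (Prec f g) u a (n # xs) = Some y" "fe g v a (y # n # xs) = Some z" by blast
  then have "fe (Prec f g) (max u v) a (n # xs) = Some y" "fe g (max u v) a (y # n # xs) = Some z"
    by (blast intro: fe_max)+
  then have "fe (Prec f g) (max u v) a (Suc n # xs) = Some z" by (simp only: fe_Prec_Suc option.case)
  then show ?case by blast
next
  case (ev_mn f n xs)
  have "\<exists>u. \<forall>i<n. \<exists>k. fe f u a (i # xs) = Some (Suc k)"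
    by (rule uniform_bound) (use ev_mn fe_mono in blast)+
  then obtain u v where u: "\<forall>i<n. \<exists>k. fe f u a (i # xs) = Some (Suc k)" and v: "fe f v a (n # xs) = Some 0"
    using ev_mn by blast
  let ?m = "max (max u v) (Suc n)"
  have "fe (Mn f) ?m a xs = Some n"
    unfolding fe_Mn_iff
  proof (intro conjI allI impI)
    show "fe f ?m a (n # xs) = Some 0" using v by (rule fe_mono) auto
    fix i assume "i < n"
    then obtain k where "fe f u a (i # xs) = Some (Suc k)" using u by blast
    then have "fe f ?m a (i # xs) = Some (Suc k)" by (rule fe_mono) auto
    then show "\<exists>k. fe f ?m a (i # xs) = Some (Suc k)" by blast
  qed simp
  then show ?case by blast
qed auto

text \<open>Both results are values of \<open>fe\<close> at a common bound, and \<open>fe\<close> is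
  a function.\<close>

lemma eval_det: "eval a f xs y \<Longrightarrow> eval a f xs z \<Longrightarrow> y = z"
proof -
  assume "eval a f xs y" "eval a f xs z"
  then obtain u v where "fe f u a xs = Some y" "fe f v a xs = Some z" using eval_fe by blast
  then have "fe f (max u v) a xs = Some y" "fe f (max u v) a xs = Some z"
    by (blast intro: fe_max)+
  then show ?thesis by simp
qed

lemma comp_arg [comp_intros]: assumes "computable l" shows "computable (\<lambda>x. arg (l x) i)"
proof -
  have "computable (\<lambda>x. case rec_nat (l x) (\<lambda>m y. tl y) i of [] \<Rightarrow> 0 | h # t \<Rightarrow> h)"
    by (intro comp_intros assms comp_comp[OF assms(1)])
  moreover have "rec_nat k (\<lambda>m y. tl y) i = drop i k" for k :: "nat list" and i
    by (induction i) (auto simp: drop_Suc tl_drop)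
  moreover have "(case drop i k of [] \<Rightarrow> 0 | h # t \<Rightarrow> h) = arg k i" for k i
    by (cases "i < length k") (auto simp: arg_def Cons_nth_drop_Suc[symmetric])
  ultimately show ?thesis by simp
qed

lemma comp_those: "(\<And>g. g \<in> set gs \<Longrightarrow> computable (g :: 'a::encd \<Rightarrow> 'b::encd option)) \<Longrightarrow> computable (\<lambda>x. those (map (\<lambda>g. g x) gs))"
proof (induction gs)
  case (Cons g gs)
  define h where "h x = those (map (\<lambda>g. g x) gs)" for x
  have g: "computable g" and IH: "computable h"
    unfolding h_def[abs_def] using Cons by auto
  have "computable (\<lambda>x. case g x of None \<Rightarrow> None | Some y \<Rightarrow>
      (case h x of None \<Rightarrow> None | Some ys \<Rightarrow> Some (y # ys)))"
    by (intro comp_intros g comp_comp[OF IH])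
  moreover have "(case o1 of None \<Rightarrow> None | Some y \<Rightarrow> (case o2 of None \<Rightarrow> None | Some ys \<Rightarrow> Some (y # ys))) =
      (case o1 of None \<Rightarrow> None | Some y \<Rightarrow> map_option ((#) y) o2)" for o1 :: "'b option" and o2
    by (auto split: option.splits)
  ultimately have "computable (\<lambda>x. case g x of None \<Rightarrow> None | Some y \<Rightarrow> map_option ((#) y) (h x))"
    by simp
  then show ?case unfolding h_def by simp
qed (simp add: comp_const)

text \<open>A program cannot receive an infinite sequence as its argument. Hence computability is
  stated for the sequences \<open>orc l\<close> of finite strings; a run with bound \<open>u\<close>
  sees only \<open>u\<close> bits anyway.\<close>

lemma comp_fe_triple: "computable (\<lambda>p. fe f (fst p) (orc (fst (snd p))) (snd (snd p)))"
proof (induction f)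
  case (Comp f gs)
  have "computable (\<lambda>p. case those (map (\<lambda>h. h p) (map (\<lambda>g p. fe g (fst p) (orc (fst (snd p))) (snd (snd p))) gs)) of
      None \<Rightarrow> None | Some ys \<Rightarrow> fe f (fst p) (orc (fst (snd p))) ys)"
  proof (intro comp_case_option comp_those comp_const)
    show "computable (\<lambda>p. fe f (fst (fst p)) (orc (fst (snd (fst p)))) (snd p))"
      by (rule comp_comp[OF Comp(1), where f = "\<lambda>p. (fst (fst p), fst (snd (fst p)), snd p)", simplified])
        (intro comp_intros)
  qed (use Comp(2) in auto)
  then show ?case by (simp add: comp_def)
next
  case (Prec f g)
  have "computable (\<lambda>p. case snd (snd p) of [] \<Rightarrow> None
    | n # ys \<Rightarrow> rec_nat (fe f (fst p) (orc (fst (snd p))) ys)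
        (\<lambda>m r. case r of None \<Rightarrow> None | Some y \<Rightarrow> fe g (fst p) (orc (fst (snd p))) (y # m # ys)) n)"
    by (intro comp_intros
        comp_comp[OF Prec(1), where f = "\<lambda>p. (fst (fst p), fst (snd (fst p)), snd (snd p))", simplified]
        comp_comp[OF Prec(2), where f = "\<lambda>p. (fst (fst (fst (fst p))), fst (snd (fst (fst (fst p)))),
          snd p # fst (snd (fst p)) # snd (snd (fst (fst p))))", simplified])
  then show ?case by simp
next
  case (Mn f)
  have f: "computable (\<lambda>p. fe f (fst (fst p)) (orc (fst (snd (fst p)))) (snd p # snd (snd (fst p))))"
    by (rule comp_comp[OF Mn, where f = "\<lambda>p. (fst (fst p), fst (snd (fst p)), snd p # snd (snd (fst p)))", simplified])
       (intro comp_intros)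
  have "computable (\<lambda>p. let n = (LEAST n. fst p \<le> n \<or>
        (case fe f (fst p) (orc (fst (snd p))) (n # snd (snd p)) of None \<Rightarrow> True | Some k \<Rightarrow> k = 0))
    in if n < fst p \<and> fe f (fst p) (orc (fst (snd p))) (n # snd (snd p)) = Some 0 then Some n else None)"
    unfolding Let_def
    by (intro comp_intros f
        comp_comp[OF Mn, where f = "\<lambda>p. (fst p, fst (snd p), (h p :: nat) # snd (snd p))" for h, simplified]) auto
  then show ?case by simp
qed (simp, intro comp_intros)+

lemma comp_fe [comp_intros]:
  assumes "computable u" "computable l" "computable xs"
  shows "computable (\<lambda>x. fe f (u x) (orc (l x)) (xs x))"
  using comp_comp[OF comp_fe_triple, of "\<lambda>x. (u x, l x, xs x)"] assms
  by (simp add: comp_Pair)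

section \<open>Weights and descriptions\<close>

definition wt :: "nat list \<Rightarrow> real" where
  "wt l = (\<Sum>g\<leftarrow>l. (1/2) ^ g)"

lemma wt_simps [simp]: "wt [] = 0" "wt (g # l) = (1/2) ^ g + wt l" "wt (k @ l) = wt k + wt l"
  by (simp_all add: wt_def)

lemma wt_nonneg [simp]: "0 \<le> wt l"
  by (induction l) auto

text \<open>The weight in units of 2^-N, an integer as long as no exponent exceeds \<open>N\<close>.
  In this form weights can be compared by programs.\<close>

definition scale_wt :: "nat \<Rightarrow> nat list \<Rightarrow> nat" where
  "scale_wt N l = sum_list (map (\<lambda>g. 2 ^ (N - g)) l)"

lemma scale_wt: "(\<And>g. g \<in> set l \<Longrightarrow> g \<le> N) \<Longrightarrow> real (scale_wt N l) = wt l * 2 ^ N"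
proof (induction l)
  case (Cons g l)
  then have "(2::real) ^ (N - g) = (1/2) ^ g * 2 ^ N" by (simp add: power_diff field_simps)
  with Cons show ?case by (simp add: scale_wt_def algebra_simps)
qed (simp add: scale_wt_def)

lemma comp_scale_wt [comp_intros]:
  "computable N \<Longrightarrow> computable l \<Longrightarrow> computable (\<lambda>x. scale_wt (N x) (l x))"
  unfolding scale_wt_def
  by (intro comp_intros comp_comp[of N fst]) assumption+

lemma comp_wt_ge [comp_intros]:
  assumes "computable l" "computable R"
  shows "computable (\<lambda>x. (1/2) ^ R x \<le> wt (l x))"
proof -
  \<comment> \<open>The sum of all exponents involved bounds each of them, so it yields a common
    denominator.\<close>
  have "computable (\<lambda>x. 2 ^ (sum_list (l x) + R x - R x) \<le> scale_wt (sum_list (l x) + R x) (l x))"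
    by (intro comp_intros assms)
  moreover have "2 ^ (sum_list k + r - r) \<le> scale_wt (sum_list k + r) k \<longleftrightarrow> (1/2) ^ r \<le> wt k" for k r
  proof -
    have "real (scale_wt (sum_list k + r) k) = wt k * 2 ^ (sum_list k + r)"
      by (rule scale_wt) (simp add: member_le_sum_list trans_le_add1)
    moreover have "2 ^ (sum_list k + r - r) \<le> scale_wt (sum_list k + r) k \<longleftrightarrow>
        (2::real) ^ sum_list k \<le> real (scale_wt (sum_list k + r) k)"
      unfolding of_nat_le_iff[where 'a=real, symmetric] by simp
    ultimately show ?thesis by (simp add: power_add field_simps)
  qed
  ultimately show ?thesis by simp
qed

subsection \<open>Kraft's inequality and its converse\<close>

text \<open>Induction on the maximal length: division by the first bit leaves two prefix-free sets
  of shorter strings, each of which contributes half of its own sum.\<close>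

lemma kraft:
  fixes S :: "bool list set"
  assumes "finite S" "\<And>p q r. p \<in> S \<Longrightarrow> q \<in> S \<Longrightarrow> q = p @ r \<Longrightarrow> r = []"
  shows "(\<Sum>p\<in>S. (1/2) ^ length p) \<le> (1::real)"
proof -
  have "(\<Sum>p\<in>S. (1/2) ^ length p) \<le> (1::real)"
    if "\<forall>p\<in>S. length p \<le> n" "finite S" "\<And>p q r. p \<in> S \<Longrightarrow> q \<in> S \<Longrightarrow> q = p @ r \<Longrightarrow> r = []"
    for n and S :: "bool list set"
    using that
  proof (induction n arbitrary: S)
    case 0
    then have "S \<subseteq> {[]}" by auto
    then have "S = {} \<or> S = {[]}" by auto
    then show ?case by auto
  next
    case (Suc n)
    show ?case
    proof (cases "[] \<in> S")
      case True
      then have "S = {[]}" using Suc.prems(3)[OF True] by force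
      then show ?thesis by simp
    next
      case False
      define H where "H b = {p. b # p \<in> S}" for b :: bool
      have fin: "finite (H b)" for b
        using finite_vimageI[OF Suc.prems(2), of "(#) b"] by (simp add: H_def vimage_def)
      have S: "S = (#) True ` H True \<union> (#) False ` H False"
        using False by (auto simp: H_def image_iff) (metis (full_types) neq_Nil_conv)
      have le: "(\<Sum>p\<in>H b. (1/2) ^ length p) \<le> (1::real)" for b
      proof (rule Suc.IH[OF _ fin])
        show "\<forall>p\<in>H b. length p \<le> n" using Suc.prems(1) by (auto simp: H_def)
        show "r = []" if "p \<in> H b" "q \<in> H b" "q = p @ r" for p q r
          using Suc.prems(3)[of "b # p" "b # q" r] that by (auto simp: H_def)
      qed
      have half: "(\<Sum>p\<in>(#) b ` H b. (1/2) ^ length p) = (\<Sum>p\<in>H b. (1/2) ^ length p) / (2::real)" for b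
        by (subst sum.reindex) (auto simp: sum_divide_distrib)
      have "(\<Sum>p\<in>S. (1/2) ^ length p) =
          (\<Sum>p\<in>H True. (1/2) ^ length p) / 2 + (\<Sum>p\<in>H False. (1/2) ^ length p) / (2::real)"
        unfolding S by (subst sum.union_disjoint) (auto simp: fin half)
      with le[of True] le[of False] show ?thesis by simp
    qed
  qed
  from this[of S "Max (length ` S)"] assms show ?thesis by auto
qed

text \<open>Binary value, most significant bit first. A string p stands for the half-open interval
  of length 2^-|p| that starts at \<open>bval p\<close> / 2^|p|; the bounds in
  \<open>bval_append\<close> place the intervals of extensions inside it.\<close>

definition bval :: "bool list \<Rightarrow> nat" where
  "bval p = foldl (\<lambda>v b. 2 * v + (if b then 1 else 0)) 0 p"

lemma bval_snoc: "bval (p @ [b]) = 2 * bval p + (if b then 1 else 0)"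
  by (simp add: bval_def)

lemma bval_append: "bval p * 2 ^ length r \<le> bval (p @ r)" "bval (p @ r) < (bval p + 1) * 2 ^ length r"
proof (induction r rule: rev_induct)
  case (snoc b r)
  { case 1 show ?case using snoc by (simp add: bval_snoc flip: append_assoc) }
  { case 2 show ?case using snoc by (simp add: bval_snoc flip: append_assoc) }
qed simp_all

lemma bval_surj: "v < 2 ^ n \<Longrightarrow> \<exists>p. length p = n \<and> bval p = v"
proof (induction n arbitrary: v)
  case (Suc n)
  then obtain p where "length p = n" "bval p = v div 2" by (metis less_mult_imp_div_less power_Suc2)
  then show ?case by (intro exI[of _ "p @ [odd v]"]) (simp add: bval_snoc)
qed (simp add: bval_def)

text \<open>The value 0 stands for truth and the search variable comes first, as \<open>Mn\<close>
  expects.\<close>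

lemma computable_pair_recf:
  assumes "computable P"
  shows "\<exists>R. \<forall>a t w. eval a R [t, w] (if P (t, w) then 0 else 1)"
proof -
  obtain F where F: "pr_on (codes TYPE(nat \<times> nat)) F" "\<And>x. F [code x] = code (P x)"
    using comp_obtain[OF assms] by blast
  have "pr 2 (\<lambda>xs. 1 - F [prod_encode (xs ! 0, xs ! 1)])"
  proof (intro pr_diff pr_const pr_on_comp1[OF F(1)] pr_prod_encode pr_proj)
    fix xs :: "nat list"
    have "[prod_encode (xs ! 0, xs ! 1)] = [code (xs ! 0, xs ! 1)]"
      by (simp add: code_prod_def code_nat_def)
    then show "[prod_encode (xs ! 0, xs ! 1)] \<in> codes TYPE(nat \<times> nat)" by blast
  qed auto
  then obtain R where R: "\<And>a xs. length xs = 2 \<Longrightarrow> eval a R xs (1 - F [prod_encode (xs ! 0, xs ! 1)])"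
    unfolding pr_on_def by blast
  have "1 - F [prod_encode (t, w)] = (if P (t, w) then 0 else 1)" for t w
    using F(2)[of "(t, w)"] by (simp add: code_prod_def code_nat_def code_bool_def)
  then show ?thesis using R[of "[t, w]" for t w] by (intro exI[of _ R]) simp
qed

inductive_cases eval_CompE: "eval a (Comp f gs) xs z"
inductive_cases eval_MnE: "eval a (Mn f) xs n"

text \<open>The request at time \<open>t\<close> receives a dyadic subinterval of the half-open interval of length
  \<open>2 ^ -r t\<close> that begins at the total weight of the earlier requests; disjoint intervals make the
  programs prefix-free.\<close>

lemma request_machine:
  fixes act :: "nat \<Rightarrow> bool" and r x :: "nat \<Rightarrow> nat"
  assumes "computable act" "computable r" "computable x"
    and bound: "\<And>T. (\<Sum>t<T. if act t then (1/2) ^ r t else (0::real)) \<le> 1"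
  shows "\<exists>M. prefix_free_machine M \<and>
    (\<forall>t. act t \<longrightarrow> (\<exists>p. length p = Suc (r t) \<and> (\<forall>a. runs a M p (dec (x t)))))"
proof -
  define l where "l t = map r (filter act [0..<t])" for t
  define \<alpha> where "\<alpha> t = wt (l t)" for t
  have \<alpha>_Suc: "\<alpha> (Suc t) = \<alpha> t + (if act t then (1/2) ^ r t else 0)" for t
    by (simp add: \<alpha>_def l_def)
  have \<alpha>_sum: "\<alpha> t = (\<Sum>t<t. if act t then (1/2) ^ r t else (0::real))" for t
  proof (induction t)
    case 0 then show ?case by (simp add: \<alpha>_def l_def)
  qed (simp add: \<alpha>_Suc)
  have \<alpha>_mono: "\<alpha> s \<le> \<alpha> t" if "s \<le> t" for s t
    using that by (induction rule: dec_induct) (auto simp: \<alpha>_Suc intro: order_trans)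
  have \<alpha>_lt: "\<alpha> s + (1/2) ^ r s \<le> \<alpha> t" if "s < t" "act s" for s t
    using \<alpha>_mono[of "Suc s" t] that by (simp add: \<alpha>_Suc)
  \<comment> \<open>\<open>p\<close> names the first interval of the grid of mesh 2^-(r t + 1) that
    starts at or after \<alpha> t. Rounding up costs less than one mesh, so the interval stays
    within distance 2^-(r t) of \<alpha> t; this is what the extra bit of program length
    buys.\<close>
  define match where "match t p \<longleftrightarrow> act t \<and> length p = Suc (r t) \<and>
    \<alpha> t * 2 ^ Suc (r t) \<le> bval p \<and> bval p < \<alpha> t * 2 ^ Suc (r t) + 1" for t p
  have interval: "\<alpha> t \<le> bval (p @ q) / 2 ^ length (p @ q) \<and> bval (p @ q) / 2 ^ length (p @ q) < \<alpha> t + (1/2) ^ r t"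
    if "match t p" for t p q
  proof
    have len: "length p = Suc (r t)" using that by (simp add: match_def)
    have "\<alpha> t * 2 ^ length p * 2 ^ length q \<le> real (bval p) * 2 ^ length q"
      using that by (auto simp: match_def)
    also have "\<dots> \<le> bval (p @ q)" using bval_append(1)[of p q]
      unfolding of_nat_le_iff[where 'a=real, symmetric] by simp
    finally show "\<alpha> t \<le> bval (p @ q) / 2 ^ length (p @ q)"
      by (simp add: field_simps power_add)
    have "bval (p @ q) < (real (bval p) + 1) * 2 ^ length q" using bval_append(2)[of p q]
      unfolding of_nat_less_iff[where 'a=real, symmetric] by (simp add: algebra_simps)
    also have "\<dots> \<le> (\<alpha> t * 2 ^ length p + 2) * 2 ^ length q"
      using that by (auto simp: match_def)
    also have "\<dots> = (\<alpha> t + (1/2) ^ r t) * 2 ^ length (p @ q)"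
      by (simp add: len power_add field_simps)
    finally show "bval (p @ q) / 2 ^ length (p @ q) < \<alpha> t + (1/2) ^ r t"
      by (simp add: field_simps)
  qed
  have unique: "s = t" if "match s p" "match t (p @ q)" for s t p q
  proof (rule ccontr)
    assume "s \<noteq> t"
    then consider "s < t" | "t < s" by linarith
    then show False
    proof cases
      case 1
      then show ?thesis
        using \<alpha>_lt[of s t] interval[OF that(1), of q] interval[OF that(2), of "[]"] that by (auto simp: match_def)
    next
      case 2
      then show ?thesis
        using \<alpha>_lt[of t s] interval[OF that(1), of q] interval[OF that(2), of "[]"] that by (auto simp: match_def)
    qed
  qed
  \<comment> \<open>\<open>W\<close> and \<open>V\<close> are the two sides of the comparison in
    \<open>match\<close>, multiplied by a common denominator of \<alpha> t, so that the test is one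
    between integers.\<close>
  define W where "W t = scale_wt (sum_list (l t)) (l t) * 2 ^ Suc (r t)" for t
  define V where "V t w = bval (dec w) * 2 ^ sum_list (l t)" for t w
  have "computable (\<lambda>z. act (fst z) \<and> length (dec (snd z)) = Suc (r (fst z)) \<and>
      W (fst z) \<le> V (fst z) (snd z) \<and> V (fst z) (snd z) < W (fst z) + 2 ^ sum_list (l (fst z)))"
    unfolding W_def V_def l_def bval_def
    by (intro comp_intros comp_comp[OF assms(1)] comp_comp[OF assms(2)])
  also have "(\<lambda>z. act (fst z) \<and> length (dec (snd z)) = Suc (r (fst z)) \<and>
      W (fst z) \<le> V (fst z) (snd z) \<and> V (fst z) (snd z) < W (fst z) + 2 ^ sum_list (l (fst z))) =
     (\<lambda>z. match (fst z) (dec (snd z)))"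
  proof
    fix z :: "nat \<times> nat"
    obtain t w where z: "z = (t, w)" by fastforce
    define N where "N = sum_list (l t)"
    have X: "real (scale_wt N (l t)) = \<alpha> t * 2 ^ N"
      unfolding \<alpha>_def N_def by (rule scale_wt) (simp add: member_le_sum_list)
    have "scale_wt N (l t) * 2 ^ Suc (r t) \<le> v * 2 ^ N \<longleftrightarrow> \<alpha> t * 2 ^ Suc (r t) \<le> v" for v
    proof -
      have "scale_wt N (l t) * 2 ^ Suc (r t) \<le> v * 2 ^ N \<longleftrightarrow>
          real (scale_wt N (l t)) * 2 ^ Suc (r t) \<le> real v * 2 ^ N"
        unfolding of_nat_le_iff[where 'a=real, symmetric] by simp
      also have "\<dots> \<longleftrightarrow> (\<alpha> t * 2 ^ Suc (r t)) * 2 ^ N \<le> real v * 2 ^ N" by (simp add: X mult_ac)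
      also have "\<dots> \<longleftrightarrow> \<alpha> t * 2 ^ Suc (r t) \<le> real v" by (subst mult_le_cancel_right) simp
      finally show ?thesis .
    qed
    moreover have "v * 2 ^ N < scale_wt N (l t) * 2 ^ Suc (r t) + 2 ^ N \<longleftrightarrow> v < \<alpha> t * 2 ^ Suc (r t) + 1" for v
    proof -
      have "v * 2 ^ N < scale_wt N (l t) * 2 ^ Suc (r t) + 2 ^ N \<longleftrightarrow>
          real v * 2 ^ N < real (scale_wt N (l t)) * 2 ^ Suc (r t) + 2 ^ N"
        unfolding of_nat_less_iff[where 'a=real, symmetric] by simp
      also have "\<dots> \<longleftrightarrow> real v * 2 ^ N < (\<alpha> t * 2 ^ Suc (r t) + 1) * 2 ^ N" by (simp add: X algebra_simps)
      also have "\<dots> \<longleftrightarrow> real v < \<alpha> t * 2 ^ Suc (r t) + 1" by (rule mult_less_cancel_right_pos) simp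
      finally show ?thesis .
    qed
    ultimately show "(act (fst z) \<and> length (dec (snd z)) = Suc (r (fst z)) \<and>
      W (fst z) \<le> V (fst z) (snd z) \<and> V (fst z) (snd z) < W (fst z) + 2 ^ sum_list (l (fst z))) =
      match (fst z) (dec (snd z))"
      unfolding match_def z fst_conv snd_conv W_def V_def N_def[symmetric] by blast
  qed
  finally obtain F where F: "\<And>a t w. eval a F [t, w] (if match t (dec w) then 0 else 1)"
    using computable_pair_recf by fastforce
  obtain X where X: "\<And>a t. eval a X [t] (x t)"
    using assms(3) unfolding computable_def code_nat_def by blast
  \<comment> \<open>The machine searches for the request whose interval the program names; by
    \<open>unique\<close> there is at most one.\<close>
  define M where "M = Comp X [Mn F]"
  have runs_match: "\<exists>t. match t p" if "runs a M p y" for a p y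
  proof -
    from that obtain t where "eval a (Mn F) [enc p] t"
      unfolding runs_def M_def by (elim eval_CompE) auto
    then have "eval a F [t, enc p] 0" by (rule eval_MnE)
    with eval_det[OF F this] have "match t p" by (simp split: if_splits)
    then show ?thesis by blast
  qed
  have runs: "runs a M p (dec (x t))" if "match t p" for a t p
  proof -
    have "eval a (Mn F) [enc p] t"
    proof (rule ev_mn)
      show "eval a F [t, enc p] 0" using F[of a t "enc p"] that by simp
      show "\<forall>m<t. \<exists>k. eval a F [m, enc p] (Suc k)"
      proof (intro allI impI)
        fix m assume "m < t"
        then have "\<not> match m p" using unique[of m p t "[]"] that by auto
        then show "\<exists>k. eval a F [m, enc p] (Suc k)" using F[of a m "enc p"] by (intro exI[of _ 0]) simp
      qed
    qed
    then show ?thesis unfolding runs_def M_def by (intro ev_comp[of "[t]"]) (auto simp: X)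
  qed
  have "prefix_free_machine M"
    unfolding prefix_free_machine_def
  proof (intro allI impI)
    fix a p q y z and s :: "bool list"
    assume "runs a M p y" "runs a M q z" and q: "q = p @ s"
    then obtain t t' where "match t p" "match t' (p @ s)" using runs_match by blast
    moreover from this have "t = t'" by (rule unique)
    ultimately show "s = []" by (simp add: match_def)
  qed
  moreover have "\<exists>p. length p = Suc (r t) \<and> (\<forall>a. runs a M p (dec (x t)))" if "act t" for t
  proof -
    define v where "v = nat \<lceil>\<alpha> t * 2 ^ Suc (r t)\<rceil>"
    have "0 \<le> \<alpha> t" by (simp add: \<alpha>_def)
    then have v: "\<alpha> t * 2 ^ Suc (r t) \<le> v" "v < \<alpha> t * 2 ^ Suc (r t) + 1"
      unfolding v_def by (simp_all add: ceiling_correct of_nat_nat) linarith+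
    have "\<alpha> t + (1/2) ^ r t \<le> 1" using bound[of "Suc t"] that by (simp add: \<alpha>_sum)
    then have "(\<alpha> t + (1/2) ^ r t) * 2 ^ Suc (r t) \<le> 1 * 2 ^ Suc (r t)" by (rule mult_right_mono) simp
    moreover have "(1/2 :: real) ^ r t * 2 ^ Suc (r t) = 2" by (simp add: power_one_over)
    ultimately have "\<alpha> t * 2 ^ Suc (r t) + 2 \<le> 2 ^ Suc (r t)" by (simp only: distrib_right)
    with v have "real v < real (2 ^ Suc (r t))" by simp
    then have "v < 2 ^ Suc (r t)" by (simp only: of_nat_less_iff)
    then obtain p where "length p = Suc (r t)" "bval p = v" using bval_surj by blast
    with v that have "match t p" by (simp add: match_def)
    then show ?thesis using runs \<open>length p = _\<close> by blast
  qed
  ultimately show ?thesis by blast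
qed

section \<open>Optimal machines and sequences of requests\<close>

lemma Krel_le: "runs a U p x \<Longrightarrow> Krel U a x \<le> length p"
  unfolding Krel_def by (rule Least_le) blast

lemma optimal_requests:
  fixes act :: "nat \<Rightarrow> bool" and r x :: "nat \<Rightarrow> nat"
  assumes "optimal_machine U" "computable act" "computable r" "computable x"
    and "\<And>T. (\<Sum>t<T. if act t then (1/2) ^ r t else (0::real)) \<le> 1"
  shows "\<exists>c. \<forall>t a. act t \<longrightarrow> (\<exists>q. runs a U q (dec (x t)) \<and> length q \<le> r t + c)"
proof -
  obtain M where M: "prefix_free_machine M"
    "\<And>t. act t \<Longrightarrow> \<exists>p. length p = Suc (r t) \<and> (\<forall>a. runs a M p (dec (x t)))"
    using request_machine[OF assms(2-5)] by blast
  obtain c where c: "\<And>a p x. runs a M p x \<Longrightarrow> \<exists>q. runs a U q x \<and> length q \<le> length p + c"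
    using assms(1) M(1) unfolding optimal_machine_def by blast
  have "\<exists>q. runs a U q (dec (x t)) \<and> length q \<le> r t + Suc c" if "act t" for a t
    using M(2)[OF that] c by fastforce
  then show ?thesis by blast
qed

lemma optimal_Kc:
  fixes act :: "nat \<Rightarrow> bool" and r x :: "nat \<Rightarrow> nat"
  assumes "optimal_machine U" "computable act" "computable r" "computable x"
    and "\<And>T. (\<Sum>t<T. if act t then (1/2) ^ r t else (0::real)) \<le> 1"
  shows "\<exists>c. \<forall>t. act t \<longrightarrow> Kc U (dec (x t)) \<le> r t + c"
  using optimal_requests[OF assms] Krel_le unfolding Kc_def by (meson order_trans)

text \<open>\<open>Krel\<close> is a \<open>LEAST\<close>, which says nothing until a description is
  known to exist. Requesting the string with code t at exponent t + 1 has total weight below 1 and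
  supplies one for every string.\<close>

lemma Krel_attained:
  assumes "optimal_machine U"
  shows "\<exists>p. runs a U p x \<and> length p = Krel U a x"
proof -
  have "(\<Sum>t<T. if True then (1/2) ^ Suc t else (0::real)) \<le> 1" for T
  proof -
    have "(\<Sum>t<T. if True then (1/2) ^ Suc t else (0::real)) = 1 - (1/2) ^ T"
      by (induction T) (auto simp: field_simps)
    then show ?thesis by simp
  qed
  from optimal_requests[OF assms comp_const comp_Suc[OF comp_id] comp_id this]
  obtain q where "runs a U q (dec (enc x))" by blast
  then have "\<exists>n p. runs a U p x \<and> length p = n" by auto
  then show ?thesis unfolding Krel_def by (rule LeastI_ex)
qed

section \<open>Approximating a K-trivial sequence\<close>

lemma kraft_runs:
  assumes "prefix_free_machine U" "finite S" "\<And>p. p \<in> S \<Longrightarrow> \<exists>x. runs a U p x"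
  shows "(\<Sum>p\<in>S. (1/2) ^ length p) \<le> (1::real)"
proof (rule kraft[OF assms(2)])
  fix p q r assume "p \<in> S" "q \<in> S" "q = p @ r"
  then show "r = []"
    using assms(1,3) unfolding prefix_free_machine_def by metis
qed

abbreviation plen :: "nat \<Rightarrow> nat" where "plen w \<equiv> length (dec w)"

definition run :: "recf \<Rightarrow> nat \<Rightarrow> nat \<Rightarrow> nat option" where
  "run U s w = fe U s (orc []) [w]"

lemma comp_run [comp_intros]: "computable s \<Longrightarrow> computable w \<Longrightarrow> computable (\<lambda>x. run U (s x) (w x))"
  unfolding run_def by (intro comp_intros)

lemma run_mono: "run U s w = Some v \<Longrightarrow> s \<le> s' \<Longrightarrow> run U s' w = Some v"
  unfolding run_def by (erule fe_mono) auto

lemma orc_Nil: "orc [] = (\<lambda>_. False)"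
  by (auto simp: orc_def)

lemma run_runs: "run U s w = Some v \<Longrightarrow> runs (\<lambda>_. False) U (dec w) (dec v)"
  by (auto simp: run_def runs_def orc_Nil intro: fe_eval)

lemma runs_run: "runs (\<lambda>_. False) U p x \<Longrightarrow> \<exists>s. enc p < s \<and> run U s (enc p) = Some (enc x)"
proof -
  assume "runs (\<lambda>_. False) U p x"
  then obtain s where "run U s (enc p) = Some (enc x)"
    unfolding runs_def run_def orc_Nil using eval_fe by blast
  then have "run U (max s (Suc (enc p))) (enc p) = Some (enc x)" by (rule run_mono) simp
  moreover have "enc p < max s (Suc (enc p))" by simp
  ultimately show ?thesis by blast
qed

text \<open>A decidable approximation to complexity from above: \<open>s\<close> bounds both the
  programs tried and the running of each. For an optimal machine, complexity at most
  \<open>m\<close> means that some \<open>s\<close> succeeds.\<close>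

definition desc_le :: "recf \<Rightarrow> nat \<Rightarrow> nat \<Rightarrow> nat \<Rightarrow> bool" where
  "desc_le U s m v \<longleftrightarrow> (\<exists>w<s. plen w \<le> m \<and> run U s w = Some v)"

lemma comp_desc_le [comp_intros]:
  assumes "computable s" "computable m" "computable v"
  shows "computable (\<lambda>x. desc_le U (s x) (m x) (v x))"
proof -
  have "computable (\<lambda>p. desc_le U (fst p) (fst (snd p)) (snd (snd p)))"
    unfolding desc_le_def by (intro comp_intros)
  from comp_comp[OF this, of "\<lambda>x. (s x, m x, v x)"] show ?thesis
    using assms by (simp add: comp_Pair)
qed

lemma desc_le_mono: "desc_le U s m v \<Longrightarrow> s \<le> s' \<Longrightarrow> m \<le> m' \<Longrightarrow> desc_le U s' m' v"
  unfolding desc_le_def using run_mono order_less_le_trans[of _ s s'] order_trans[of _ m m'] by blast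

lemma desc_le_Kc: "desc_le U s m v \<Longrightarrow> Kc U (dec v) \<le> m"
  unfolding desc_le_def Kc_def using Krel_le[OF run_runs, of U s _ v] order_trans by blast

lemma Kc_desc_le:
  assumes "optimal_machine U" "Kc U (dec v) \<le> m"
  shows "\<exists>s. desc_le U s m v"
proof -
  obtain p where "runs (\<lambda>_. False) U p (dec v)" "length p \<le> m"
    using Krel_attained[OF assms(1), of "\<lambda>_. False" "dec v"] assms(2) unfolding Kc_def by force
  with runs_run[OF this(1)] show ?thesis
    unfolding desc_le_def by (metis dec_enc enc_dec)
qed

subsection \<open>The coding theorem for lengths\<close>

definition progs :: "recf \<Rightarrow> nat \<Rightarrow> nat \<Rightarrow> nat list" where
  "progs U s n = filter (\<lambda>w. case run U s w of None \<Rightarrow> False | Some v \<Rightarrow> plen v = n) [0..<s]"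

lemma set_progs: "set (progs U s n) = {w. w < s \<and> (\<exists>v. run U s w = Some v \<and> plen v = n)}"
  by (auto simp: progs_def split: option.splits)

lemma wt_map_distinct: "distinct l \<Longrightarrow> wt (map f l) = (\<Sum>w\<in>set l. (1/2) ^ f w)"
  by (simp add: wt_def sum_list_distinct_conv_sum_set)

text \<open>The weight of the programs known by stage \<open>s\<close> to print some string of
  length \<open>n\<close>.\<close>

definition lwt :: "recf \<Rightarrow> nat \<Rightarrow> nat \<Rightarrow> real" where
  "lwt U s n = wt (map plen (progs U s n))"

lemma lwt_sum: "lwt U s n = (\<Sum>w\<in>set (progs U s n). (1/2) ^ plen w)"
  unfolding lwt_def by (rule wt_map_distinct) (simp add: progs_def)

lemma lwt_mono: "s \<le> s' \<Longrightarrow> lwt U s n \<le> lwt U s' n"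
  unfolding lwt_sum by (rule sum_mono2) (auto simp: set_progs intro: run_mono)

lemma sum_lwt_le:
  assumes "prefix_free_machine U" "finite N"
  shows "(\<Sum>n\<in>N. lwt U s n) \<le> 1"
proof -
  have "(\<Sum>n\<in>N. lwt U s n) = (\<Sum>w\<in>(\<Union>n\<in>N. set (progs U s n)). (1/2) ^ plen w)"
    unfolding lwt_sum by (rule sum.UNION_disjoint[symmetric]) (use assms(2) in \<open>auto simp: set_progs\<close>)
  also have "\<dots> = (\<Sum>p\<in>dec ` (\<Union>n\<in>N. set (progs U s n)). (1/2) ^ length p)"
    by (subst sum.reindex) (auto intro: inj_on_inverseI[of _ enc])
  also have "\<dots> \<le> 1"
    by (rule kraft_runs[OF assms(1), where a = "\<lambda>_. False"]) (use assms(2) run_runs in \<open>fastforce simp: set_progs\<close>)+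
  finally show ?thesis .
qed

lemma sum_half_powers_le:
  assumes "finite R" "\<And>r. r \<in> R \<Longrightarrow> m \<le> r"
  shows "(\<Sum>r\<in>R. (1/2) ^ Suc r) \<le> ((1/2) ^ m :: real)"
proof -
  obtain M where M: "m \<le> M" "R \<subseteq> {m..<M}"
    using assms by (metis atLeastLessThan_iff finite_nat_set_iff_bounded le_cases less_le_trans subsetI)
  have "(\<Sum>r\<in>R. (1/2) ^ Suc r) \<le> (\<Sum>r=m..<M. (1/2) ^ Suc r :: real)"
    by (rule sum_mono2) (use M in auto)
  also have "\<dots> = (1/2) ^ m - (1/2) ^ M"
    using M(1) by (induction rule: dec_induct) (auto simp: sum.atLeastLessThan_Suc)
  finally show ?thesis by (smt (verit) zero_le_power zero_le_divide_1_iff)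
qed

text \<open>\<open>n\<close> is requested with exponent r + 1 at the first stage where the weight of
  its length reaches 2^-r. For fixed n these exponents are distinct, so their weights sum to at most
  the largest 2^-r, which the weight of length n dominates; over all n the latter sum to at most 1
  by Kraft's inequality.\<close>

lemma coding_theorem:
  assumes "optimal_machine U"
  shows "\<exists>c. \<forall>n r s. (1/2) ^ r \<le> lwt U s n \<longrightarrow> Kc U (dec n) \<le> r + c"
proof -
  have pf: "prefix_free_machine U" using assms by (simp add: optimal_machine_def)
  define P where "P n r s \<longleftrightarrow> (1/2) ^ r \<le> lwt U s n" for n r s
  define nn rr ss where "nn t = fst (prod_decode t)" and "rr t = fst (prod_decode (snd (prod_decode t)))"
    and "ss t = snd (prod_decode (snd (prod_decode t)))" for t
  define act where "act t \<longleftrightarrow> P (nn t) (rr t) (ss t) \<and> (\<forall>s<ss t. \<not> P (nn t) (rr t) s)" for t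
  have "computable act" "computable (\<lambda>t. Suc (rr t))" "computable nn"
    unfolding act_def P_def lwt_def progs_def nn_def rr_def ss_def
    by (intro comp_intros)+
  moreover have "(\<Sum>t<T. if act t then (1/2) ^ Suc (rr t) else (0::real)) \<le> 1" for T
  proof -
    define F where "F = {t. t < T \<and> act t}"
    have fin: "finite F" by (simp add: F_def)
    have le: "(1/2) ^ rr t \<le> lwt U T (nn t)" if "t \<in> F" for t
    proof -
      have "ss t \<le> t" unfolding ss_def
        by (metis le_prod_encode_2 order_trans prod.collapse prod_decode_inverse)
      then have "lwt U (ss t) (nn t) \<le> lwt U T (nn t)" using that by (intro lwt_mono) (simp add: F_def)
      then show ?thesis using that by (simp add: F_def act_def P_def)
    qed
    have inj: "inj_on rr {t \<in> F. nn t = n}" for n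
    proof (rule inj_onI)
      fix t t' assume t: "t \<in> {t \<in> F. nn t = n}" "t' \<in> {t \<in> F. nn t = n}" "rr t = rr t'"
      then have "ss t = ss t'" unfolding F_def act_def by (auto intro: linorder_cases[of "ss t" "ss t'"])
      with t have "prod_decode t = prod_decode t'"
        unfolding nn_def rr_def ss_def by (auto intro!: prod_eqI) (metis prod.collapse prod_decode_inverse)
      then show "t = t'" by (metis prod_decode_inverse)
    qed
    have "(\<Sum>t<T. if act t then (1/2) ^ Suc (rr t) else (0::real)) = (\<Sum>t\<in>F. (1/2) ^ Suc (rr t))"
      unfolding F_def by (subst sum.inter_filter[symmetric]) (auto intro!: sum.cong)
    also have "\<dots> = (\<Sum>n\<in>nn ` F. \<Sum>t\<in>{t \<in> F. nn t = n}. (1/2) ^ Suc (rr t))"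
      by (rule sum.image_gen[OF fin])
    also have "\<dots> \<le> (\<Sum>n\<in>nn ` F. lwt U T n)"
    proof (rule sum_mono)
      fix n assume n: "n \<in> nn ` F"
      define R where "R = rr ` {t \<in> F. nn t = n}"
      have R: "finite R" "R \<noteq> {}" using fin n by (auto simp: R_def)
      have "(\<Sum>t\<in>{t \<in> F. nn t = n}. (1/2) ^ Suc (rr t)) = (\<Sum>r\<in>R. (1/2) ^ Suc r :: real)"
        unfolding R_def by (simp add: sum.reindex[OF inj] o_def)
      also have "\<dots> \<le> (1/2) ^ Min R" using R by (intro sum_half_powers_le) auto
      also have "\<dots> \<le> lwt U T n"
        using Min_in[OF R] le by (auto simp: R_def)
      finally show "(\<Sum>t\<in>{t \<in> F. nn t = n}. (1/2) ^ Suc (rr t)) \<le> lwt U T n" .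
    qed
    also have "\<dots> \<le> 1" using fin by (intro sum_lwt_le[OF pf]) simp
    finally show ?thesis .
  qed
  ultimately obtain c where c: "\<And>t. act t \<Longrightarrow> Kc U (dec (nn t)) \<le> Suc (rr t) + c"
    using optimal_Kc[OF assms] by blast
  have "Kc U (dec n) \<le> r + Suc c" if "P n r s" for n r s
  proof -
    define s0 where "s0 = (LEAST s. P n r s)"
    have "P n r s0" "\<forall>s<s0. \<not> P n r s"
      unfolding s0_def using that by (auto intro: LeastI dest: not_less_Least)
    then show ?thesis using c[of "prod_encode (n, prod_encode (r, s0))"]
      by (simp add: act_def nn_def rr_def ss_def)
  qed
  then show ?thesis unfolding P_def by blast
qed

text \<open>Shortest programs of more than 2^(b + c + 1) such strings would give length n a weight
  of at least 2^(c + 1 - K(n)), and the coding theorem would then bring K(n) below itself.\<close>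

lemma few_low_complexity_strings:
  assumes "optimal_machine U"
  shows "\<exists>B. \<forall>n. \<forall>X \<subseteq> {x. length x = n \<and> Kc U x \<le> Kc U (dec n) + b}. finite X \<longrightarrow> card X \<le> B"
proof -
  have pf: "prefix_free_machine U" using assms by (simp add: optimal_machine_def)
  obtain c where c: "\<And>n r s. (1/2) ^ r \<le> lwt U s n \<Longrightarrow> Kc U (dec n) \<le> r + c"
    using coding_theorem[OF assms] by blast
  have "card X \<le> 2 ^ (b + c + 1)"
    if X: "X \<subseteq> {x. length x = n \<and> Kc U x \<le> Kc U (dec n) + b}" "finite X" for n X
  proof (rule ccontr)
    assume large: "\<not> ?thesis"
    define \<kappa> where "\<kappa> = Kc U (dec n)"
    obtain p where p: "runs (\<lambda>_. False) U (p x) x" "length (p x) = Kc U x" for x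
      using Krel_attained[OF assms] unfolding Kc_def by metis
    obtain S where S: "enc (p x) < S x" "run U (S x) (enc (p x)) = Some (enc x)" for x
      using runs_run[OF p(1)] by metis
    define s where "s = Max (S ` X)"
    have sub: "(enc \<circ> p) ` X \<subseteq> set (progs U s n)"
    proof
      fix w assume "w \<in> (enc \<circ> p) ` X"
      then obtain x where x: "x \<in> X" "w = enc (p x)" by auto
      then have "S x \<le> s" unfolding s_def using X(2) by simp
      then show "w \<in> set (progs U s n)"
        using S[of x] x X(1) run_mono[OF S(2) \<open>S x \<le> s\<close>] by (auto simp: set_progs)
    qed
    have inj: "inj_on (enc \<circ> p) X"
    proof (rule inj_onI)
      fix x y assume "(enc \<circ> p) x = (enc \<circ> p) y"
      then have "p x = p y" by simp
      then show "x = y" using p(1)[of x] p(1)[of y] unfolding runs_def by (metis eval_det enc_eq_iff)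
    qed
    have "real (card X) * (1/2) ^ (\<kappa> + b) = (\<Sum>x\<in>X. (1/2) ^ (\<kappa> + b))" by simp
    also have "\<dots> \<le> (\<Sum>x\<in>X. (1/2) ^ length (p x))"
      by (rule sum_mono, rule power_decreasing) (use X(1) in \<open>auto simp: p(2) \<kappa>_def\<close>)
    also have "\<dots> = (\<Sum>w\<in>(enc \<circ> p) ` X. (1/2) ^ plen w)"
      unfolding sum.reindex[OF inj] by simp
    also have "\<dots> \<le> lwt U s n"
      unfolding lwt_sum by (rule sum_mono2) (use sub in auto)
    finally have "real (card X) * (1/2) ^ (\<kappa> + b) \<le> lwt U s n" .
    moreover have "(2::real) ^ (b + c + 1) \<le> real (card X)"
      using large by (metis le_cases of_nat_le_iff of_nat_numeral of_nat_power)
    then have "2 ^ (b + c + 1) * (1/2) ^ (\<kappa> + b) \<le> real (card X) * (1/2) ^ (\<kappa> + b)"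
      by (rule mult_right_mono) simp
    ultimately have big: "2 ^ (b + c + 1) * (1/2) ^ (\<kappa> + b) \<le> lwt U s n" by linarith
    have "lwt U s n \<le> 1" using sum_lwt_le[OF pf, of "{n}"] by simp
    show False
    \<comment> \<open>The coding theorem needs a natural number as exponent; if K(n) is at most c,
      the weight would instead exceed 1.\<close>
    proof (cases "c + 1 \<le> \<kappa>")
      case True
      then obtain k where k: "\<kappa> = k + (c + 1)" by (metis add.commute le_Suc_ex)
      have "(1/2) ^ k = (2::real) ^ (b + c + 1) * (1/2) ^ (\<kappa> + b)"
        by (simp add: k power_add field_simps power_one_over)
      with big c[of k s n] k show False by (simp add: \<kappa>_def)
    next
      case False
      then obtain k where k: "c + 1 = \<kappa> + Suc k" by (metis add.commute less_iff_Suc_add not_le add_Suc)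
      have "(2::real) ^ (b + c + 1) * (1/2) ^ (\<kappa> + b) = 2 ^ (b + (c + 1)) * (1/2) ^ (\<kappa> + b)" by simp
      also have "\<dots> = 2 ^ Suc k" unfolding k by (simp add: power_add field_simps power_one_over)
      finally have "(2::real) ^ Suc k \<le> 1" using big \<open>lwt U s n \<le> 1\<close> by linarith
      moreover have "(1::real) \<le> 2 ^ k" by simp
      ultimately show False by simp
    qed
  qed
  then show ?thesis by blast
qed

subsection \<open>A K-trivial sequence is an isolated path\<close>

lemma length_initseg [simp]: "length (initseg a n) = n"
  by (simp add: initseg_def)

lemma take_initseg: "take i (initseg a n) = initseg a (min i n)"
  by (rule nth_equalityI) (auto simp: initseg_def)

lemma nth_initseg [simp]: "i < n \<Longrightarrow> initseg a n ! i = a i"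
  by (simp add: initseg_def)

text \<open>If no level isolates \<open>a\<close>, each n0 has a level g n0 such that arbitrarily
  long nodes follow \<open>a\<close> up to n0 but not up to g n0. Iterating g yields B + 1 nodes
  that leave \<open>a\<close> between successive levels; cut to a common length they remain
  distinct, against the bound on the width.\<close>

lemma isolated_path:
  assumes closed: "\<And>x i. x \<in> T \<Longrightarrow> take i x \<in> T"
    and width: "\<And>n X. X \<subseteq> {x \<in> T. length x = n} \<Longrightarrow> finite X \<Longrightarrow> card X \<le> B"
  shows "\<exists>n0. \<forall>n. \<exists>h. \<forall>x\<in>T. h \<le> length x \<longrightarrow> take n0 x = initseg a n0 \<longrightarrow> take n x = initseg a n"
proof (rule ccontr)
  assume "\<not> ?thesis"
  then obtain g where g: "\<And>n0 h. \<exists>x\<in>T. h \<le> length x \<and> take n0 x = initseg a n0 \<and> take (g n0) x \<noteq> initseg a (g n0)"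
    by metis
  have less: "n < g n" for n
  proof (rule ccontr)
    assume "\<not> n < g n"
    obtain x where x: "take n x = initseg a n" "take (g n) x \<noteq> initseg a (g n)" using g by blast
    from x(2) have "take (g n) (take n x) \<noteq> initseg a (g n)" using \<open>\<not> n < g n\<close> by (simp add: min_def)
    then show False unfolding x(1) take_initseg using \<open>\<not> n < g n\<close> by (simp add: min_def)
  qed
  define N where "N i = (g ^^ i) 0" for i
  have N_Suc: "N (Suc i) = g (N i)" for i by (simp add: N_def)
  have mono: "i \<le> j \<Longrightarrow> N i \<le> N j" for i j
    by (induction rule: dec_induct) (use less in \<open>auto simp: N_Suc intro: order_trans less_imp_le\<close>)
  define h where "h = N (Suc B)"
  obtain f where f: "\<And>i. f i \<in> T" "\<And>i. h \<le> length (f i)" "\<And>i. take (N i) (f i) = initseg a (N i)"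
    "\<And>i. take (N (Suc i)) (f i) \<noteq> initseg a (N (Suc i))"
    unfolding N_Suc using g[of h "N i" for i] by metis
  define t where "t i = take h (f i)" for i
  have take_t: "take (N i) (t j) = take (N i) (f j)" if "i \<le> Suc B" for i j
    using mono[OF that] by (simp add: t_def h_def min_absorb1)
  have neq: "t i \<noteq> t j" if "i < j" "j \<le> B" for i j
  proof
    assume "t i = t j"
    then have "take (N (Suc i)) (f i) = take (N (Suc i)) (f j)" using take_t[of "Suc i"] that by (metis Suc_leI le_SucI le_trans)
    also have "\<dots> = take (N (Suc i)) (take (N j) (f j))" using mono[of "Suc i" j] that by (simp add: min_absorb1)
    also have "\<dots> = initseg a (N (Suc i))" unfolding f(3) take_initseg using mono[of "Suc i" j] that by (simp add: min_absorb1)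
    finally show False using f(4) by blast
  qed
  then have "inj_on t {..B}" by (intro linorder_inj_onI) auto
  then have "card (t ` {..B}) = Suc B" by (simp add: card_image)
  moreover have "card (t ` {..B}) \<le> B"
    by (rule width[where n = h]) (use f closed in \<open>auto simp: t_def\<close>)
  ultimately show False by simp
qed

text \<open>The condition K(x|i) \<le> K(i) + b for all i, as far as it can be judged at stage
  \<open>s\<close>. It is not monotone in \<open>s\<close>, but prefixes of \<open>a\<close> satisfy
  it from some stage on, and strings that violate the true condition fail it from some stage
  on.\<close>

definition tree :: "recf \<Rightarrow> nat \<Rightarrow> nat \<Rightarrow> bool list \<Rightarrow> bool" where
  "tree U b s x \<longleftrightarrow> (\<forall>i<Suc (length x). \<forall>w<s. run U s w = Some i \<longrightarrow> desc_le U s (plen w + b) (enc (take i x)))"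

lemma comp_tree [comp_intros]:
  assumes "computable s" "computable x" shows "computable (\<lambda>z. tree U b (s z) (x z))"
proof -
  have "computable (\<lambda>p. tree U b (fst p) (snd p))"
    unfolding tree_def by (intro comp_intros)
  from comp_comp[OF this, of "\<lambda>z. (s z, x z)"] show ?thesis
    using assms by (simp add: comp_Pair)
qed

lemma tree_take: "tree U b s x \<Longrightarrow> tree U b s (take i x)"
  unfolding tree_def by (auto simp: min_def)

lemma tree_initseg:
  assumes "optimal_machine U" "\<And>n. Kc U (initseg a n) \<le> Kc U (dec n) + b"
  shows "\<exists>s0. \<forall>s\<ge>s0. tree U b s (initseg a n)"
proof -
  have "\<exists>s. desc_le U s (Kc U (dec i) + b) (enc (initseg a i))" for i
    using Kc_desc_le[OF assms(1)] assms(2) by simp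
  then have "\<exists>s0. \<forall>i<Suc n. desc_le U s0 (Kc U (dec i) + b) (enc (initseg a i))"
    by (intro uniform_bound) (auto intro: desc_le_mono)
  then obtain s0 where s0: "\<And>i. i < Suc n \<Longrightarrow> desc_le U s0 (Kc U (dec i) + b) (enc (initseg a i))" by blast
  have "tree U b s (initseg a n)" if "s0 \<le> s" for s
    unfolding tree_def
  proof (intro allI impI)
    fix i w assume i: "i < Suc (length (initseg a n))" and w: "w < s" "run U s w = Some i"
    then have "Kc U (dec i) \<le> plen w" by (auto intro!: desc_le_Kc simp: desc_le_def)
    then have "desc_le U s (plen w + b) (enc (initseg a i))"
      using desc_le_mono[OF s0[of i] that] i by simp
    then show "desc_le U s (plen w + b) (enc (take i (initseg a n)))"
      using i by (simp add: take_initseg min_absorb1)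
  qed
  then show ?thesis by blast
qed

lemma not_tree:
  assumes "optimal_machine U" "i \<le> length x" "\<not> Kc U (take i x) \<le> Kc U (dec i) + b"
  shows "\<exists>s0. \<forall>s\<ge>s0. \<not> tree U b s x"
proof -
  obtain s0 where "desc_le U s0 (Kc U (dec i)) i" using Kc_desc_le[OF assms(1)] by blast
  then obtain w where w: "w < s0" "plen w \<le> Kc U (dec i)" "run U s0 w = Some i"
    unfolding desc_le_def by blast
  have "\<not> tree U b s x" if "s0 \<le> s" for s
  proof
    assume "tree U b s x"
    then have "desc_le U s (plen w + b) (enc (take i x))"
      using w run_mono[OF w(3) that] that assms(2) unfolding tree_def by auto
    from desc_le_Kc[OF this] w(2) assms(3) show False by simp
  qed
  then show ?thesis by blast
qed

lemma finite_lists_length: "finite {x :: bool list. length x = n}"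
  using finite_lists_length_eq[of "UNIV :: bool set" n] by simp

text \<open>An isolating prefix of \<open>a\<close> is built into the programs as finite
  information. At late stages the initial part of a candidate, up to a large height, lies in the
  true tree \<open>T\<close>, where strings through the isolating prefix have to follow
  \<open>a\<close>; hence the candidates converge.\<close>

lemma K_trivial_approximation:
  assumes U: "optimal_machine U" and triv: "\<And>n. Kc U (initseg a n) \<le> Kc U (dec n) + b"
  obtains A :: "nat \<Rightarrow> bool list" and st :: "nat \<Rightarrow> nat" where
    "computable A" "computable st" "mono st" "\<And>j. j < st j" "\<And>j. j \<le> length (A j)"
    "\<And>n. \<exists>J. \<forall>j\<ge>J. take n (A j) = initseg a n"
    "\<And>i j m. i \<le> j \<Longrightarrow> desc_le U (st j) m i \<Longrightarrow> Kc U (take i (A j)) \<le> m + b"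
proof -
  define T where "T = {x. \<forall>i\<le>length x. Kc U (take i x) \<le> Kc U (dec i) + b}"
  obtain B where B: "\<And>n X. X \<subseteq> {x. length x = n \<and> Kc U x \<le> Kc U (dec n) + b} \<Longrightarrow> finite X \<Longrightarrow> card X \<le> B"
    using few_low_complexity_strings[OF U] by metis
  have T_take: "take i x \<in> T" if "x \<in> T" for x i
    using that by (auto simp: T_def min_def)
  have width: "card X \<le> B" if "X \<subseteq> {x \<in> T. length x = n}" "finite X" for n X
    by (rule B[of X n]) (use that in \<open>force simp: T_def\<close>)+
  have "\<exists>n0. \<forall>n. \<exists>h. \<forall>x\<in>T. h \<le> length x \<longrightarrow> take n0 x = initseg a n0 \<longrightarrow> take n x = initseg a n"
    by (rule isolated_path[of T B]) (use T_take width in blast)+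
  then obtain n0 where
    n0: "\<And>n. \<exists>h. \<forall>x\<in>T. h \<le> length x \<longrightarrow> take n0 x = initseg a n0 \<longrightarrow> take n x = initseg a n"
    by blast
  \<comment> \<open>The additional length \<open>n0\<close> makes room for the isolating prefix, so
    that every candidate passes through it.\<close>
  define cand where "cand s j x \<longleftrightarrow> length x = j + n0 \<and> take n0 x = initseg a n0 \<and> tree U b s x" for s j x
  define st where "st j = (LEAST s. \<exists>z<s. cand s j (dec z))" for j
  define A where "A j = dec (LEAST z. cand (st j) j (dec z))" for j
  have ex: "\<exists>s. \<exists>z<s. cand s j (dec z)" for j
  proof -
    obtain s0 where s0: "\<And>s. s \<ge> s0 \<Longrightarrow> tree U b s (initseg a (j + n0))"
      using tree_initseg[OF U triv] by blast
    have "cand (max s0 (Suc (enc (initseg a (j + n0))))) j (dec (enc (initseg a (j + n0))))"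
      using s0 by (simp add: cand_def take_initseg)
    then show ?thesis by (meson lessI max.strict_coboundedI2)
  qed
  have st: "\<exists>z<st j. cand (st j) j (dec z)" for j
    unfolding st_def by (rule LeastI_ex[OF ex])
  have A: "cand (st j) j (A j)" for j
    unfolding A_def using st[of j] by (metis (mono_tags, lifting) LeastI_ex)
  have c1: "computable st"
    unfolding st_def cand_def by (intro comp_intros, use ex in \<open>simp add: cand_def\<close>)
  have c2: "computable A"
    unfolding A_def cand_def
    by (intro comp_intros comp_comp[OF c1], use st in \<open>auto simp: cand_def\<close>)
  \<comment> \<open>Truncating a candidate for \<open>Suc j\<close> gives one for \<open>j\<close>
    whose code is no larger, hence still below the stage.\<close>
  have "st j \<le> st (Suc j)" for j
  proof -
    obtain z where z: "z < st (Suc j)" "cand (st (Suc j)) (Suc j) (dec z)" using st by blast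
    have "cand (st (Suc j)) j (take (j + n0) (dec z))"
      using z(2) by (auto simp: cand_def intro: tree_take)
    moreover have "enc (take (j + n0) (dec z)) < st (Suc j)"
      using enc_take_le[of "j + n0" "dec z"] z(1) by simp
    ultimately have "\<exists>z<st (Suc j). cand (st (Suc j)) j (dec z)" by (metis dec_enc)
    then show ?thesis unfolding st_def[of j] by (rule Least_le)
  qed
  then have mono: "mono st" by (simp add: mono_iff_le_Suc)
  have gt: "j < st j" for j
  proof -
    obtain z where z: "z < st j" "cand (st j) j (dec z)" using st by blast
    then show ?thesis using length_le_enc[of "dec z"] by (simp add: cand_def)
  qed
  have lim: "\<exists>J. \<forall>j\<ge>J. take n (A j) = initseg a n" for n
  proof -
    obtain h where h: "\<And>x. x \<in> T \<Longrightarrow> h \<le> length x \<Longrightarrow> take n0 x = initseg a n0 \<Longrightarrow> take n x = initseg a n"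
      using n0 by blast
    define H where "H = max h (max n n0)"
    have "\<exists>s0. x \<notin> T \<longrightarrow> (\<forall>s\<ge>s0. \<not> tree U b s x)" for x
      using not_tree[OF U, of _ x b] unfolding T_def by blast
    then obtain s0 where s0: "\<And>x s. x \<notin> T \<Longrightarrow> s0 x \<le> s \<Longrightarrow> \<not> tree U b s x"
      by metis
    \<comment> \<open>Only finitely many strings have length H, so from a common stage on all of
      them outside \<open>T\<close> are rejected; since j < st j, the stage used by A j is then late
      enough.\<close>
    define J where "J = max H (Max (s0 ` {x. length x = H}))"
    have "take n (A j) = initseg a n" if "J \<le> j" for j
    proof -
      define y where "y = take H (A j)"
      have y: "length y = H" "tree U b (st j) y" "take n0 y = initseg a n0" "take n y = take n (A j)"
        using A[of j] that by (auto simp: y_def cand_def J_def H_def intro: tree_take)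
      have "s0 y \<le> Max (s0 ` {x. length x = H})"
        by (rule Max_ge) (use y(1) finite_lists_length in auto)
      then have "s0 y \<le> st j" using that gt[of j] by (simp add: J_def)
      with s0 y have "y \<in> T" by blast
      from h[OF this] y show ?thesis by (simp add: H_def)
    qed
    then show ?thesis by blast
  qed
  have conf: "Kc U (take i (A j)) \<le> m + b" if ij: "i \<le> j" and le: "desc_le U (st j) m i" for i j m
  proof -
    obtain w where w: "w < st j" "plen w \<le> m" "run U (st j) w = Some i"
      using le by (auto simp: desc_le_def)
    then have "desc_le U (st j) (plen w + b) (enc (take i (A j)))"
      using A[of j] ij by (auto simp: cand_def tree_def)
    from desc_le_Kc[OF this] w(2) show ?thesis by simp
  qed
  show ?thesis
    by (rule that[OF c2 c1 mono gt _ lim conf]) (use A in \<open>auto simp: cand_def\<close>)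
qed

section \<open>The game\<close>

text \<open>A procedure of level \<open>lv\<close> wants to release weight \<open>2 ^ -goal\<close>.  A pair \<open>(g, E)\<close> records a
  finished call of weight \<open>2 ^ -g\<close> together with the requests \<open>(n, r)\<close> it collected; \<open>rel\<close> contains
  the released pairs and \<open>chs\<close> those still backing a computation \<open>v\<close>.  The computation served by
  the current call is \<open>sv\<close>, the number of dropped calls is \<open>drops\<close>, and \<open>sp\<close> lists the
  exponents of all requests made by calls that have ended.  A procedure of level 1 is a single
  request.  The stack starts with the outermost procedure.\<close>

datatype frame = Frame (lv: nat) (goal: nat) (rel: "(nat \<times> (nat \<times> nat) list) list")
  (chs: "(nat \<times> nat \<times> (nat \<times> nat) list) list") (drops: nat) (sv: "nat option") (sp: "nat list")

definition frame_tuple where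
  "frame_tuple f = (lv f, goal f, rel f, chs f, drops f, sv f, sp f)"

instantiation frame :: encd
begin
definition code_frame :: "frame \<Rightarrow> nat" where "code_frame f = code (frame_tuple f)"
instance by standard (auto simp: inj_def code_frame_def frame_tuple_def intro: frame.expand)
end

lemma comp_frame_tuple: "computable f \<Longrightarrow> computable (\<lambda>x. frame_tuple (f x))"
  by (rule comp_lift1[where F = "\<lambda>xs. xs ! 0" and h = frame_tuple and f = f])
     (auto simp: code_frame_def intro!: pr_proj)

lemma comp_frame_sel [comp_intros]:
  assumes "computable f"
  shows "computable (\<lambda>x. lv (f x))" "computable (\<lambda>x. goal (f x))" "computable (\<lambda>x. rel (f x))"
    "computable (\<lambda>x. chs (f x))" "computable (\<lambda>x. drops (f x))" "computable (\<lambda>x. sv (f x))"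
    "computable (\<lambda>x. sp (f x))"
proof -
  note t = comp_frame_tuple[OF assms]
  note s = comp_snd[OF t] comp_snd[OF comp_snd[OF t]] comp_snd[OF comp_snd[OF comp_snd[OF t]]]
    comp_snd[OF comp_snd[OF comp_snd[OF comp_snd[OF t]]]]
    comp_snd[OF comp_snd[OF comp_snd[OF comp_snd[OF comp_snd[OF t]]]]]
    comp_snd[OF comp_snd[OF comp_snd[OF comp_snd[OF comp_snd[OF comp_snd[OF t]]]]]]
  show "computable (\<lambda>x. lv (f x))" using comp_fst[OF t] by (simp add: frame_tuple_def)
  show "computable (\<lambda>x. goal (f x))" using comp_fst[OF s(1)] by (simp add: frame_tuple_def)
  show "computable (\<lambda>x. rel (f x))" using comp_fst[OF s(2)] by (simp add: frame_tuple_def)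
  show "computable (\<lambda>x. chs (f x))" using comp_fst[OF s(3)] by (simp add: frame_tuple_def)
  show "computable (\<lambda>x. drops (f x))" using comp_fst[OF s(4)] by (simp add: frame_tuple_def)
  show "computable (\<lambda>x. sv (f x))" using comp_fst[OF s(5)] by (simp add: frame_tuple_def)
  show "computable (\<lambda>x. sp (f x))" using s(6) by (simp add: frame_tuple_def)
qed

lemma comp_Frame [comp_intros]:
  assumes "computable a" "computable b" "computable c" "computable d" "computable e" "computable f" "computable g"
  shows "computable (\<lambda>x. Frame (a x) (b x) (c x) (d x) (e x) (f x) (g x))"
proof -
  have "computable (\<lambda>x. code (a x, b x, c x, d x, e x, f x, g x))"
    by (intro comp_intros assms)
  then show ?thesis
    by (subst comp_codes) (simp add: code_frame_def frame_tuple_def)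
qed

definition res :: "frame \<Rightarrow> (nat \<times> nat) list" where
  "res f = concat (map snd (rel f))"

definition relw :: "frame \<Rightarrow> real" where
  "relw f = wt (map fst (rel f))"

definition chw :: "(nat \<times> nat \<times> (nat \<times> nat) list) list \<Rightarrow> real" where
  "chw l = wt (map (\<lambda>c. fst (snd c)) l)"

definition cwt :: "frame \<Rightarrow> nat \<Rightarrow> real" where
  "cwt f v = chw (filter (\<lambda>c. fst c = v) (chs f))"

text \<open>A level-1 call requests the number of the stage at which it is made, which is fresh and
  will be at least the use of every computation served by the enclosing procedures. Its request
  counts as released from the start, so \<open>finished\<close> merely waits for the answer.\<close>

definition newf :: "nat \<Rightarrow> nat \<Rightarrow> nat \<Rightarrow> frame" where
  "newf j l R = (if l \<le> 1 then Frame 1 R [(R, [(j, R)])] [] 0 None [R] else Frame l R [] [] 0 None [])"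

definition cancel :: "frame \<Rightarrow> frame list \<Rightarrow> frame" where
  "cancel f rest = Frame (lv f) (goal f) (rel f) (chs f) (Suc (drops f)) None (sp f @ concat (map sp rest))"

definition credit :: "frame \<Rightarrow> nat \<Rightarrow> frame \<Rightarrow> frame list \<Rightarrow> frame" where
  "credit f v c rest = Frame (lv f) (goal f) (rel f) ((v, goal c, res c) # chs f) (drops f) None
     (sp f @ concat (map sp rest))"

lemma comp_newf [comp_intros]:
  "computable j \<Longrightarrow> computable l \<Longrightarrow> computable R \<Longrightarrow> computable (\<lambda>x. newf (j x) (l x) (R x))"
  unfolding newf_def by (intro comp_intros)

lemma comp_cancel [comp_intros]:
  "computable f \<Longrightarrow> computable r \<Longrightarrow> computable (\<lambda>x. cancel (f x) (r x))"
  unfolding cancel_def by (intro comp_intros)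

lemma comp_res [comp_intros]: "computable f \<Longrightarrow> computable (\<lambda>x. res (f x))"
  unfolding res_def by (intro comp_intros)

lemma comp_credit [comp_intros]:
  "computable f \<Longrightarrow> computable v \<Longrightarrow> computable c \<Longrightarrow> computable r \<Longrightarrow>
    computable (\<lambda>x. credit (f x) (v x) (c x) (r x))"
  unfolding credit_def by (intro comp_intros)

text \<open>\<open>stab j v\<close>: the use of \<open>v\<close> is the same prefix at stages \<open>j\<close> and \<open>j + 1\<close>; \<open>Q j v\<close>: the computation
  \<open>v\<close> halts along the approximation at stage \<open>j\<close>; \<open>ln v\<close>: the length of its program;
  \<open>kn j n m\<close>: by stage \<open>j\<close> the number \<open>n\<close> has a description of length at most \<open>m\<close>.\<close>

locale game =
  fixes stab :: "nat \<Rightarrow> nat \<Rightarrow> bool" and Q :: "nat \<Rightarrow> nat \<Rightarrow> bool"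
    and ln :: "nat \<Rightarrow> nat" and kn :: "nat \<Rightarrow> nat \<Rightarrow> nat \<Rightarrow> bool"
begin

text \<open>The approximation has left the use of the unstable computations; the requests that
  backed them gain a string and are released.\<close>

definition prune :: "nat \<Rightarrow> frame \<Rightarrow> frame" where
  "prune j f = Frame (lv f) (goal f) (rel f @ map snd (filter (\<lambda>c. \<not> stab j (fst c)) (chs f)))
     (filter (\<lambda>c. stab j (fst c)) (chs f)) (drops f) (sv f) (sp f)"

definition full :: "nat \<Rightarrow> frame \<Rightarrow> nat \<Rightarrow> bool" where
  "full h f v \<longleftrightarrow> (1/2) ^ (goal f + h + ln v) \<le> cwt f v"

definition finished :: "nat \<Rightarrow> nat \<Rightarrow> frame \<Rightarrow> bool" where
  "finished d j f \<longleftrightarrow> (1/2) ^ goal f \<le> relw f \<and> (\<forall>x\<in>set (res f). kn j (fst x) (snd x + d))"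

text \<open>The value \<open>Suc j\<close> signals that no computation with code up to j both halts
  and still needs weight; it also makes the search terminate.\<close>

definition pick :: "nat \<Rightarrow> nat \<Rightarrow> frame \<Rightarrow> nat" where
  "pick h j f = (LEAST i. j < i \<or> Q j i \<and> \<not> full h f i)"

text \<open>Each dropped call halves the weight of the later calls; hence dropped calls waste little in total.\<close>

definition spawn :: "nat \<Rightarrow> nat \<Rightarrow> frame \<Rightarrow> frame list" where
  "spawn h j f = (if lv f \<le> 1 \<or> j < pick h j f then [f] else
     [Frame (lv f) (goal f) (rel f) (chs f) (drops f) (Some (pick h j f)) (sp f),
      newf j (lv f - 1) (goal f + h + ln (pick h j f) + drops f + 1)])"

text \<open>Frames are visited from the outermost one. The first whose computation has changed, or
  whose call has finished, discards all frames after it. Only the last frame can make a call, so at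
  most one request is made per stage.\<close>

primrec step :: "nat \<Rightarrow> nat \<Rightarrow> nat \<Rightarrow> frame list \<Rightarrow> frame list" where
  "step h d j [] = []"
| "step h d j (f # rest) = (case sv f of None \<Rightarrow> spawn h (Suc j) (prune j f)
    | Some v \<Rightarrow> if \<not> stab j v then [cancel (prune j f) rest]
       else case rest of [] \<Rightarrow> [prune j f]
         | c # cs \<Rightarrow> if finished d (Suc j) c then [credit (prune j f) v c rest]
                     else prune j f # step h d j rest)"

primrec stack :: "nat \<Rightarrow> nat \<Rightarrow> nat \<Rightarrow> nat \<Rightarrow> frame list" where
  "stack k h d 0 = [newf 0 k 1]"
| "stack k h d (Suc j) = step h d j (stack k h d j)"

end

locale computable_game = game +
  assumes comp_stab: "computable (\<lambda>p. stab (fst p) (snd p))"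
    and comp_Q: "computable (\<lambda>p. Q (fst p) (snd p))"
    and comp_ln: "computable ln"
    and comp_kn: "computable (\<lambda>p. kn (fst p) (fst (snd p)) (snd (snd p)))"
begin

lemma comp_stab' [comp_intros]: "computable j \<Longrightarrow> computable v \<Longrightarrow> computable (\<lambda>x. stab (j x) (v x))"
  using comp_comp[OF comp_stab, of "\<lambda>x. (j x, v x)"] by (simp add: comp_Pair)

lemma comp_Q' [comp_intros]: "computable j \<Longrightarrow> computable v \<Longrightarrow> computable (\<lambda>x. Q (j x) (v x))"
  using comp_comp[OF comp_Q, of "\<lambda>x. (j x, v x)"] by (simp add: comp_Pair)

lemma comp_ln' [comp_intros]: "computable v \<Longrightarrow> computable (\<lambda>x. ln (v x))"
  using comp_comp[OF comp_ln] .

lemma comp_kn' [comp_intros]: "computable j \<Longrightarrow> computable n \<Longrightarrow> computable m \<Longrightarrow> computable (\<lambda>x. kn (j x) (n x) (m x))"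
  using comp_comp[OF comp_kn, of "\<lambda>x. (j x, n x, m x)"] by (simp add: comp_Pair)

lemma comp_prune [comp_intros]:
  assumes "computable j" "computable f" shows "computable (\<lambda>x. prune (j x) (f x))"
proof -
  have "computable (\<lambda>p. prune (fst p) (snd p))" unfolding prune_def by (intro comp_intros)
  from comp_comp[OF this, of "\<lambda>x. (j x, f x)"] assms show ?thesis by (simp add: comp_Pair)
qed

lemma comp_full [comp_intros]:
  assumes "computable h" "computable f" "computable v" shows "computable (\<lambda>x. full (h x) (f x) (v x))"
proof -
  have "computable (\<lambda>p. full (fst p) (fst (snd p)) (snd (snd p)))"
    unfolding full_def cwt_def chw_def by (intro comp_intros)
  from comp_comp[OF this, of "\<lambda>x. (h x, f x, v x)"] assms show ?thesis by (simp add: comp_Pair)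
qed

lemma comp_finished [comp_intros]:
  assumes "computable d" "computable j" "computable f" shows "computable (\<lambda>x. finished (d x) (j x) (f x))"
proof -
  have "computable (\<lambda>p. finished (fst p) (fst (snd p)) (snd (snd p)))"
    unfolding finished_def relw_def by (intro comp_intros)
  from comp_comp[OF this, of "\<lambda>x. (d x, j x, f x)"] assms show ?thesis by (simp add: comp_Pair)
qed

lemma comp_pick [comp_intros]:
  assumes "computable h" "computable j" "computable f" shows "computable (\<lambda>x. pick (h x) (j x) (f x))"
proof -
  have "computable (\<lambda>p. pick (fst p) (fst (snd p)) (snd (snd p)))"
    unfolding pick_def by (intro comp_intros) auto
  from comp_comp[OF this, of "\<lambda>x. (h x, j x, f x)"] assms show ?thesis by (simp add: comp_Pair)
qed

lemma comp_spawn [comp_intros]: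
  "computable h \<Longrightarrow> computable j \<Longrightarrow> computable f \<Longrightarrow> computable (\<lambda>x. spawn (h x) (j x) (f x))"
  unfolding spawn_def by (intro comp_intros)

lemma step_rec: "step h d j l = rec_list [] (\<lambda>f rest r. case sv f of None \<Rightarrow> spawn h (Suc j) (prune j f)
    | Some v \<Rightarrow> if \<not> stab j v then [cancel (prune j f) rest]
       else case rest of [] \<Rightarrow> [prune j f]
         | c # cs \<Rightarrow> if finished d (Suc j) c then [credit (prune j f) v c rest]
                     else prune j f # r) l"
  by (induction l) (auto split: option.splits list.splits)

lemma stack_rec: "stack k h d j = rec_nat [newf 0 k 1] (\<lambda>j S. step h d j S) j"
  by (induction j) auto

lemma comp_step [comp_intros]:
  assumes "computable h" "computable d" "computable j" "computable l"
  shows "computable (\<lambda>x. step (h x) (d x) (j x) (l x))"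
proof -
  have "computable (\<lambda>p. step (fst p) (fst (snd p)) (fst (snd (snd p))) (snd (snd (snd p))))"
    unfolding step_rec by (intro comp_intros)
  from comp_comp[OF this, of "\<lambda>x. (h x, d x, j x, l x)"] assms show ?thesis by (simp add: comp_Pair)
qed

lemma comp_stack:
  assumes "computable k" "computable h" "computable d" "computable j"
  shows "computable (\<lambda>x. stack (k x) (h x) (d x) (j x))"
proof -
  have "computable (\<lambda>p. stack (fst p) (fst (snd p)) (fst (snd (snd p))) (snd (snd (snd p))))"
    unfolding stack_rec by (intro comp_intros)
  from comp_comp[OF this, of "\<lambda>x. (k x, h x, d x, j x)"] assms show ?thesis by (simp add: comp_Pair)
qed

end

subsection \<open>Invariants of the game\<close>

lemma chw_simps [simp]: "chw [] = 0" "chw (c # l) = (1/2) ^ fst (snd c) + chw l"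
  by (simp_all add: chw_def)

lemma chw_nonneg [simp]: "0 \<le> chw l"
  by (simp add: chw_def)

lemma chw_filter_split: "chw (filter P l) + chw (filter (\<lambda>c. \<not> P c) l) = chw l"
  by (induction l) auto

lemma chw_filter_le: "chw (filter P l) \<le> chw l"
  using chw_filter_split[of P l] by (smt (verit) chw_nonneg)

lemma chw_by_label:
  "finite V \<Longrightarrow> fst ` set l \<subseteq> V \<Longrightarrow> chw l = (\<Sum>v\<in>V. chw (filter (\<lambda>c. fst c = v) l))"
proof (induction l)
  case (Cons c l)
  have "(\<Sum>v\<in>V. chw (filter (\<lambda>x. fst x = v) (c # l))) =
      (\<Sum>v\<in>V. (if fst c = v then (1/2) ^ fst (snd c) else 0) + chw (filter (\<lambda>x. fst x = v) l))"
    by (intro sum.cong) auto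
  also have "\<dots> = (1/2) ^ fst (snd c) + chw l"
    using Cons by (simp add: sum.distrib sum.delta)
  finally show ?case by simp
qed simp

lemma wt_map_snd_res: "(\<And>e. e \<in> set l \<Longrightarrow> (1/2) ^ fst e \<le> wt (map snd (snd e))) \<Longrightarrow>
    wt (map fst l) \<le> wt (map snd (concat (map snd l)))"
proof (induction l)
  case (Cons e l)
  then have "(1/2) ^ fst e \<le> wt (map snd (snd e))" "wt (map fst l) \<le> wt (map snd (concat (map snd l)))" by auto
  then show ?case by simp
qed simp

context game
begin

lemma prune_sel [simp]: "lv (prune j f) = lv f" "goal (prune j f) = goal f" "drops (prune j f) = drops f"
  "sv (prune j f) = sv f" "sp (prune j f) = sp f"
  "chs (prune j f) = filter (\<lambda>c. stab j (fst c)) (chs f)"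
  by (simp_all add: prune_def)

lemma relw_prune: "relw (prune j f) = relw f + chw (filter (\<lambda>c. \<not> stab j (fst c)) (chs f))"
  by (simp add: relw_def prune_def chw_def o_def)

lemma relw_chw_prune: "relw (prune j f) + chw (chs (prune j f)) = relw f + chw (chs f)"
  using chw_filter_split[of "\<lambda>c. stab j (fst c)" "chs f"] by (simp add: relw_prune)

lemma cwt_prune: "cwt (prune j f) v = (if stab j v then cwt f v else 0)"
proof -
  have "filter (\<lambda>c. fst c = v) (filter (\<lambda>c. stab j (fst c)) (chs f)) =
      (if stab j v then filter (\<lambda>c. fst c = v) (chs f) else [])"
    by (auto simp: filter_empty_conv intro: filter_cong)
  then show ?thesis by (simp add: cwt_def)
qed

lemma full_prune: "stab j v \<Longrightarrow> full h (prune j f) v = full h f v"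
  by (simp add: full_def cwt_prune)

lemma pick_le:
  assumes "\<not> j < pick h j f"
  shows "pick h j f \<le> j" "Q j (pick h j f)" "\<not> full h f (pick h j f)"
proof -
  have "j < pick h j f \<or> Q j (pick h j f) \<and> \<not> full h f (pick h j f)"
    unfolding pick_def by (rule LeastI[of _ "Suc j"]) simp
  with assms show "pick h j f \<le> j" "Q j (pick h j f)" "\<not> full h f (pick h j f)" by auto
qed

lemma step_neq_Nil: "S \<noteq> [] \<Longrightarrow> step h d j S \<noteq> []"
  by (cases S) (auto simp: spawn_def split: option.splits list.splits)

end

lemma newf_sel [simp]: "lv (newf j l R) = max 1 l" "goal (newf j l R) = R" "sv (newf j l R) = None"
  "drops (newf j l R) = 0" "chs (newf j l R) = []"
  by (auto simp: newf_def)

lemma cancel_sel [simp]: "lv (cancel f r) = lv f" "goal (cancel f r) = goal f" "sv (cancel f r) = None"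
  "rel (cancel f r) = rel f" "chs (cancel f r) = chs f" "drops (cancel f r) = Suc (drops f)"
  by (simp_all add: cancel_def)

lemma credit_sel [simp]: "lv (credit f v c r) = lv f" "goal (credit f v c r) = goal f" "sv (credit f v c r) = None"
  "rel (credit f v c r) = rel f" "chs (credit f v c r) = (v, goal c, res c) # chs f" "drops (credit f v c r) = drops f"
  by (simp_all add: credit_def)

text \<open>What the game uses of the approximation. \<open>conf\<close> is K-triviality as seen at
  each stage. \<open>Q_kraft\<close> reflects that the programs halting with one sequence form a
  prefix-free set. By \<open>us_le\<close>, a stage number that is at least the code of a
  computation is also at least its use. \<open>k_ge\<close> defeats the outermost procedure, and
  \<open>h_ge\<close> bounds the losses over \<open>k\<close> levels.\<close>

locale game_inv = game +
  fixes A :: "nat \<Rightarrow> bool list" and us :: "nat \<Rightarrow> nat" and K :: "bool list \<Rightarrow> nat" and b k h d :: nat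
  assumes stab: "stab j v \<longleftrightarrow> take (us v) (A (Suc j)) = take (us v) (A j)"
    and us_le: "us v \<le> v"
    and Q_stab: "Q j v \<Longrightarrow> stab j v \<Longrightarrow> Q (Suc j) v"
    and Q_kraft: "finite V \<Longrightarrow> (\<And>v. v \<in> V \<Longrightarrow> Q j v) \<Longrightarrow> (\<Sum>v\<in>V. (1/2) ^ ln v) \<le> (1::real)"
    and kn_Suc: "kn j n m \<Longrightarrow> kn (Suc j) n m"
    and conf: "n \<le> j \<Longrightarrow> kn j n m \<Longrightarrow> K (take n (A j)) \<le> m + b"
    and length_A: "j \<le> length (A j)"
    and K_kraft: "finite X \<Longrightarrow> (\<Sum>x\<in>X. (1/2) ^ K x) \<le> (1::real)"
    and k_ge: "2 \<le> k" "2 ^ (d + b + 2) \<le> k"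
    and h_ge: "8 * real k * (1/2) ^ h \<le> 1"
begin

text \<open>A procedure of level i spends at most \<open>co i\<close> times its goal; each level
  above the first contributes the relative loss 4 * 2^-h found in \<open>spent_le\<close>.\<close>

definition co :: "nat \<Rightarrow> real" where "co i = (1 + 4 * (1/2) ^ h) ^ (i - 1)"

lemma co_pos [simp]: "0 < co i" "0 \<le> co i"
proof -
  have "(0::real) < 1 + 4 * (1/2) ^ h" by (rule add_pos_nonneg) auto
  then show "0 < co i" unfolding co_def by (rule zero_less_power)
  then show "0 \<le> co i" by simp
qed

lemma co_step: "2 \<le> i \<Longrightarrow> co i = co (i - 1) * (1 + 4 * (1/2) ^ h)"
  unfolding co_def by (cases i; cases "i - 1") auto

text \<open>(1 + x)^n \<le> 1 + 2 * n * x holds for n \<le> k as long as k * x \<le> 1/2, and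
  \<open>h_ge\<close> is this condition for x = 4 * 2^-h.\<close>

lemma co_le: "co k \<le> 2"
proof -
  define x where "x = 4 * (1/2 :: real) ^ h"
  have x: "0 \<le> x" "real k * x \<le> 1/2" using h_ge by (simp_all add: x_def)
  have "n \<le> k \<Longrightarrow> (1 + x) ^ n \<le> 1 + 2 * real n * x" for n
  proof (induction n)
    case (Suc n)
    then have "(1 + x) ^ Suc n \<le> (1 + 2 * real n * x) * (1 + x)" using x by (simp add: mult_left_mono mult.commute)
    also have "\<dots> = 1 + 2 * real n * x + x + 2 * (real n * x) * x" by (simp add: algebra_simps)
    also have "\<dots> \<le> 1 + 2 * real n * x + x + 1 * x"
    proof -
      have "real n * x \<le> real k * x" using Suc.prems x by (intro mult_right_mono) auto
      then have "2 * (real n * x) \<le> 1" using x by linarith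
      then have "2 * (real n * x) * x \<le> 1 * x" using x(1) by (rule mult_right_mono)
      then show ?thesis by linarith
    qed
    finally show ?case by (simp add: algebra_simps)
  qed simp
  from this[of "k - 1"] have "co k \<le> 1 + 2 * real (k - 1) * x" by (simp add: co_def x_def)
  also have "\<dots> \<le> 1 + 2 * (real k * x)" using x by (simp add: mult_right_mono)
  finally show ?thesis using x by linarith
qed

text \<open>\<open>X\<close> consists of \<open>i\<close> strings of length \<open>n\<close> with short descriptions, all of them extending the current
  prefixes of length \<open>us v\<close> for \<open>v \<in> Ps\<close>, the computations served by the enclosing procedures.\<close>

definition conf_strings :: "nat \<Rightarrow> nat \<Rightarrow> nat set \<Rightarrow> nat \<Rightarrow> nat \<Rightarrow> bool list set \<Rightarrow> bool" where
  "conf_strings j i Ps n r X \<longleftrightarrow> finite X \<and> card X = i \<and>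
        (\<forall>x\<in>X. length x = n \<and> K x \<le> r + d + b \<and> (\<forall>v\<in>Ps. take (us v) x = take (us v) (A j)))"

definition good :: "nat \<Rightarrow> nat \<Rightarrow> nat set \<Rightarrow> (nat \<times> nat) list \<Rightarrow> bool" where
  "good j i Ps E \<longleftrightarrow> (\<forall>(n, r)\<in>set E. n \<le> j \<and> kn j n (r + d) \<and> (\<forall>v\<in>Ps. us v \<le> n) \<and>
     (\<exists>X. conf_strings j i Ps n r X))"

lemma goodD:
  assumes "good j i Ps E" "(n, r) \<in> set E"
  shows "n \<le> j" "kn j n (r + d)" "\<forall>v\<in>Ps. us v \<le> n" "\<exists>X. conf_strings j i Ps n r X"
  using bspec[OF assms(1)[unfolded good_def] assms(2)] unfolding prod.case by blast+

lemma goodI: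
  assumes "\<And>n r. (n, r) \<in> set E \<Longrightarrow> n \<le> j \<and> kn j n (r + d) \<and> (\<forall>v\<in>Ps. us v \<le> n) \<and> (\<exists>X. conf_strings j i Ps n r X)"
  shows "good j i Ps E"
  using assms unfolding good_def by auto

lemma good_Suc:
  assumes "good j i Ps E" "\<And>v. v \<in> Ps \<Longrightarrow> stab j v"
  shows "good (Suc j) i Ps E"
proof (rule goodI)
  fix n r assume nr: "(n, r) \<in> set E"
  obtain X where X: "conf_strings j i Ps n r X" using goodD(4)[OF assms(1) nr] by blast
  have eq: "take (us v) (A (Suc j)) = take (us v) (A j)" if "v \<in> Ps" for v
    using assms(2)[OF that] by (simp only: stab)
  have "conf_strings (Suc j) i Ps n r X"
    using X eq unfolding conf_strings_def by metis
  then show "n \<le> Suc j \<and> kn (Suc j) n (r + d) \<and> (\<forall>v\<in>Ps. us v \<le> n) \<and> (\<exists>X. conf_strings (Suc j) i Ps n r X)"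
    using goodD(1-3)[OF assms(1) nr] kn_Suc le_SucI by blast
qed

text \<open>The additional string is the prefix of length n of the next approximation. It has a
  short description because the request has been answered. It is new because the strings of X carry
  the old prefix of length \<open>us v\<close>, which has changed; \<open>us v\<close> \<le> n makes
  the change visible.\<close>

lemma good_released:
  assumes "good j i (insert v Ps) E" "\<And>v. v \<in> Ps \<Longrightarrow> stab j v" "\<not> stab j v"
  shows "good (Suc j) (Suc i) Ps E"
proof (rule goodI)
  fix n r assume nr: "(n, r) \<in> set E"
  note g = goodD[OF assms(1) nr]
  obtain X where X: "conf_strings j i (insert v Ps) n r X" using g(4) by blast
  define y where "y = take n (A (Suc j))"
  have ty: "take (us w) y = take (us w) (A (Suc j))" if "w \<in> insert v Ps" for w
  proof -
    have "us w \<le> n" using g(3) that by blast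
    then show ?thesis by (simp add: y_def min_absorb1)
  qed
  have eq: "take (us v) (A (Suc j)) = take (us v) (A j)" if "v \<in> Ps" for v
    using assms(2)[OF that] by (simp only: stab)
  have "take (us v) y \<noteq> take (us v) (A j)" using ty[of v] assms(3) by (simp add: stab)
  then have "y \<notin> X" using X unfolding conf_strings_def by blast
  moreover have y: "length y = n" using g(1) length_A[of "Suc j"] by (simp add: y_def)
  moreover have "K y \<le> r + d + b"
    unfolding y_def by (rule conf) (use g(1) kn_Suc[OF g(2)] in auto)
  ultimately have "conf_strings (Suc j) (Suc i) Ps n r (insert y X)"
    using X ty eq unfolding conf_strings_def by simp
  then show "n \<le> Suc j \<and> kn (Suc j) n (r + d) \<and> (\<forall>v\<in>Ps. us v \<le> n) \<and> (\<exists>X. conf_strings (Suc j) (Suc i) Ps n r X)"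
    using g(1-3) kn_Suc le_SucI by blast
qed

text \<open>With x = 2^-(goal + h), the i-th dropped call may waste x * 2^-i, in total x * (1 -
  2^-drops), up to the factor \<open>co\<close>. The overshoot 3 * x consists of at most 2 * x of
  live weight and one more credit. Since a computation is served only while it is not full, it holds
  at most twice the threshold of \<open>full\<close>. Released requests have one string more than
  those still backing a computation.\<close>

definition finv :: "nat \<Rightarrow> nat set \<Rightarrow> frame \<Rightarrow> bool" where
  "finv j Ps f \<longleftrightarrow> (if lv f = 1
     then \<exists>n. f = Frame 1 (goal f) [(goal f, [(n, goal f)])] [] 0 None [goal f] \<and> n \<le> j \<and> (\<forall>v\<in>Ps. us v \<le> n)
     else 2 \<le> lv f \<and>
       wt (sp f) \<le> co (lv f - 1) * (relw f + chw (chs f) + (1/2) ^ (goal f + h) * (1 - (1/2) ^ drops f)) \<and>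
       relw f + chw (chs f) \<le> (1/2) ^ goal f + 3 * (1/2) ^ (goal f + h) \<and>
       (\<forall>c\<in>set (chs f). Q j (fst c)) \<and> (\<forall>v. cwt f v \<le> 2 * (1/2) ^ (goal f + h + ln v)) \<and>
       (\<forall>e\<in>set (rel f). good j (lv f) Ps (snd e) \<and> (1/2) ^ fst e \<le> wt (map snd (snd e))) \<and>
       (\<forall>c\<in>set (chs f). good j (lv f - 1) (insert (fst c) Ps) (snd (snd c)) \<and>
          (1/2) ^ fst (snd c) \<le> wt (map snd (snd (snd c)))))"

fun inv :: "nat \<Rightarrow> nat set \<Rightarrow> frame list \<Rightarrow> bool" where
  "inv j Ps [] = False"
| "inv j Ps (f # rest) = (finv j Ps f \<and> (case sv f of None \<Rightarrow> rest = []
    | Some v \<Rightarrow> 2 \<le> lv f \<and> v \<le> j \<and> Q j v \<and> \<not> full h f v \<and> rest \<noteq> [] \<and> lv (hd rest) = lv f - 1 \<and>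
        goal (hd rest) = goal f + h + ln v + drops f + 1 \<and> inv j (insert v Ps) rest))"

lemma finvD:
  assumes "finv j Ps f" "2 \<le> lv f"
  shows "wt (sp f) \<le> co (lv f - 1) * (relw f + chw (chs f) + (1/2) ^ (goal f + h) * (1 - (1/2) ^ drops f))"
    "relw f + chw (chs f) \<le> (1/2) ^ goal f + 3 * (1/2) ^ (goal f + h)"
    "\<And>c. c \<in> set (chs f) \<Longrightarrow> Q j (fst c)" "cwt f v \<le> 2 * (1/2) ^ (goal f + h + ln v)"
    "\<And>e. e \<in> set (rel f) \<Longrightarrow> good j (lv f) Ps (snd e)"
    "\<And>e. e \<in> set (rel f) \<Longrightarrow> (1/2) ^ fst e \<le> wt (map snd (snd e))"
    "\<And>c. c \<in> set (chs f) \<Longrightarrow> good j (lv f - 1) (insert (fst c) Ps) (snd (snd c))"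
    "\<And>c. c \<in> set (chs f) \<Longrightarrow> (1/2) ^ fst (snd c) \<le> wt (map snd (snd (snd c)))"
proof -
  have ne: "lv f \<noteq> 1" using assms(2) by simp
  note * = assms(1)[unfolded finv_def if_not_P[OF ne]]
  show "wt (sp f) \<le> co (lv f - 1) * (relw f + chw (chs f) + (1/2) ^ (goal f + h) * (1 - (1/2) ^ drops f))"
    "relw f + chw (chs f) \<le> (1/2) ^ goal f + 3 * (1/2) ^ (goal f + h)"
    "\<And>c. c \<in> set (chs f) \<Longrightarrow> Q j (fst c)" "cwt f v \<le> 2 * (1/2) ^ (goal f + h + ln v)"
    "\<And>e. e \<in> set (rel f) \<Longrightarrow> good j (lv f) Ps (snd e)"
    "\<And>e. e \<in> set (rel f) \<Longrightarrow> (1/2) ^ fst e \<le> wt (map snd (snd e))"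
    "\<And>c. c \<in> set (chs f) \<Longrightarrow> good j (lv f - 1) (insert (fst c) Ps) (snd (snd c))"
    "\<And>c. c \<in> set (chs f) \<Longrightarrow> (1/2) ^ fst (snd c) \<le> wt (map snd (snd (snd c)))"
    using * by blast+
qed

text \<open>The live computations all halt along the same approximation, so Kraft's inequality sums
  their individual bounds 2 * 2^-(goal + h + ln v).\<close>

lemma live_weight:
  assumes "finv j Ps f" "2 \<le> lv f"
  shows "chw (chs f) \<le> 2 * (1/2) ^ (goal f + h)"
proof -
  let ?V = "fst ` set (chs f)"
  have "chw (chs f) = (\<Sum>v\<in>?V. cwt f v)" unfolding cwt_def by (rule chw_by_label) auto
  also have "\<dots> \<le> (\<Sum>v\<in>?V. 2 * (1/2) ^ (goal f + h) * (1/2) ^ ln v)"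
    by (rule sum_mono) (use finvD(4)[OF assms] in \<open>simp add: power_add mult_ac\<close>)
  also have "\<dots> = 2 * (1/2) ^ (goal f + h) * (\<Sum>v\<in>?V. (1/2) ^ ln v)" by (simp add: sum_distrib_left)
  also have "\<dots> \<le> 2 * (1/2) ^ (goal f + h) * 1"
  proof (rule mult_left_mono)
    show "(\<Sum>v\<in>?V. (1/2) ^ ln v) \<le> (1::real)"
      by (rule Q_kraft[of _ j]) (auto dest: finvD(3)[OF assms])
  qed simp
  finally show ?thesis by simp
qed

text \<open>With x = 2^-(goal + h), a running call spends at most x * 2^-drops up to the factor
  \<open>co\<close>, which is what the allowance x for dropped calls has left. Goal, overshoot 3 * x
  and this allowance give the relative loss 4 * 2^-h of one level.\<close>

lemma spent_le: "inv j Ps S \<Longrightarrow> wt (concat (map sp S)) \<le> co (lv (hd S)) * (1/2) ^ goal (hd S)"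
proof (induction S arbitrary: Ps)
  case (Cons f rest)
  have f: "finv j Ps f" using Cons.prems by simp
  show ?case
  proof (cases "lv f = 1")
    case True
    then have "sv f = None" "sp f = [goal f]" using f unfolding finv_def by (metis frame.sel)+
    then show ?thesis using Cons.prems True by (simp add: co_def)
  next
    case False
    then have l: "2 \<le> lv f" using f by (simp add: finv_def)
    define c x where "c = co (lv f - 1)" and "x = (1/2 :: real) ^ (goal f + h)"
    have cx: "0 \<le> c" "0 \<le> x" by (simp_all add: c_def x_def)
    have rest: "wt (concat (map sp rest)) \<le> c * (x * (1/2) ^ drops f)"
    proof (cases "sv f")
      case None
      then show ?thesis using Cons.prems cx by simp
    next
      case (Some v)
      then have "wt (concat (map sp rest)) \<le> c * (1/2) ^ (goal f + h + ln v + drops f + 1)"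
        using Cons.prems Cons.IH[of "insert v Ps"] by (auto simp: c_def)
      also have "\<dots> \<le> c * (1/2) ^ (goal f + h + drops f)"
        by (intro mult_left_mono power_decreasing) (use cx in auto)
      finally show ?thesis by (simp add: x_def power_add)
    qed
    have "wt (sp f) \<le> c * (relw f + chw (chs f) + x * (1 - (1/2) ^ drops f))"
      using finvD(1)[OF f l] by (simp add: c_def x_def)
    also have "\<dots> \<le> c * ((1/2) ^ goal f + 3 * x + x * (1 - (1/2) ^ drops f))"
      using finvD(2)[OF f l] cx by (intro mult_left_mono add_right_mono) (auto simp: x_def)
    finally have "wt (concat (map sp (f # rest))) \<le>
        c * ((1/2) ^ goal f + 3 * x + x * (1 - (1/2) ^ drops f)) + c * (x * (1/2) ^ drops f)"
      using rest by simp
    also have "\<dots> = c * ((1/2) ^ goal f + 4 * x)" by (simp add: algebra_simps)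
    also have "\<dots> = co (lv f) * (1/2) ^ goal f"
      using co_step[OF l] by (simp add: c_def x_def power_add algebra_simps)
    finally show ?thesis by simp
  qed
qed simp

lemma finv_prune:
  assumes f: "finv j Ps f" and Ps: "\<And>v. v \<in> Ps \<Longrightarrow> stab j v"
  shows "finv (Suc j) Ps (prune j f)"
proof (cases "lv f = 1")
  case True
  then obtain n where n: "f = Frame 1 (goal f) [(goal f, [(n, goal f)])] [] 0 None [goal f]" "n \<le> j"
    "\<forall>v\<in>Ps. us v \<le> n" using f by (auto simp: finv_def)
  have "prune j f = f" by (subst (1 2) n(1)) (simp add: prune_def)
  with n True show ?thesis by (auto simp: finv_def)
next
  case False
  then have l: "2 \<le> lv f" using f by (simp add: finv_def)
  have "good (Suc j) (lv f) Ps (snd e) \<and> (1/2) ^ fst e \<le> wt (map snd (snd e))" if "e \<in> set (rel (prune j f))" for e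
  proof -
    consider "e \<in> set (rel f)" | c where "c \<in> set (chs f)" "\<not> stab j (fst c)" "e = snd c"
      using \<open>e \<in> _\<close> by (auto simp: prune_def)
    then show ?thesis
    proof cases
      case 1
      then show ?thesis using finvD(5,6)[OF f l] good_Suc Ps by blast
    next
      case 2
      then have "good (Suc j) (Suc (lv f - 1)) Ps (snd e)"
        using finvD(7)[OF f l 2(1)] good_released[of j "lv f - 1" "fst c" Ps] Ps by blast
      then show ?thesis using finvD(8)[OF f l 2(1)] 2 l by simp
    qed
  qed
  moreover have "good (Suc j) (lv f - 1) (insert (fst c) Ps) (snd (snd c)) \<and>
      (1/2) ^ fst (snd c) \<le> wt (map snd (snd (snd c)))" if "c \<in> set (chs (prune j f))" for c
    using that finvD(7,8)[OF f l, of c] good_Suc[of j "lv f - 1" "insert (fst c) Ps"] Ps by auto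
  moreover have "cwt (prune j f) v \<le> 2 * (1/2) ^ (goal f + h + ln v)" for v
    using finvD(4)[OF f l] by (simp add: cwt_prune)
  moreover have "Q (Suc j) (fst c)" if "c \<in> set (chs (prune j f))" for c
    using that finvD(3)[OF f l] Q_stab by auto
  ultimately show ?thesis
    using l finvD(1,2)[OF f l] relw_chw_prune[of j f] by (simp add: finv_def)
qed

lemma finv_sv: "2 \<le> lv f \<Longrightarrow> finv j Ps (Frame (lv f) (goal f) (rel f) (chs f) (drops f) s (sp f)) = finv j Ps f"
  by (simp add: finv_def relw_def cwt_def)

lemma inv_newf:
  assumes "\<And>v. v \<in> Ps \<Longrightarrow> v \<le> j" shows "inv j Ps [newf j l R]"
proof -
  have "us v \<le> j" if "v \<in> Ps" for v using us_le[of v] assms[OF that] by linarith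
  then show ?thesis
    by (cases "l \<le> 1") (simp_all add: finv_def newf_def relw_def cwt_def)
qed

text \<open>The dropped call has spent at most half of what was left of the allowance for dropped
  calls, which is the purpose of the summand 1 in its goal exponent.\<close>

lemma finv_cancel:
  assumes f: "finv j Ps f" and l: "2 \<le> lv f"
    and r: "wt (concat (map sp rest)) \<le> co (lv f - 1) * (1/2) ^ (goal f + h + ln v + drops f + 1)"
  shows "finv j Ps (cancel f rest)"
proof -
  define c x where "c = co (lv f - 1)" and "x = (1/2 :: real) ^ (goal f + h)"
  have cx: "0 \<le> c" "0 \<le> x" by (simp_all add: c_def x_def)
  have "c * (1/2) ^ (goal f + h + ln v + drops f + 1) \<le> c * (1/2) ^ (goal f + h + drops f + 1)"
    by (intro mult_left_mono power_decreasing) (use cx in auto)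
  with r have "wt (concat (map sp rest)) \<le> c * (1/2) ^ (goal f + h + drops f + 1)"
    unfolding c_def by linarith
  then have "wt (concat (map sp rest)) \<le> c * (x * (1/2) ^ Suc (drops f))"
    by (simp add: x_def power_add)
  moreover have "wt (sp f) \<le> c * (relw f + chw (chs f) + x * (1 - (1/2) ^ drops f))"
    using finvD(1)[OF f l] by (simp add: c_def x_def)
  moreover have "c * (relw f + chw (chs f) + x * (1 - (1/2) ^ drops f)) + c * (x * (1/2) ^ Suc (drops f)) =
      c * (relw f + chw (chs f) + x * (1 - (1/2) ^ Suc (drops f)))"
    by (simp add: algebra_simps)
  ultimately have "wt (sp f @ concat (map sp rest)) \<le> c * (relw f + chw (chs f) + x * (1 - (1/2) ^ Suc (drops f)))"
    by simp
  then show ?thesis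
    using l finvD(2-8)[OF f l] by (simp add: finv_def relw_def cwt_def c_def x_def cancel_def)
qed

text \<open>Level 1 supplies the first string: once the request is answered, the current prefix of
  length n has a short description. At higher levels the strings are inherited from the released
  pairs.\<close>

lemma child_good:
  assumes i: "inv j Ps (c # cs)" and Ps: "\<And>v. v \<in> Ps \<Longrightarrow> stab j v" and fin: "finished d (Suc j) c"
  shows "good (Suc j) (lv c) Ps (res c)" "(1/2) ^ goal c \<le> wt (map snd (res c))"
proof -
  have c: "finv j Ps c" using i by simp
  show "good (Suc j) (lv c) Ps (res c)"
  proof (cases "lv c = 1")
    case True
    then obtain n where n: "c = Frame 1 (goal c) [(goal c, [(n, goal c)])] [] 0 None [goal c]" "n \<le> j"
      "\<forall>v\<in>Ps. us v \<le> n" using c by (auto simp: finv_def)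
    then have res: "res c = [(n, goal c)]" by (metis concat.simps append_Nil2 frame.sel(3) list.simps(8,9) res_def snd_conv)
    then have kn: "kn (Suc j) n (goal c + d)" using fin by (simp add: finished_def)
    have "K (take n (A (Suc j))) \<le> goal c + d + b" by (rule conf[OF _ kn]) (use n in simp)
    moreover have "length (take n (A (Suc j))) = n" using n(2) length_A[of "Suc j"] by simp
    moreover have "take (us v) (take n (A (Suc j))) = take (us v) (A (Suc j))" if "v \<in> Ps" for v
      using n(3) that by (simp add: min_absorb1)
    ultimately have "conf_strings (Suc j) 1 Ps n (goal c) {take n (A (Suc j))}"
      unfolding conf_strings_def by simp
    then show ?thesis
      unfolding res True using n kn by (intro goodI) auto
  next
    case False
    then have l: "2 \<le> lv c" using c by (simp add: finv_def)
    show ?thesis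
    proof (rule goodI)
      fix n r assume "(n, r) \<in> set (res c)"
      then obtain e where e: "e \<in> set (rel c)" "(n, r) \<in> set (snd e)" by (auto simp: res_def)
      from goodD[OF good_Suc[OF finvD(5)[OF c l e(1)] Ps] e(2)]
      show "n \<le> Suc j \<and> kn (Suc j) n (r + d) \<and> (\<forall>v\<in>Ps. us v \<le> n) \<and>
          (\<exists>X. conf_strings (Suc j) (lv c) Ps n r X)" by blast
    qed
  qed
  show "(1/2) ^ goal c \<le> wt (map snd (res c))"
  proof (cases "lv c = 1")
    case True
    then obtain n where "c = Frame 1 (goal c) [(goal c, [(n, goal c)])] [] 0 None [goal c]"
      using c by (auto simp: finv_def)
    then have "res c = [(n, goal c)]" by (metis concat.simps append_Nil2 frame.sel(3) list.simps(8,9) res_def snd_conv)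
    then show ?thesis by simp
  next
    case False
    then have l: "2 \<le> lv c" using c by (simp add: finv_def)
    have "(1/2) ^ goal c \<le> relw c" using fin by (simp add: finished_def)
    also have "\<dots> \<le> wt (map snd (res c))"
      unfolding relw_def res_def by (rule wt_map_snd_res) (rule finvD(6)[OF c l])
    finally show ?thesis .
  qed
qed

text \<open>Above level 1 all collected requests are answered already, so an unfinished procedure is
  one that has not reached its goal.\<close>

lemma not_finished_relw:
  assumes "inv j Ps (c # cs)" "2 \<le> lv c" "\<not> finished d (Suc j) c"
  shows "relw c < (1/2) ^ goal c"
proof -
  have c: "finv j Ps c" using assms(1) by simp
  have "kn (Suc j) (fst x) (snd x + d)" if "x \<in> set (res c)" for x
  proof -
    have "\<exists>e\<in>set (rel c). (fst x, snd x) \<in> set (snd e)" using that by (simp add: res_def)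
    then obtain e where e: "e \<in> set (rel c)" "(fst x, snd x) \<in> set (snd e)" by blast
    show ?thesis using goodD(2)[OF finvD(5)[OF c assms(2) e(1)] e(2)] by (rule kn_Suc)
  qed
  then show ?thesis using assms(3) by (auto simp: finished_def)
qed

text \<open>The last premise limits the overshoot when a call is credited. Inner frames satisfy it
  because they are unfinished; for the outermost one it comes from
  \<open>top_unfinished\<close>.\<close>

lemma inv_step:
  assumes "inv j Ps S" "\<And>v. v \<in> Ps \<Longrightarrow> stab j v" "\<And>v. v \<in> Ps \<Longrightarrow> v \<le> j"
    and "2 \<le> lv (hd S) \<Longrightarrow> relw (hd S) < (1/2) ^ goal (hd S)"
  shows "inv (Suc j) Ps (step h d j S) \<and> lv (hd (step h d j S)) = lv (hd S) \<and> goal (hd (step h d j S)) = goal (hd S)"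
  using assms
proof (induction S arbitrary: Ps)
  case (Cons f rest)
  let ?f = "prune j f"
  have f: "finv j Ps f" using Cons.prems by simp
  have f1: "finv (Suc j) Ps ?f" by (rule finv_prune[OF f Cons.prems(2)])
  show ?case
  proof (cases "sv f")
    case None
    show ?thesis
    proof (cases "lv f \<le> 1 \<or> Suc j < pick h (Suc j) ?f")
      case True
      then show ?thesis using None f1 by (simp add: spawn_def)
    next
      case False
      let ?v = "pick h (Suc j) ?f"
      let ?f2 = "Frame (lv f) (goal f) (rel ?f) (chs ?f) (drops f) (Some ?v) (sp f)"
      have p: "?v \<le> Suc j" "Q (Suc j) ?v" "\<not> full h ?f ?v" using pick_le False by auto
      have "finv (Suc j) Ps ?f2" using finv_sv[of ?f "Suc j" Ps "Some ?v"] f1 False by simp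
      moreover have "\<not> full h ?f2 ?v" using p(3) by (simp add: full_def cwt_def)
      moreover have "inv (Suc j) (insert ?v Ps) [newf (Suc j) (lv f - 1) (goal f + h + ln ?v + drops f + 1)]"
        by (rule inv_newf) (use p Cons.prems(3) le_SucI in blast)
      ultimately show ?thesis using None False p by (simp add: spawn_def)
    qed
  next
    case (Some v)
    with Cons.prems(1) have s: "2 \<le> lv f" "v \<le> j" "Q j v" "\<not> full h f v" "rest \<noteq> []" "lv (hd rest) = lv f - 1"
      "goal (hd rest) = goal f + h + ln v + drops f + 1" "inv j (insert v Ps) rest" by auto
    obtain c cs where rest: "rest = c # cs" using s(5) by (cases rest) auto
    have spent: "wt (concat (map sp rest)) \<le> co (lv f - 1) * (1/2) ^ (goal f + h + ln v + drops f + 1)"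
      using spent_le[OF s(8)] s(6,7) by simp
    show ?thesis
    proof (cases "stab j v")
      case False
      then have "step h d j (f # rest) = [cancel ?f rest]" using Some by simp
      moreover have "finv (Suc j) Ps (cancel ?f rest)"
        by (rule finv_cancel[OF f1]) (use s spent in simp_all)
      ultimately show ?thesis by simp
    next
      case True
      have Ps: "\<And>w. w \<in> insert v Ps \<Longrightarrow> stab j w" "\<And>w. w \<in> insert v Ps \<Longrightarrow> w \<le> j"
        using Cons.prems True s by auto
      show ?thesis
      proof (cases "finished d (Suc j) c")
        case fin: True
        then have step: "step h d j (f # rest) = [credit ?f v c rest]" using Some True rest by simp
        define g where "g = goal f + h + ln v + drops f + 1"
        have gc: "goal c = g" using s(7) rest by (simp add: g_def)
        note ch = child_good[OF s(8)[unfolded rest] Ps(1) fin]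
        have gx: "(1/2 :: real) ^ g \<le> (1/2) ^ (goal f + h + ln v)" "(1/2 :: real) ^ g \<le> (1/2) ^ (goal f + h)"
          by (rule power_decreasing; simp add: g_def)+
        have "wt (sp f @ concat (map sp rest)) \<le> co (lv f - 1) *
            (relw ?f + ((1/2) ^ g + chw (chs ?f)) + (1/2) ^ (goal f + h) * (1 - (1/2) ^ drops f))"
          using spent finvD(1)[OF f1] s(1) by (simp add: g_def algebra_simps)
        \<comment> \<open>Before the credit \<open>relw\<close> is below the goal and the live
          weight is at most 2 * 2^-(goal + h); the credited call adds at most 2^-(goal + h).\<close>
        moreover have "relw ?f + ((1/2) ^ g + chw (chs ?f)) \<le> (1/2) ^ goal f + 3 * (1/2) ^ (goal f + h)"
        proof -
          have "relw f < (1/2) ^ goal f" using Cons.prems(4) s(1) by simp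
          then show ?thesis using live_weight[OF f s(1)] relw_chw_prune[of j f] gx(2) by linarith
        qed
        moreover have "Q (Suc j) v" using Q_stab s True by blast
        moreover have "cwt (credit ?f v c rest) w \<le> 2 * (1/2) ^ (goal f + h + ln w)" for w
        proof (cases "w = v")
          case True
          have "cwt ?f v < (1/2) ^ (goal f + h + ln v)"
            using s(4) \<open>stab j v\<close> by (simp add: full_def cwt_prune)
          moreover have "cwt (credit ?f v c rest) v = (1/2) ^ g + cwt ?f v" by (simp add: cwt_def gc)
          ultimately show ?thesis unfolding True using gx(1) by linarith
        next
          case False
          then show ?thesis using finvD(4)[OF f1, of w] s(1) by (simp add: cwt_def)
        qed
        moreover have "good (Suc j) (lv f - 1) (insert v Ps) (res c)" "(1/2) ^ g \<le> wt (map snd (res c))"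
          using ch s(6) rest gc by auto
        ultimately have "finv (Suc j) Ps (credit ?f v c rest)"
          using s(1) finvD(3,5-8)[OF f1] gc
          by (simp add: finv_def relw_def credit_def)
        then show ?thesis unfolding step by simp
      next
        case nfin: False
        then have step: "step h d j (f # rest) = ?f # step h d j rest" using Some True rest by simp
        have IH: "inv (Suc j) (insert v Ps) (step h d j rest) \<and> lv (hd (step h d j rest)) = lv (hd rest) \<and>
            goal (hd (step h d j rest)) = goal (hd rest)"
        proof (rule Cons.IH[OF s(8) Ps])
          show "relw (hd rest) < (1/2) ^ goal (hd rest)" if "2 \<le> lv (hd rest)"
            using not_finished_relw s(8) rest that nfin by simp
        qed
        moreover have "Q (Suc j) v" using Q_stab s True by blast
        moreover have "\<not> full h ?f v" using s(4) full_prune[OF True] by simp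
        moreover have "step h d j rest \<noteq> []" by (rule step_neq_Nil[OF s(5)])
        ultimately show ?thesis unfolding step using Some s f1 by simp
      qed
    qed
  qed
qed simp

end

subsection \<open>Disjointness of the requests, and the top procedure\<close>

text \<open>The multiplicity of \<open>x\<close> among the requested numbers. Once it is at most 1,
  strings collected for different requests differ in length, so their weights may be added.\<close>

definition ecnt :: "nat \<Rightarrow> frame \<Rightarrow> nat" where
  "ecnt x f = (\<Sum>e\<leftarrow>rel f. count_list (map fst (snd e)) x) + (\<Sum>c\<leftarrow>chs f. count_list (map fst (snd (snd c))) x)"

definition cnt :: "nat \<Rightarrow> frame list \<Rightarrow> nat" where
  "cnt x S = (\<Sum>f\<leftarrow>S. ecnt x f)"

lemma cnt_simps [simp]: "cnt x [] = 0" "cnt x (f # S) = ecnt x f + cnt x S"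
  by (simp_all add: cnt_def)

lemma sum_list_filter_split:
  fixes g :: "'a \<Rightarrow> nat"
  shows "sum_list (map g (filter P l)) + sum_list (map g (filter (\<lambda>c. \<not> P c) l)) = sum_list (map g l)"
  by (induction l) auto

lemma ecnt_newf: "ecnt x (newf j l R) = (if l \<le> 1 \<and> x = j then 1 else 0)"
  by (auto simp: ecnt_def newf_def)

lemma ecnt_cancel [simp]: "ecnt x (cancel f r) = ecnt x f"
  by (simp add: ecnt_def)

lemma count_res: "count_list (map fst (res c)) x = (\<Sum>e\<leftarrow>rel c. count_list (map fst (snd e)) x)"
proof -
  have "count_list (map fst (concat (map snd l))) x = (\<Sum>e\<leftarrow>l. count_list (map fst (snd e)) x)"
    for l :: "(nat \<times> (nat \<times> nat) list) list"
    by (induction l) auto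
  then show ?thesis by (simp add: res_def)
qed

lemma ecnt_credit: "ecnt x (credit f v c r) = ecnt x f + count_list (map fst (res c)) x"
  by (simp add: ecnt_def)

context game
begin

lemma ecnt_prune [simp]: "ecnt x (prune j f) = ecnt x f"
  using sum_list_filter_split[of "\<lambda>c. count_list (map fst (snd (snd c))) x" "\<lambda>c. stab j (fst c)" "chs f"]
  by (simp add: ecnt_def prune_def o_def)

text \<open>The only new entry is that of a level-1 call made at this stage, whose number is
  \<open>Suc j\<close>; a credit moves the requests of the finished call to its caller.\<close>

lemma cnt_step: "cnt x (step h d j S) \<le> cnt x S + (if x = Suc j then 1 else 0)"
proof (induction S)
  case (Cons f rest)
  note IH = Cons.IH
  have sp: "cnt x (spawn h (Suc j) (prune j f)) \<le> ecnt x f + (if x = Suc j then 1 else 0)"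
  proof -
    have "ecnt y (Frame (lv g) (goal g) (rel g) (chs g) (drops g) s (sp g)) = ecnt y g" for s y g
      by (simp only: ecnt_def frame.sel)
    from this[where g = "prune j f"] show ?thesis
      unfolding spawn_def by (simp add: ecnt_newf del: prune_sel)
  qed
  show ?case
  proof (cases "sv f")
    case (Some v)
    show ?thesis
    proof (cases rest)
      case (Cons c cs)
      have le: "count_list (map fst (res c)) x \<le> ecnt x c" by (simp add: count_res ecnt_def)
      consider "\<not> stab j v" | "stab j v" "finished d (Suc j) c" | "stab j v" "\<not> finished d (Suc j) c" by blast
      then show ?thesis
      proof cases
        case 1
        then have "step h d j (f # rest) = [cancel (prune j f) rest]" using Some by simp
        then show ?thesis by simp
      next
        case 2
        then have "step h d j (f # rest) = [credit (prune j f) v c rest]" using Some \<open>rest = _\<close> by simp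
        then show ?thesis using le \<open>rest = _\<close> by (simp add: ecnt_credit)
      next
        case 3
        then have "step h d j (f # rest) = prune j f # step h d j rest" using Some \<open>rest = _\<close> by simp
        then show ?thesis using IH by simp
      qed
    qed (use Some in simp)
  qed (use sp in simp)
qed simp

lemma cnt_stack: "2 \<le> k \<Longrightarrow> cnt x (stack k h d j) \<le> (if x \<le> j then 1 else 0)"
proof (induction j)
  case (Suc j)
  then show ?case using cnt_step[of x h d j "stack k h d j"] by (auto split: if_splits)
qed (simp add: ecnt_newf)

end

lemma distinct_count_list: "(\<And>x. count_list l x \<le> 1) \<Longrightarrow> distinct l"
proof (induction l)
  case (Cons y l)
  have "count_list l y = 0" using Cons.prems[of y] by simp
  moreover have "count_list l x \<le> 1" for x using Cons.prems[of x] by (simp split: if_splits)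
  ultimately show ?case using Cons.IH by (simp add: count_list_0_iff)
qed simp

context game_inv
begin

text \<open>Requests of weight 1/2 with \<open>k\<close> strings each, of complexity at most r + d +
  b, give a total weight of at least k * 2^-(d + b) / 2. No string is counted twice, as different
  requests concern different lengths. By \<open>k_ge\<close> the total is at least 2, against
  Kraft's bound 1.\<close>

lemma top_unfinished:
  assumes i: "inv j Ps S" and l: "lv (hd S) = k" and g: "goal (hd S) = 1" and c: "\<And>x. cnt x S \<le> 1"
  shows "relw (hd S) < 1/2"
proof (rule ccontr)
  assume "\<not> relw (hd S) < 1/2"
  obtain f rest where S: "S = f # rest" using i by (cases S) auto
  have f: "finv j Ps f" "2 \<le> lv f" and lk: "lv f = k" using i l S k_ge by auto
  define E where "E = res f"
  have "1/2 \<le> wt (map snd E)"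
  proof -
    have "relw f \<le> wt (map snd E)"
      unfolding relw_def E_def res_def by (rule wt_map_snd_res) (rule finvD(6)[OF f])
    then show ?thesis using \<open>\<not> _\<close> S by simp
  qed
  have dist: "distinct (map fst E)"
  proof (rule distinct_count_list)
    fix x
    have "count_list (map fst E) x \<le> ecnt x f" by (simp add: E_def count_res ecnt_def)
    then show "count_list (map fst E) x \<le> 1" using c[of x] S by simp
  qed
  have "\<exists>X. conf_strings j k Ps (fst e) (snd e) X" if "e \<in> set E" for e
  proof -
    obtain p where p: "p \<in> set (rel f)" "(fst e, snd e) \<in> set (snd p)"
    proof -
      have "\<exists>p\<in>set (rel f). (fst e, snd e) \<in> set (snd p)" using \<open>e \<in> set E\<close> by (simp add: E_def res_def)
      then show ?thesis using that by blast
    qed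
    from goodD(4)[OF finvD(5)[OF f p(1)] p(2)] show ?thesis unfolding lk .
  qed
  then obtain X where X: "\<And>e. e \<in> set E \<Longrightarrow> conf_strings j k Ps (fst e) (snd e) (X e)" by metis
  have XD: "finite (X e)" "card (X e) = k" "\<And>x. x \<in> X e \<Longrightarrow> length x = fst e \<and> K x \<le> snd e + d + b"
    if "e \<in> set E" for e using X[OF that] unfolding conf_strings_def by blast+
  have inj: "inj_on fst (set E)" and dE: "distinct E" using dist by (auto simp: distinct_map)
  have "real k * (1/2) ^ (d + b) * (1/2) \<le> real k * (1/2) ^ (d + b) * wt (map snd E)"
    by (rule mult_left_mono) (use \<open>1/2 \<le> _\<close> in auto)
  also have "\<dots> = (\<Sum>e\<in>set E. real k * (1/2) ^ (snd e + d + b))"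
    by (simp add: wt_map_distinct[OF dE] sum_distrib_left power_add mult_ac)
  also have "\<dots> \<le> (\<Sum>e\<in>set E. \<Sum>x\<in>X e. (1/2) ^ K x)"
  proof (rule sum_mono)
    fix e assume e: "e \<in> set E"
    have "real k * (1/2) ^ (snd e + d + b) = (\<Sum>x\<in>X e. (1/2) ^ (snd e + d + b))" using XD(2)[OF e] by simp
    also have "\<dots> \<le> (\<Sum>x\<in>X e. (1/2) ^ K x)"
      by (intro sum_mono power_decreasing) (use XD(3)[OF e] in auto)
    finally show "real k * (1/2) ^ (snd e + d + b) \<le> (\<Sum>x\<in>X e. (1/2) ^ K x)" .
  qed
  also have "\<dots> = (\<Sum>x\<in>(\<Union>e\<in>set E. X e). (1/2) ^ K x)"
  proof (rule sum.UNION_disjoint[symmetric])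
    show "\<forall>e\<in>set E. \<forall>e'\<in>set E. e \<noteq> e' \<longrightarrow> X e \<inter> X e' = {}"
    proof (intro ballI impI)
      fix e e' assume e: "e \<in> set E" "e' \<in> set E" "e \<noteq> e'"
      then have "fst e \<noteq> fst e'" using inj by (auto dest: inj_onD)
      then show "X e \<inter> X e' = {}" using XD(3)[OF e(1)] XD(3)[OF e(2)] by fastforce
    qed
  qed (use XD(1) in auto)
  also have "\<dots> \<le> 1" by (rule K_kraft) (use XD(1) in auto)
  finally have "real k * (1/2) ^ (d + b) \<le> 2" by simp
  moreover have "(2::real) ^ (d + b + 2) * (1/2) ^ (d + b) \<le> real k * (1/2) ^ (d + b)"
    by (rule mult_right_mono) (use k_ge(2) in \<open>auto simp flip: of_nat_le_iff[where 'a=real]\<close>)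
  moreover have "(2::real) ^ (d + b + 2) * (1/2) ^ (d + b) = 4" by (simp add: power_add power_one_over)
  ultimately show False by linarith
qed

abbreviation stk :: "nat \<Rightarrow> frame list" where "stk \<equiv> stack k h d"

lemma inv_stack: "inv j {} (stk j) \<and> lv (hd (stk j)) = k \<and> goal (hd (stk j)) = 1"
proof (induction j)
  case 0
  show ?case using inv_newf[of "{}" 0 k 1] k_ge by simp
next
  case (Suc j)
  have "relw (hd (stk j)) < (1/2) ^ goal (hd (stk j))"
    using top_unfinished[of j "{}" "stk j"] Suc cnt_stack[OF k_ge(1), of _ h d j]
    by (fastforce intro: order_trans)
  with inv_step[of j "{}" "stk j"] Suc show ?case by simp
qed

lemma top_relw: "relw (hd (stk j)) < (1/2) ^ goal (hd (stk j))"
  using top_unfinished[of j "{}" "stk j"] inv_stack[of j] cnt_stack[OF k_ge(1), of _ h d j]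
  by (fastforce intro: order_trans)

subsection \<open>Requests\<close>

lemma inv_length: "inv j Ps S \<Longrightarrow> length S \<le> lv (hd S)"
proof (induction S arbitrary: Ps)
  case (Cons f rest)
  show ?case
  proof (cases "sv f")
    case None
    then show ?thesis using Cons.prems by (auto simp: finv_def split: if_splits)
  next
    case (Some v)
    then show ?thesis using Cons.prems Cons.IH[of "insert v Ps"] by auto
  qed
qed simp

lemma finv_leaf:
  assumes "finv j Ps f" "lv f = 1"
  shows "sv f = None" "step h d j [f] = [f]" "prune j f = f"
proof -
  obtain n where n: "f = Frame 1 (goal f) [(goal f, [(n, goal f)])] [] 0 None [goal f]"
    using assms by (auto simp: finv_def)
  show sv: "sv f = None" by (subst n) simp
  show p: "prune j f = f" by (subst (1 2) n) (simp add: prune_def)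
  show "step h d j [f] = [f]" using sv p assms(2) by (simp add: spawn_def)
qed

text \<open>A stack of length \<open>lv (hd S)\<close> ends in a level-1 frame, so a request is made
  exactly when this length is attained. All other moves only shift exponents between the lists
  \<open>sp\<close>; thus weight spent is weight requested.\<close>

lemma step_spawn_cases:
  assumes "inv j Ps S"
  shows "wt (concat (map sp (step h d j S))) = wt (concat (map sp S)) +
      (if length S < lv (hd S) \<and> length (step h d j S) = lv (hd S) then (1/2) ^ goal (last (step h d j S)) else 0)
    \<and> (length S < lv (hd S) \<longrightarrow> length (step h d j S) = lv (hd S) \<longrightarrow>
        (\<exists>r. last (step h d j S) = newf (Suc j) 1 r))
    \<and> (length S = lv (hd S) \<longrightarrow> length (step h d j S) = lv (hd S) \<longrightarrow> last (step h d j S) = last S)"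
  using assms
proof (induction S arbitrary: Ps)
  case (Cons f rest)
  have f: "finv j Ps f" using Cons.prems by simp
  show ?case
  proof (cases "sv f")
    case None
    then have r: "rest = []" using Cons.prems by simp
    show ?thesis
    proof (cases "lv f = 1")
      case True
      then have "step h d j (f # rest) = f # rest" using finv_leaf[OF f True] r by (simp only:)
      then show ?thesis using True r by simp
    next
      case False
      then have "2 \<le> lv f" using f unfolding finv_def by presburger
      have step: "step h d j [f] = spawn h (Suc j) (prune j f)" using None by simp
      show ?thesis
        unfolding r step using \<open>2 \<le> lv f\<close>
        by (cases "Suc j < pick h (Suc j) (prune j f)") (auto simp: spawn_def newf_def)
    qed
  next
    case (Some v)
    then have s: "2 \<le> lv f" "rest \<noteq> []" "lv (hd rest) = lv f - 1" "inv j (insert v Ps) rest"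
      using Cons.prems by auto
    then obtain c cs where rest: "rest = c # cs" by (cases rest) auto
    note IH = Cons.IH[OF s(4)]
    show ?thesis
    proof (cases "\<not> stab j v \<or> finished d (Suc j) c")
      case True
      then have "step h d j (f # rest) = [cancel (prune j f) rest] \<or>
          step h d j (f # rest) = [credit (prune j f) v c rest]"
        using Some rest by auto
      then obtain f' where f': "step h d j (f # rest) = [f']" "sp f' = sp f @ concat (map sp rest)"
        by (auto simp: cancel_def credit_def)
      have "length (f # rest) \<noteq> lv f \<or> length [f'] \<noteq> lv f" "length [f'] < lv f" using s(1) by auto
      then show ?thesis unfolding f'(1) by (simp add: f'(2))
    next
      case False
      then have step: "step h d j (f # rest) = prune j f # step h d j rest" using Some rest by simp
      have "step h d j rest \<noteq> []" by (rule step_neq_Nil[OF s(2)])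
      then show ?thesis unfolding step using IH s by (auto simp: less_diff_conv)
    qed
  qed
qed simp

text \<open>Marks the stages at which a request is made; the number requested is then
  \<open>Suc j\<close>.\<close>

definition act :: "nat \<Rightarrow> bool" where
  "act j \<longleftrightarrow> length (stk j) < k \<and> length (stk (Suc j)) = k"

definition req :: "nat \<Rightarrow> nat" where
  "req j = goal (last (stk (Suc j)))"

lemma requests_bound: "(\<Sum>i<j. if act i then (1/2) ^ req i else 0) \<le> (1::real)"
proof -
  have "(\<Sum>i<j. if act i then (1/2) ^ req i else 0) = wt (concat (map sp (stk j)))"
  proof (induction j)
    case 0
    show ?case using k_ge by (simp add: newf_def)
  next
    case (Suc j)
    then show ?case using step_spawn_cases[of j "{}" "stk j"] inv_stack[of j]
      by (simp add: act_def req_def)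
  qed
  also have "\<dots> \<le> co k * (1/2) ^ 1" using spent_le[of j "{}" "stk j"] inv_stack[of j] by simp
  also have "\<dots> \<le> 1" using co_le by simp
  finally show ?thesis .
qed

lemma leaf_requested: "length (stk j) = k \<Longrightarrow> \<exists>i<j. act i \<and> last (stk j) = newf (Suc i) 1 (req i)"
proof (induction j)
  case 0
  then show ?case using k_ge by simp
next
  case (Suc j)
  have i: "inv j {} (stk j)" "lv (hd (stk j)) = k" using inv_stack by auto
  show ?case
  proof (cases "length (stk j) = k")
    case True
    then obtain i where "i < j" "act i" "last (stk j) = newf (Suc i) 1 (req i)" using Suc.IH by blast
    moreover have "last (stk (Suc j)) = last (stk j)" using step_spawn_cases[OF i(1)] i True Suc.prems by simp
    ultimately show ?thesis using less_SucI by metis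
  next
    case False
    then have "length (stk j) < k" using inv_length[OF i(1)] i(2) by simp
    then have "act j" using Suc.prems by (simp add: act_def)
    moreover have "last (stk (Suc j)) = newf (Suc j) 1 (req j)"
      using step_spawn_cases[OF i(1)] i \<open>length (stk j) < k\<close> Suc.prems by (auto simp: req_def)
    ultimately show ?thesis by blast
  qed
qed

subsection \<open>The golden run\<close>

text \<open>A frame that survives a step is not influenced by the procedures enclosing it, so the
  stack from its position on evolves by the rules of the game alone.\<close>

lemma drop_step:
  "inv j Ps S \<Longrightarrow> p < length S \<Longrightarrow> p < length (step h d j S) \<Longrightarrow> drop p (step h d j S) = step h d j (drop p S)"
proof (induction S arbitrary: p Ps)
  case (Cons f rest)
  show ?case
  proof (cases p)
    case (Suc q)
    then have "rest \<noteq> []" using Cons.prems by auto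
    then obtain v where v: "sv f = Some v" "inv j (insert v Ps) rest" using Cons.prems by (auto split: option.splits)
    obtain c cs where rest: "rest = c # cs" using \<open>rest \<noteq> []\<close> by (cases rest) auto
    have "\<not> (\<not> stab j v \<or> finished d (Suc j) c)"
    proof
      assume "\<not> stab j v \<or> finished d (Suc j) c"
      then have "length (step h d j (f # rest)) = 1" using v rest by auto
      then show False using Cons.prems(3) Suc by simp
    qed
    then have step: "step h d j (f # rest) = prune j f # step h d j rest" using v rest by simp
    show ?thesis unfolding step using Suc Cons.IH[OF v(2), of q] Cons.prems step by simp
  qed simp
qed simp

lemma inv_drop:
  "inv j Ps S \<Longrightarrow> p < length S \<Longrightarrow> \<exists>Ps'. inv j Ps' (drop p S) \<and> lv (hd (drop p S)) = lv (hd S) - p"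
proof (induction S arbitrary: p Ps)
  case (Cons f rest)
  show ?case
  proof (cases p)
    case 0
    then show ?thesis using Cons.prems by auto
  next
    case (Suc q)
    then have "rest \<noteq> []" using Cons.prems by auto
    then obtain v where v: "sv f = Some v" "inv j (insert v Ps) rest" "lv (hd rest) = lv f - 1"
      using Cons.prems by (auto split: option.splits)
    then show ?thesis using Cons.IH[OF v(2), of q] Cons.prems Suc by auto
  qed
qed simp

lemma child_unfinished:
  assumes "inv j Ps (f # c # cs)" "1 < length (step h d j (f # c # cs))"
  shows "\<not> finished d (Suc j) c"
proof -
  obtain v where "sv f = Some v" using assms(1) by (auto split: option.splits)
  then show ?thesis using assms(2) by (auto split: if_splits)
qed

text \<open>\<open>drop g\<close> cuts off the enclosing procedures. That stacks of length
  \<open>Suc g\<close> recur means that every call made by the procedure at position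
  \<open>g\<close> ends.\<close>

definition golden :: "nat \<Rightarrow> nat \<Rightarrow> bool" where
  "golden g j0 \<longleftrightarrow> (\<forall>j\<ge>j0. g < length (stk j) \<and> drop g (stk (Suc j)) = step h d j (drop g (stk j)) \<and>
      (\<exists>Ps. inv j Ps (drop g (stk j))) \<and> 2 \<le> lv (hd (drop g (stk j))) \<and>
      relw (hd (drop g (stk j))) < (1/2) ^ goal (hd (drop g (stk j)))) \<and>
    (\<forall>J. \<exists>j\<ge>J. length (stk j) = Suc g)"

text \<open>With m the limes inferior of the stack lengths, position m - 1 is occupied for good and
  infinitely often the last one. If m were k, a level-1 frame would wait forever although its
  request is answered; this is where \<open>answered\<close> enters.\<close>

lemma golden_exists:
  assumes answered: "\<And>i. act i \<Longrightarrow> \<exists>J. \<forall>j\<ge>J. kn j (Suc i) (req i + d)"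
  shows "\<exists>g j0. golden g j0"
proof -
  have len: "1 \<le> length (stk j)" "length (stk j) \<le> k" for j
    using inv_stack[of j] inv_length[of j "{}" "stk j"] by (cases "stk j"; simp)+
  define M where "M = {m. \<exists>j0. \<forall>j\<ge>j0. m \<le> length (stk j)}"
  have M: "finite M" "1 \<in> M"
  proof -
    have "M \<subseteq> {..k}" unfolding M_def using len(2) order_trans by blast
    then show "finite M" by (rule finite_subset) simp
    show "1 \<in> M" unfolding M_def using len(1) by blast
  qed
  define m where "m = Max M"
  have "m \<in> M" unfolding m_def using M by (intro Max_in) auto
  then obtain j0 where j0: "\<And>j. j \<ge> j0 \<Longrightarrow> m \<le> length (stk j)" unfolding M_def by blast
  have m1: "1 \<le> m" unfolding m_def using M by (intro Max_ge)
  have "Suc m \<notin> M" using Max_ge[OF M(1), of "Suc m"] unfolding m_def by auto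
  have inf: "\<exists>j\<ge>J. length (stk j) = m" for J
  proof -
    obtain j where "max J j0 \<le> j" "\<not> Suc m \<le> length (stk j)" using \<open>Suc m \<notin> M\<close> unfolding M_def by blast
    then show ?thesis using j0[of j] by (intro exI[of _ j]) auto
  qed
  have ev: "p < m \<Longrightarrow> j \<ge> j0 \<Longrightarrow> p < length (stk j) \<and> drop p (stk (Suc j)) = step h d j (drop p (stk j))" for p j
  proof -
    assume p: "p < m" "j \<ge> j0"
    have "p < length (stk j)" "p < length (stk (Suc j))" using j0[of j] j0[of "Suc j"] p by auto
    then show ?thesis using drop_step[of j "{}" "stk j" p] inv_stack[of j] by simp
  qed
  have unf: "\<not> finished d (Suc j) (hd (drop (Suc p) (stk j)))" if "Suc p < m" "j \<ge> j0" for p j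
  proof -
    obtain f c cs where d: "drop p (stk j) = f # c # cs"
    proof -
      have "Suc (Suc 0) \<le> length (drop p (stk j))" using j0[of j] \<open>Suc p < m\<close> \<open>j \<ge> j0\<close> by simp
      then show ?thesis using that by (auto simp: Suc_le_length_iff simp del: length_drop)
    qed
    obtain Ps where Ps: "inv j Ps (f # c # cs)"
      using inv_drop[of j "{}" "stk j" p] inv_stack[of j] ev[of p j] \<open>Suc p < m\<close> \<open>j \<ge> j0\<close> unfolding d by auto
    have "1 < length (drop p (stk (Suc j)))" using j0[of "Suc j"] that by simp
    then have "1 < length (step h d j (f # c # cs))" using ev[of p j] that d by (simp only:)
    then have "\<not> finished d (Suc j) c" by (rule child_unfinished[OF Ps])
    moreover have "drop (Suc p) (stk j) = c # cs" using d by (metis drop_Suc tl_drop list.sel(3))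
    ultimately show ?thesis by simp
  qed
  have mk: "m < k"
  proof (rule ccontr)
    assume "\<not> m < k"
    then have mk: "m = k" using inf[of 0] len(2) by (metis le_antisym not_less)
    obtain j1 where j1: "j1 \<ge> j0" "length (stk j1) = k" using inf[of j0] mk by blast
    obtain i where i: "act i" "last (stk j1) = newf (Suc i) 1 (req i)" using leaf_requested[OF j1(2)] by blast
    have last: "last (stk j) = newf (Suc i) 1 (req i)" if "j \<ge> j1" for j
      using that
    proof (induction rule: dec_induct)
      case base then show ?case using i by simp
    next
      case (step j)
      have "length (stk j) = k" "length (stk (Suc j)) = k"
        using j0[of j] j0[of "Suc j"] len(2)[of j] len(2)[of "Suc j"] step j1 mk by auto
      then show ?case using step_spawn_cases[of j "{}" "stk j"] inv_stack[of j] step by simp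
    qed
    obtain J where J: "\<forall>j\<ge>J. kn j (Suc i) (req i + d)" using answered[OF i(1)] by blast
    define j where "j = max J j1"
    have lj: "length (stk j) = k" using j0[of j] len(2)[of j] j1 mk by (simp add: j_def)
    have "drop (Suc (k - 2)) (stk j) = [last (stk j)]"
    proof -
      have "length (butlast (stk j)) = Suc (k - 2)" using lj k_ge by simp
      moreover have "stk j = butlast (stk j) @ [last (stk j)]" using len(1)[of j] by (intro append_butlast_last_id[symmetric]) auto
      ultimately show ?thesis by (metis append_eq_conv_conj)
    qed
    then have "\<not> finished d (Suc j) (newf (Suc i) 1 (req i))"
      using unf[of "k - 2" j] mk k_ge j1 last[of j] by (simp add: j_def)
    moreover have "kn (Suc j) (Suc i) (req i + d)" using J by (simp add: j_def)
    ultimately show False by (simp add: finished_def newf_def relw_def res_def)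
  qed
  define g where "g = m - 1"
  have gm: "Suc g = m" using m1 by (simp add: g_def)
  have "golden g j0"
    unfolding golden_def
  proof (intro conjI allI impI)
    fix j assume j: "j0 \<le> j"
    show "g < length (stk j)" "drop g (stk (Suc j)) = step h d j (drop g (stk j))" using ev[of g j] gm j by auto
    have lg: "\<exists>Ps. inv j Ps (drop g (stk j)) \<and> lv (hd (drop g (stk j))) = k - g"
      using inv_drop[of j "{}" "stk j" g] inv_stack[of j] ev[of g j] gm j by simp
    then show "\<exists>Ps. inv j Ps (drop g (stk j))" by blast
    show l2: "2 \<le> lv (hd (drop g (stk j)))" using lg mk gm by auto
    show "relw (hd (drop g (stk j))) < (1/2) ^ goal (hd (drop g (stk j)))"
    proof (cases g)
      case 0
      then show ?thesis using top_relw[of j] by simp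
    next
      case (Suc p)
      obtain Ps where Ps: "inv j Ps (drop g (stk j))" using lg by blast
      then obtain c cs where "drop g (stk j) = c # cs" by (cases "drop g (stk j)") auto
      then show ?thesis
        using not_finished_relw[of j Ps c cs] Ps l2 unf[of p j] gm j Suc by simp
    qed
  next
    fix J show "\<exists>j\<ge>J. length (stk j) = Suc g" using inf gm by simp
  qed
  then show ?thesis by blast
qed

end

subsection \<open>The requests of a golden run\<close>

context game_inv
begin

declare stack.simps(2) [simp del]

abbreviation gf :: "nat \<Rightarrow> nat \<Rightarrow> frame" where "gf g j \<equiv> hd (drop g (stk j))"

definition served :: "nat \<Rightarrow> nat \<Rightarrow> nat" where
  "served g j = (case sv (gf g j) of None \<Rightarrow> 0 | Some v \<Rightarrow> v)"

text \<open>A call for v has been credited and v has thereby become full. Each event will yield one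
  description of the output of v.\<close>

definition event :: "nat \<Rightarrow> nat \<Rightarrow> bool" where
  "event g j \<longleftrightarrow> (case sv (gf g j) of None \<Rightarrow> False
     | Some v \<Rightarrow> sv (gf g (Suc j)) = None \<and> stab j v \<and> full h (gf g (Suc j)) v)"

lemma goldenD:
  assumes "golden g j0" "j0 \<le> j"
  shows "drop g (stk (Suc j)) = step h d j (drop g (stk j))" "\<exists>Ps. inv j Ps (drop g (stk j))"
    "2 \<le> lv (gf g j)" "relw (gf g j) < (1/2) ^ goal (gf g j)" "g < length (stk j)"
  using assms unfolding golden_def by blast+

lemma golden_often: "golden g j0 \<Longrightarrow> \<exists>j\<ge>J. length (stk j) = Suc g"
  unfolding golden_def by blast

lemma golden_finv: "golden g j0 \<Longrightarrow> j0 \<le> j \<Longrightarrow> \<exists>Ps. finv j Ps (gf g j)"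
proof -
  assume "golden g j0" "j0 \<le> j"
  then obtain Ps where "inv j Ps (drop g (stk j))" using goldenD(2) by blast
  then show ?thesis by (cases "drop g (stk j)") auto
qed

lemma golden_cases:
  assumes "golden g j0" "j0 \<le> j"
  obtains (quiet) "sv (gf g j) = None" "gf g (Suc j) = prune j (gf g j)" "Suc j < pick h (Suc j) (prune j (gf g j))"
  | (spawn) "sv (gf g j) = None" "sv (gf g (Suc j)) = Some (pick h (Suc j) (prune j (gf g j)))"
      "rel (gf g (Suc j)) = rel (prune j (gf g j))" "chs (gf g (Suc j)) = chs (prune j (gf g j))"
      "drops (gf g (Suc j)) = drops (gf g j)"
  | (go) v where "sv (gf g j) = Some v" "stab j v" "gf g (Suc j) = prune j (gf g j)"
  | (cancel) v where "sv (gf g j) = Some v" "\<not> stab j v" "sv (gf g (Suc j)) = None"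
      "rel (gf g (Suc j)) = rel (prune j (gf g j))" "chs (gf g (Suc j)) = chs (prune j (gf g j))"
  | (credit) v E where "sv (gf g j) = Some v" "stab j v" "sv (gf g (Suc j)) = None"
      "rel (gf g (Suc j)) = rel (prune j (gf g j))" "drops (gf g (Suc j)) = drops (gf g j)"
      "chs (gf g (Suc j)) = (v, goal (gf g j) + h + ln v + drops (gf g j) + 1, E) # chs (prune j (gf g j))"
      "\<not> full h (gf g j) v"
proof -
  obtain Ps where Ps: "inv j Ps (drop g (stk j))" using goldenD(2)[OF assms] by blast
  then obtain f rest where f: "drop g (stk j) = f # rest" by (cases "drop g (stk j)") auto
  have gj: "gf g j = f" using f by simp
  have gs: "gf g (Suc j) = hd (step h d j (f # rest))" using goldenD(1)[OF assms] f by simp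
  have l2: "2 \<le> lv f" using goldenD(3)[OF assms] gj by simp
  show ?thesis
  proof (cases "sv f")
    case None
    have s: "step h d j (f # rest) = spawn h (Suc j) (prune j f)" using None by simp
    show ?thesis
    proof (cases "Suc j < pick h (Suc j) (prune j f)")
      case True
      then have "gf g (Suc j) = prune j f" unfolding gs s by (simp add: spawn_def)
      then show ?thesis using quiet None True unfolding gj by blast
    next
      case False
      then have "gf g (Suc j) = Frame (lv f) (goal f) (rel (prune j f)) (chs (prune j f)) (drops f)
          (Some (pick h (Suc j) (prune j f))) (sp f)"
        unfolding gs s using l2 by (simp add: spawn_def)
      then show ?thesis using spawn None unfolding gj by simp
    qed
  next
    case (Some v)
    then have i: "\<not> full h f v" "rest \<noteq> []" "goal (hd rest) = goal f + h + ln v + drops f + 1"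
      using Ps f by auto
    obtain c cs where rest: "rest = c # cs" using i(2) by (cases rest) auto
    consider "\<not> stab j v" | "stab j v" "finished d (Suc j) c" | "stab j v" "\<not> finished d (Suc j) c" by blast
    then show ?thesis
    proof cases
      case 1
      then have "gf g (Suc j) = cancel (prune j f) rest" unfolding gs using Some by simp
      then show ?thesis using cancel[of v] Some 1 unfolding gj by simp
    next
      case 2
      then have "gf g (Suc j) = credit (prune j f) v c rest" unfolding gs using Some rest by simp
      moreover have "goal c = goal f + h + ln v + drops f + 1" using i(3) rest by simp
      ultimately show ?thesis using credit[of v "res c"] Some 2 i(1) unfolding gj by simp
    next
      case 3
      then have "gf g (Suc j) = prune j f" unfolding gs using Some rest by simp
      then show ?thesis using go Some 3 unfolding gj by blast
    qed
  qed
qed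

lemma golden_goal:
  assumes "golden g j0" "j0 \<le> j" shows "goal (gf g j) = goal (gf g j0)"
  using assms(2)
proof (induction rule: dec_induct)
  case (step j)
  have "goal (gf g (Suc j)) = goal (gf g j)"
  proof -
    obtain f rest where f: "drop g (stk j) = f # rest"
      using goldenD(2)[OF assms(1) step(1)] by (cases "drop g (stk j)") auto
    have "goal (hd (step h d j (f # rest))) = goal f"
      by (auto simp: spawn_def split: option.splits list.splits)
    then show ?thesis using goldenD(1)[OF assms(1) step(1)] f by simp
  qed
  then show ?case using step by simp
qed simp

text \<open>The live weight of full computations. On a golden run \<open>relw\<close> +
  \<open>FW\<close> never decreases, because pruning moves such weight into \<open>relw\<close>.
  Counting full computations only makes the whole threshold of \<open>full\<close> appear at the
  moment of an event.\<close>

definition FW :: "frame \<Rightarrow> real" where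
  "FW f = chw (filter (\<lambda>c. full h f (fst c)) (chs f))"

lemma full_cong: "goal f = goal f' \<Longrightarrow> chs f = chs f' \<Longrightarrow> full h f v = full h f' v"
  by (simp add: full_def cwt_def)

lemma FW_cong: "goal f = goal f' \<Longrightarrow> chs f = chs f' \<Longrightarrow> FW f = FW f'"
  using full_cong[of f f'] by (simp add: FW_def)

lemma FW_prune: "relw f + FW f \<le> relw (prune j f) + FW (prune j f)"
proof -
  let ?s = "\<lambda>c :: nat \<times> nat \<times> (nat \<times> nat) list. stab j (fst c)"
  let ?F = "\<lambda>c :: nat \<times> nat \<times> (nat \<times> nat) list. full h f (fst c)"
  have "filter (\<lambda>c. full h (prune j f) (fst c)) (filter ?s (chs f)) = filter ?s (filter ?F (chs f))"
    by (auto simp: full_prune intro: filter_cong)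
  then have "FW (prune j f) = chw (filter ?s (filter ?F (chs f)))" by (simp add: FW_def)
  moreover have "FW f = chw (filter ?s (filter ?F (chs f))) + chw (filter (\<lambda>c. \<not> ?s c) (filter ?F (chs f)))"
    unfolding FW_def by (rule chw_filter_split[symmetric])
  moreover have "filter (\<lambda>c. \<not> ?s c) (filter ?F (chs f)) = filter ?F (filter (\<lambda>c. \<not> ?s c) (chs f))"
    by (simp add: conj_commute)
  then have "chw (filter (\<lambda>c. \<not> ?s c) (filter ?F (chs f))) \<le> chw (filter (\<lambda>c. \<not> ?s c) (chs f))"
    using chw_filter_le[of ?F] by metis
  ultimately show ?thesis by (simp add: relw_prune)
qed

lemma FW_credit:
  assumes g: "goal f' = goal f" and c: "chs f' = (v, e, E) # chs f" and nf: "\<not> full h f v"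
  shows "FW f' = FW f + (if full h f' v then cwt f' v else 0)"
proof -
  have w: "full h f' w = full h f w" if "w \<noteq> v" for w
    using that by (simp add: full_def cwt_def g c)
  have eq: "filter (\<lambda>c. full h f' (fst c)) (chs f) =
      filter (\<lambda>c. full h f (fst c) \<or> full h f' v \<and> fst c = v) (chs f)"
    by (rule filter_cong[OF refl]) (use w nf in metis)
  have split: "chw (filter (\<lambda>c. full h f (fst c) \<or> fst c = v) l) =
      chw (filter (\<lambda>c. full h f (fst c)) l) + chw (filter (\<lambda>c. fst c = v) l)" for l
    by (induction l) (use nf in auto)
  show ?thesis
  proof (cases "full h f' v")
    case True
    then show ?thesis unfolding FW_def using eq split[of "chs f"] by (simp add: c cwt_def)
  next
    case False
    then show ?thesis unfolding FW_def using eq by (simp add: c)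
  qed
qed

lemma golden_weight_step:
  assumes "golden g j0" "j0 \<le> j"
  shows "relw (gf g j) + FW (gf g j) + (if event g j then (1/2) ^ (goal (gf g j) + h + ln (served g j)) else 0)
    \<le> relw (gf g (Suc j)) + FW (gf g (Suc j))"
proof -
  have goal: "goal (gf g (Suc j)) = goal (prune j (gf g j))"
    using golden_goal[OF assms(1), of j] golden_goal[OF assms(1), of "Suc j"] assms(2) by simp
  have same: ?thesis if "\<not> event g j" "rel (gf g (Suc j)) = rel (prune j (gf g j))"
    "chs (gf g (Suc j)) = chs (prune j (gf g j))"
    using FW_prune[of "gf g j" j] FW_cong[OF goal that(3)] that by (simp add: relw_def)
  from assms show ?thesis
  proof (cases rule: golden_cases)
    case quiet
    then show ?thesis by (intro same) (auto simp: event_def)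
  next
    case spawn
    then show ?thesis by (intro same) (auto simp: event_def)
  next
    case (go v)
    then show ?thesis by (intro same) (auto simp: event_def)
  next
    case (cancel v)
    then show ?thesis by (intro same) (auto simp: event_def)
  next
    case (credit v E)
    have nf: "\<not> full h (prune j (gf g j)) v" using credit(7) full_prune[OF credit(2)] by simp
    have ev: "event g j \<longleftrightarrow> full h (gf g (Suc j)) v" using credit by (simp add: event_def)
    have sv: "served g j = v" using credit by (simp add: served_def)
    have rw: "relw (gf g (Suc j)) = relw (prune j (gf g j))" by (simp add: relw_def credit(4))
    have "(if event g j then (1/2) ^ (goal (gf g j) + h + ln (served g j)) else 0) \<le>
        (if full h (gf g (Suc j)) v then cwt (gf g (Suc j)) v else 0)"
      unfolding ev sv using goal by (simp add: full_def)
    then show ?thesis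
      using FW_credit[OF goal credit(6) nf] FW_prune[of "gf g j" j] rw by linarith
  qed
qed

text \<open>For goal exponent R, \<open>relw\<close> + \<open>FW\<close> is at most 4 * 2^-R, being
  at most the goal and its overshoot. Scaling by 2^R / 4 turns the exponents R + h + ln into the
  lengths ln + h + 2.\<close>

lemma golden_bound:
  assumes "golden g j0"
  shows "(\<Sum>j<T. if j0 \<le> j \<and> event g j then (1/2) ^ (ln (served g j) + h + 2) else 0) \<le> (1::real)"
proof -
  define R where "R = goal (gf g j0)"
  have "(\<Sum>j<T. if j0 \<le> j \<and> event g j then (1/2) ^ (R + h + ln (served g j)) else 0) \<le>
      relw (gf g T) + FW (gf g T)" if "j0 \<le> T" for T
    using that
  proof (induction rule: dec_induct)
    case base
    have "(\<Sum>j<j0. if j0 \<le> j \<and> event g j then (1/2) ^ (R + h + ln (served g j)) else 0) = (0::real)"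
      by (rule sum.neutral) auto
    moreover have "0 \<le> relw (gf g j0) + FW (gf g j0)" by (simp add: relw_def FW_def)
    ultimately show ?case by simp
  next
    case (step j)
    then show ?case
      using golden_weight_step[OF assms step(1)] golden_goal[OF assms step(1)] by (auto simp: R_def)
  qed
  then have main: "(\<Sum>j<max j0 T. if j0 \<le> j \<and> event g j then (1/2) ^ (R + h + ln (served g j)) else 0) \<le>
      relw (gf g (max j0 T)) + FW (gf g (max j0 T))" by simp
  let ?T = "max j0 T"
  obtain Ps where f: "finv ?T Ps (gf g ?T)" using golden_finv[OF assms, of ?T] by auto
  have l2: "2 \<le> lv (gf g ?T)" using goldenD(3)[OF assms] by simp
  have "FW (gf g ?T) \<le> chw (chs (gf g ?T))" unfolding FW_def by (rule chw_filter_le)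
  then have "relw (gf g ?T) + FW (gf g ?T) \<le> (1/2) ^ R + 3 * (1/2) ^ (R + h)"
    using finvD(2)[OF f l2] golden_goal[OF assms, of ?T] by (simp add: R_def)
  also have "\<dots> \<le> (1/2) ^ R + 3 * (1/2) ^ R"
    by (intro add_left_mono mult_left_mono power_decreasing) auto
  finally have total: "relw (gf g ?T) + FW (gf g ?T) \<le> 4 * (1/2) ^ R" by simp
  have "(\<Sum>j<T. if j0 \<le> j \<and> event g j then (1/2) ^ (ln (served g j) + h + 2) else 0) \<le>
      (\<Sum>j<?T. if j0 \<le> j \<and> event g j then (1/2) ^ (ln (served g j) + h + 2) else (0::real))"
    by (rule sum_mono2) auto
  also have "\<dots> = (\<Sum>j<?T. (if j0 \<le> j \<and> event g j then (1/2) ^ (R + h + ln (served g j)) else 0) * (2 ^ R / 4))"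
    by (intro sum.cong) (auto simp: power_add power_one_over)
  also have "\<dots> = (\<Sum>j<?T. if j0 \<le> j \<and> event g j then (1/2) ^ (R + h + ln (served g j)) else 0) * (2 ^ R / 4)"
    by (simp add: sum_distrib_right)
  also have "\<dots> \<le> (4 * (1/2) ^ R) * (2 ^ R / 4)"
    by (rule mult_right_mono) (use main total in auto)
  also have "\<dots> = 1" by (simp add: power_one_over)
  finally show ?thesis .
qed

section \<open>True computations become full with their final use\<close>

lemma cwt_zero: "v \<notin> fst ` set (chs f) \<Longrightarrow> cwt f v = 0"
proof -
  assume "v \<notin> fst ` set (chs f)"
  then have "filter (\<lambda>c. fst c = v) (chs f) = []" by (auto simp: filter_empty_conv)
  then show ?thesis by (simp add: cwt_def)
qed

lemma not_full_zero: "cwt f v = 0 \<Longrightarrow> \<not> full h f v"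
  by (simp add: full_def not_le)

lemma golden_unstable:
  assumes "golden g j0" "j0 \<le> j" "\<not> stab j v"
  shows "\<not> full h (gf g (Suc j)) v"
proof -
  have p: "cwt (prune j (gf g j)) v = 0" using assms(3) by (simp add: cwt_prune)
  have same: ?thesis if "chs (gf g (Suc j)) = chs (prune j (gf g j))"
    by (rule not_full_zero) (use p that in \<open>simp add: cwt_def\<close>)
  from assms(1,2) show ?thesis
  proof (cases rule: golden_cases)
    case (credit w E)
    then have "v \<noteq> w" using assms(3) by blast
    then show ?thesis by (intro not_full_zero) (use p credit(6) in \<open>simp add: cwt_def\<close>)
  qed (use same in auto)
qed

lemma golden_becomes_full:
  assumes "golden g j0" "j0 \<le> j" "stab j v" "\<not> full h (gf g j) v" "full h (gf g (Suc j)) v"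
  shows "event g j \<and> served g j = v"
proof -
  have goal: "goal (gf g (Suc j)) = goal (prune j (gf g j))"
    using golden_goal[OF assms(1), of j] golden_goal[OF assms(1), of "Suc j"] assms(2) by simp
  have nf: "\<not> full h (prune j (gf g j)) v" using assms(4) full_prune[OF assms(3)] by simp
  have same: ?thesis if "chs (gf g (Suc j)) = chs (prune j (gf g j))"
    using full_cong[OF goal that] nf assms(5) by blast
  from assms(1,2) show ?thesis
  proof (cases rule: golden_cases)
    case (credit w E)
    have "w = v"
    proof (rule ccontr)
      assume "w \<noteq> v"
      then have "full h (gf g (Suc j)) v = full h (prune j (gf g j)) v"
        by (simp add: full_def cwt_def goal credit(6))
      then show False using nf assms(5) by blast
    qed
    then show ?thesis using credit assms(5) by (simp add: event_def served_def)
  qed (use same in auto)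
qed

text \<open>Otherwise \<open>pick\<close> keeps returning codes up to v, whose computations no
  longer change. After an idle moment no call is dropped any more, so every call has a weight
  bounded below and adds it to the live weight of codes up to v. That weight is never released, yet
  \<open>live_weight\<close> bounds it.\<close>

lemma golden_eventually_full:
  assumes G: "golden g j0" and J: "j0 \<le> J" "v \<le> J"
    and Qv: "\<And>j. J \<le> j \<Longrightarrow> Q j v" and st: "\<And>j w. J \<le> j \<Longrightarrow> w \<le> v \<Longrightarrow> stab j w"
  shows "\<exists>j\<ge>J. full h (gf g j) v"
proof (rule ccontr)
  assume "\<not> ?thesis"
  then have nf: "\<And>j. J \<le> j \<Longrightarrow> \<not> full h (gf g j) v" by blast
  have idle: "sv (gf g j) = None" if j: "j0 \<le> j" and l: "length (stk j) = Suc g" for j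
  proof -
    obtain Ps where Ps: "inv j Ps (drop g (stk j))" using goldenD(2)[OF G j] by blast
    obtain f rest where f: "drop g (stk j) = f # rest" using Ps by (cases "drop g (stk j)") auto
    have "length (drop g (stk j)) = 1" using l by simp
    then have "rest = []" using f by simp
    then show ?thesis using Ps f by (auto split: option.splits)
  qed
  \<comment> \<open>At an idle stage there is no older call for a code above \<open>v\<close> left
    that might still be dropped.\<close>
  obtain J1 where J1: "J \<le> J1" "length (stk J1) = Suc g" using golden_often[OF G] by blast
  define e where "e = drops (gf g J1)"
  have pick_le: "pick h (Suc j) (prune j (gf g j)) \<le> v" if "J \<le> j" for j
    unfolding pick_def by (rule Least_le) (use Qv[of "Suc j"] nf[OF that] full_prune[OF st[OF that order_refl]] that in simp)
  have low: "(\<forall>w. sv (gf g j) = Some w \<longrightarrow> w \<le> v) \<and> drops (gf g j) = e" if "J1 \<le> j" for j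
    using that
  proof (induction rule: dec_induct)
    case base
    then show ?case using idle[OF _ J1(2)] J J1(1) by (simp add: e_def)
  next
    case (step j)
    then have j: "J \<le> j" "j0 \<le> j" using J J1 by auto
    from G j(2) show ?case
    proof (cases rule: golden_cases)
      case quiet then show ?thesis using step.IH by simp
    next
      case spawn then show ?thesis using step.IH pick_le[OF j(1)] by simp
    next
      case (go w) then show ?thesis using step.IH by simp
    next
      case (cancel w)
      then show ?thesis using step.IH st[OF j(1), of w] by blast
    next
      case (credit w E) then show ?thesis using step.IH by simp
    qed
  qed
  define Lw where "Lw j = chw (filter (\<lambda>c. fst c \<le> v) (chs (gf g j)))" for j
  define R where "R = goal (gf g j0)"
  \<comment> \<open>A lower bound for the weight of every call from J1 on: the number of drops
    remains \<open>e\<close>, and the longest program among codes up to \<open>v\<close> is allowed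
    for.\<close>
  define \<delta> where "\<delta> = (1/2 :: real) ^ (R + h + Max (ln ` {..v}) + e + 1)"
  have prune: "filter (\<lambda>c. fst c \<le> v) (chs (prune j (gf g j))) = filter (\<lambda>c. fst c \<le> v) (chs (gf g j))"
    if "J \<le> j" for j
    using st[OF that] by (auto intro: filter_cong)
  have Lw_step: "Lw j \<le> Lw (Suc j)" if "J1 \<le> j" for j
  proof -
    have j: "J \<le> j" "j0 \<le> j" using J J1 that by auto
    have same: ?thesis if "chs (gf g (Suc j)) = chs (prune j (gf g j))"
      unfolding Lw_def that prune[OF j(1)] by simp
    from G j(2) show ?thesis
    proof (cases rule: golden_cases)
      case (credit w E)
      have "Lw j = chw (filter (\<lambda>c. fst c \<le> v) (chs (prune j (gf g j))))" unfolding Lw_def prune[OF j(1)] ..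
      then show ?thesis unfolding Lw_def credit(6) by simp
    qed (use same in auto)
  qed
  have Lw_mono: "Lw i \<le> Lw j" if "J1 \<le> i" "i \<le> j" for i j
    using that(2,1) by (induction rule: dec_induct) (auto intro: order_trans Lw_step)
  have gain: "Lw j + \<delta> \<le> Lw (Suc j)" if "J1 \<le> j" "sv (gf g j) = Some w" "sv (gf g (Suc j)) = None" for j w
  proof -
    have j: "J \<le> j" "j0 \<le> j" using J J1 that by auto
    have w: "w \<le> v" using low[OF that(1)] that(2) by blast
    from G j(2) show ?thesis
    proof (cases rule: golden_cases)
      case (cancel u)
      then show ?thesis using that(2) st[OF j(1) w] by simp
    next
      case (credit u E)
      then have u: "u = w" using that(2) by simp
      have "Lw j = chw (filter (\<lambda>c. fst c \<le> v) (chs (prune j (gf g j))))" unfolding Lw_def prune[OF j(1)] ..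
      then have "Lw (Suc j) = Lw j + (1/2) ^ (goal (gf g j) + h + ln w + drops (gf g j) + 1)"
        unfolding Lw_def[of "Suc j"] credit(6) using w u by simp
      moreover have "\<delta> \<le> (1/2) ^ (goal (gf g j) + h + ln w + drops (gf g j) + 1)"
        unfolding \<delta>_def
      proof (rule power_decreasing)
        have "ln w \<le> Max (ln ` {..v})" using w by (intro Max_ge) auto
        then show "goal (gf g j) + h + ln w + drops (gf g j) + 1 \<le> R + h + Max (ln ` {..v}) + e + 1"
          using golden_goal[OF G j(2)] low[OF that(1)] by (simp add: R_def)
      qed auto
      ultimately show ?thesis by linarith
    qed (use that in auto)
  qed
  have progress: "\<exists>j'\<ge>j. Lw j + \<delta> \<le> Lw j'" if "J1 \<le> j" for j
  proof -
    obtain i where i: "j \<le> i" "length (stk i) = Suc g" using golden_often[OF G] by blast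
    have i0: "J \<le> i" "j0 \<le> i" "J1 \<le> i" using i that J J1 by auto
    have "sv (gf g (Suc i)) \<noteq> None"
      using G i0(2)
    proof (cases rule: golden_cases)
      case quiet
      then show ?thesis using pick_le[OF i0(1)] i0 J by simp
    qed (use idle[OF i0(2) i(2)] in auto)
    obtain n where n: "Suc i \<le> n" "length (stk n) = Suc g" using golden_often[OF G] by blast
    have "sv (gf g n) = None" using idle[OF _ n(2)] n(1) i0 by simp
    define t where "t = (LEAST t. Suc i \<le> t \<and> sv (gf g t) = None)"
    have t: "Suc i \<le> t" "sv (gf g t) = None"
      unfolding t_def using LeastI[of "\<lambda>t. Suc i \<le> t \<and> sv (gf g t) = None" n] n \<open>sv (gf g n) = None\<close> by auto
    then have "Suc i < t" using \<open>sv (gf g (Suc i)) \<noteq> None\<close> by (metis le_neq_implies_less)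
    then obtain s where s: "t = Suc s" "Suc i \<le> s" by (metis less_Suc_eq_le less_imp_Suc_add add_Suc_right le_add1)
    have "\<not> (Suc i \<le> s \<and> sv (gf g s) = None)"
      by (rule not_less_Least[of _ "\<lambda>t. Suc i \<le> t \<and> sv (gf g t) = None", folded t_def]) (simp add: s)
    then obtain w where w: "sv (gf g s) = Some w" using s(2) by auto
    have "Lw s + \<delta> \<le> Lw (Suc s)" by (rule gain[OF _ w]) (use t s i0 in auto)
    moreover have "Lw j \<le> Lw s" by (rule Lw_mono) (use that s i in auto)
    ultimately show ?thesis using s i by (intro exI[of _ "Suc s"]) auto
  qed
  have unbounded: "\<exists>j\<ge>J1. real n * \<delta> \<le> Lw j" for n
  proof (induction n)
    case 0
    show ?case by (intro exI[of _ J1]) (simp add: Lw_def)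
  next
    case (Suc n)
    then obtain j where j: "J1 \<le> j" "real n * \<delta> \<le> Lw j" by blast
    from progress[OF j(1)] obtain j' where "j \<le> j'" "Lw j + \<delta> \<le> Lw j'" by blast
    then show ?case using j by (intro exI[of _ j']) (auto simp: algebra_simps)
  qed
  have "\<delta> > 0" by (simp add: \<delta>_def)
  then obtain n where "2 * (1/2) ^ (R + h) < real n * \<delta>" using reals_Archimedean3 by blast
  moreover obtain j where j: "J1 \<le> j" "real n * \<delta> \<le> Lw j" using unbounded by blast
  moreover have "Lw j \<le> 2 * (1/2) ^ (R + h)"
  proof -
    have j0: "j0 \<le> j" using j J J1 by simp
    obtain Ps where f: "finv j Ps (gf g j)" using golden_finv[OF G j0] by blast
    have "Lw j \<le> chw (chs (gf g j))" unfolding Lw_def by (rule chw_filter_le)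
    then show ?thesis using live_weight[OF f goldenD(3)[OF G j0]] golden_goal[OF G j0] by (simp add: R_def)
  qed
  ultimately show False by linarith
qed

text \<open>\<open>v\<close> may become full repeatedly, under uses that are left again. At the
  first stage j1 from which its use stays fixed, \<open>v\<close> is not full: either a change has
  just released its backing, or j1 = j0 and \<open>new\<close> applies. So it becomes full later, in
  an event that sees the final use.\<close>

lemma golden_complete:
  assumes G: "golden g j0" and new: "v \<notin> fst ` set (chs (gf g j0))"
    and J: "\<And>j. J \<le> j \<Longrightarrow> Q j v" "\<And>j w. J \<le> j \<Longrightarrow> w \<le> v \<Longrightarrow> stab j w"
  shows "\<exists>j\<ge>j0. event g j \<and> served g j = v \<and> (\<forall>i\<ge>j. stab i v)"
proof -
  define J' where "J' = max (max J j0) v"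
  have "\<exists>j\<ge>J'. full h (gf g j) v"
    by (rule golden_eventually_full[OF G]) (use J in \<open>auto simp: J'_def\<close>)
  then obtain j2 where j2: "J' \<le> j2" "full h (gf g j2) v" by blast
  define P where "P j \<longleftrightarrow> j0 \<le> j \<and> (\<forall>i\<ge>j. stab i v)" for j
  have "P J'" using J(2) by (simp add: P_def J'_def)
  define j1 where "j1 = (LEAST j. P j)"
  have j1: "P j1" unfolding j1_def by (rule LeastI[of P, OF \<open>P J'\<close>])
  have "j1 \<le> J'" unfolding j1_def by (rule Least_le[of P, OF \<open>P J'\<close>])
  have nf: "\<not> full h (gf g j1) v"
  proof (cases "j1 = j0")
    case True
    then show ?thesis using not_full_zero[OF cwt_zero[OF new]] by simp
  next
    case False
    then obtain i where i: "j1 = Suc i" "j0 \<le> i" using j1 unfolding P_def by (metis le_neq_implies_less less_Suc_eq_le less_imp_Suc_add add_Suc_right le_add1)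
    have "\<not> P i" using not_less_Least[of i P] i(1) unfolding j1_def by simp
    then have "\<not> stab i v" using j1 i unfolding P_def by (metis le_antisym not_less_eq_eq)
    then show ?thesis using golden_unstable[OF G i(2)] i(1) by simp
  qed
  define t where "t = (LEAST t. j1 \<le> t \<and> full h (gf g t) v)"
  have t: "j1 \<le> t" "full h (gf g t) v"
    unfolding t_def using LeastI[of "\<lambda>t. j1 \<le> t \<and> full h (gf g t) v" j2] j2 \<open>j1 \<le> J'\<close> by auto
  then have "j1 < t" using nf by (metis le_neq_implies_less)
  then obtain s where s: "t = Suc s" "j1 \<le> s" by (metis less_Suc_eq_le less_imp_Suc_add add_Suc_right le_add1)
  have "\<not> (j1 \<le> s \<and> full h (gf g s) v)"
    by (rule not_less_Least[of _ "\<lambda>t. j1 \<le> t \<and> full h (gf g t) v", folded t_def]) (simp add: s)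
  then have "event g s \<and> served g s = v"
    using golden_becomes_full[OF G, of s v] j1 s t unfolding P_def by auto
  then show ?thesis using j1 s unfolding P_def by (intro exI[of _ s]) auto
qed

end

subsection \<open>K-trivial sequences are K-low\<close>

lemma comp_last [comp_intros]: assumes "computable l" shows "computable (\<lambda>x. last (l x))"
proof -
  have "computable (\<lambda>x. case rev (l x) of [] \<Rightarrow> last [] | h # t \<Rightarrow> h)"
    by (intro comp_intros assms)
  moreover have "(case rev k of [] \<Rightarrow> last [] | h # t \<Rightarrow> h) = last k" for k :: "'b list"
    by (cases k rule: rev_cases) auto
  ultimately show ?thesis by simp
qed

lemma comp_hd [comp_intros]: assumes "computable l" shows "computable (\<lambda>x. hd (l x))"
proof -
  have "computable (\<lambda>x. case l x of [] \<Rightarrow> hd [] | h # t \<Rightarrow> h)"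
    by (intro comp_intros assms)
  moreover have "(case k of [] \<Rightarrow> hd [] | h # t \<Rightarrow> h) = hd k" for k :: "'b list"
    by (cases k) auto
  ultimately show ?thesis by simp
qed

lemma comp_drop [comp_intros]:
  fixes l :: "'a::encd \<Rightarrow> 'b::encd list"
  assumes "computable l" shows "computable (\<lambda>x. drop n (l x))"
proof (induction n)
  case (Suc n)
  from comp_tl[OF this] show ?case by (simp add: drop_Suc tl_drop)
qed (use assms in simp)

lemma orc_take: "i < u \<Longrightarrow> orc (take u l) i = orc l i"
  by (auto simp: orc_def)

lemma orc_initseg: "i < u \<Longrightarrow> orc (initseg a u) i = a i"
  by (simp add: orc_def)

lemma fe_agree:
  assumes "\<And>i. i < u \<Longrightarrow> a i = a' i" shows "fe f u a xs = fe f u a' xs"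
proof (cases "fe f u a xs")
  case None
  then show ?thesis using fe_mono[of f u a' xs _ u a] assms by (cases "fe f u a' xs") auto
next
  case (Some y)
  then show ?thesis using fe_mono[of f u a xs y u a'] assms by simp
qed

lemma fe_take_agree: "take u l = take u l' \<Longrightarrow> u' \<le> u \<Longrightarrow> fe f u' (orc l) xs = fe f u' (orc l') xs"
  by (rule fe_agree) (metis orc_take order_less_le_trans)

lemma sum_Kc_le:
  assumes "optimal_machine U" "finite X" shows "(\<Sum>x\<in>X. (1/2) ^ Kc U x) \<le> (1::real)"
proof -
  obtain p where p: "runs (\<lambda>_. False) U (p x) x" "length (p x) = Kc U x" for x
    using Krel_attained[OF assms(1)] unfolding Kc_def by metis
  have inj: "inj_on p X"
  proof (rule inj_onI)
    fix x y assume "p x = p y"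
    then show "x = y" using p(1)[of x] p(1)[of y] unfolding runs_def by (metis eval_det enc_eq_iff)
  qed
  have "(\<Sum>x\<in>X. (1/2) ^ Kc U x) = (\<Sum>q\<in>p ` X. (1/2) ^ length q :: real)"
    by (simp add: sum.reindex[OF inj] p(2))
  also have "\<dots> \<le> 1"
    by (rule kraft_runs[where a = "\<lambda>_. False"]) (use assms p(1) in \<open>auto simp: optimal_machine_def\<close>)
  finally show ?thesis .
qed

text \<open>Indices below T code pairs with both components below T, so a rectangle dominates the
  sum, and the shares 2^-(e + 1) of the strategies add up to at most 1.\<close>

lemma sum_prod_decode_le:
  fixes f :: "nat \<Rightarrow> nat \<Rightarrow> real"
  assumes nonneg: "\<And>e j. 0 \<le> f e j" and le: "\<And>e T. (\<Sum>j<T. f e j) \<le> (1/2) ^ Suc e"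
  shows "(\<Sum>t<T. f (fst (prod_decode t)) (snd (prod_decode t))) \<le> 1"
proof -
  have sub: "prod_decode ` {..<T} \<subseteq> {..<T} \<times> {..<T}"
  proof
    fix p assume "p \<in> prod_decode ` {..<T}"
    then obtain t where t: "t < T" "p = prod_decode t" by auto
    then have "prod_encode (fst p, snd p) = t" by simp
    then show "p \<in> {..<T} \<times> {..<T}"
      using le_prod_encode_1[of "fst p" "snd p"] le_prod_encode_2[of "snd p" "fst p"] t(1) by (cases p) auto
  qed
  have "(\<Sum>t<T. f (fst (prod_decode t)) (snd (prod_decode t))) = (\<Sum>p\<in>prod_decode ` {..<T}. f (fst p) (snd p))"
    by (subst sum.reindex) (auto simp: inj_prod_decode)
  also have "\<dots> \<le> (\<Sum>p\<in>{..<T} \<times> {..<T}. f (fst p) (snd p))"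
    by (rule sum_mono2) (use sub nonneg in auto)
  also have "\<dots> = (\<Sum>e<T. \<Sum>j<T. f e j)" by (simp add: sum.cartesian_product split_def)
  also have "\<dots> \<le> (\<Sum>e<T. (1/2) ^ Suc e)" by (intro sum_mono le)
  also have "\<dots> \<le> (1/2) ^ 0" by (rule sum_half_powers_le) auto
  finally show ?thesis by simp
qed

theorem mainTheorem18:
  fixes U :: recf and a :: "nat \<Rightarrow> bool"
  assumes "optimal_machine U"
    and "K_trivial U a"
  shows "K_low U a"
proof -
  note U = assms(1)
  have pf: "prefix_free_machine U" using U by (simp add: optimal_machine_def)
  obtain b where triv: "\<And>n. Kc U (initseg a n) \<le> Kc U (dec n) + b"
    using assms(2) unfolding K_trivial_def by blast
  obtain A st where cA: "computable A" and cst: "computable st" and st: "mono st" "\<And>j. j < st j"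
    and lenA: "\<And>j. j \<le> length (A j)" and lim: "\<And>n. \<exists>J. \<forall>j\<ge>J. take n (A j) = initseg a n"
    and conf: "\<And>i j m. i \<le> j \<Longrightarrow> desc_le U (st j) m i \<Longrightarrow> Kc U (take i (A j)) \<le> m + b"
    using K_trivial_approximation[OF U triv] by blast
  define us yy ln where "us v = fst (prod_decode v)" and "yy v = snd (prod_decode v)"
    and "ln v = plen (yy v)" for v
  define stab where "stab j v \<longleftrightarrow> take (us v) (A (Suc j)) = take (us v) (A j)" for j v
  \<comment> \<open>\<open>v\<close> codes a use together with a program. Requiring the use to be
    exact leaves at most one such \<open>v\<close> per program at each stage, as Kraft's inequality
    demands.\<close>
  define Q where "Q j v \<longleftrightarrow> us v \<le> j \<and> fe U (us v) (orc (A j)) [yy v] \<noteq> None \<and>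
    (\<forall>u<us v. fe U u (orc (A j)) [yy v] = None)" for j v
  define kn where "kn j n m \<longleftrightarrow> desc_le U (st j) m n" for j n m
  \<comment> \<open>With d = 2 * e, \<open>k e\<close> is the bound in \<open>k_ge\<close> itself,
    and \<open>h e\<close> is then chosen so that 8 * k * 2^-h = 1.\<close>
  define k h :: "nat \<Rightarrow> nat" where "k e = 2 ^ (2 * e + b + 2)" and "h e = 2 * e + b + 5" for e
  have us_le: "us v \<le> v" for v
    unfolding us_def by (metis le_prod_encode_1 prod.collapse prod_decode_inverse)
  have Q_stab: "Q (Suc j) v" if "Q j v" "stab j v" for j v
    using that fe_take_agree[of "us v" "A (Suc j)" "A j"] unfolding Q_def stab_def by simp
  have Q_kraft: "(\<Sum>v\<in>V. (1/2) ^ ln v) \<le> (1::real)" if V: "finite V" "\<And>v. v \<in> V \<Longrightarrow> Q j v" for V j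
  proof -
    have inj: "inj_on (\<lambda>v. dec (yy v)) V"
    proof (rule inj_onI)
      fix v w assume vw: "v \<in> V" "w \<in> V" "dec (yy v) = dec (yy w)"
      then have y: "yy v = yy w" by (metis enc_dec)
      have "us v = us w"
        using V(2)[OF vw(1)] V(2)[OF vw(2)] y unfolding Q_def by (metis linorder_neqE_nat)
      with y have "prod_decode v = prod_decode w" unfolding us_def yy_def by (simp add: prod_eq_iff)
      then show "v = w" by (metis prod_decode_inverse)
    qed
    have "(\<Sum>v\<in>V. (1/2) ^ ln v) = (\<Sum>p\<in>(\<lambda>v. dec (yy v)) ` V. (1/2) ^ length p :: real)"
      by (simp add: sum.reindex[OF inj] ln_def)
    also have "\<dots> \<le> 1"
    proof (rule kraft_runs[OF pf, where a = "orc (A j)"])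
      fix p assume "p \<in> (\<lambda>v. dec (yy v)) ` V"
      then obtain v where v: "v \<in> V" "p = dec (yy v)" by blast
      then obtain z where "fe U (us v) (orc (A j)) [yy v] = Some z" using V(2) unfolding Q_def by blast
      then have "runs (orc (A j)) U p (dec z)" using v fe_eval by (simp add: runs_def)
      then show "\<exists>x. runs (orc (A j)) U p x" by blast
    qed (use V in simp)
    finally show ?thesis .
  qed
  have inv: "game_inv stab Q ln kn A us (Kc U) b (k e) (h e) (2 * e)" for e
  proof
    show "8 * real (k e) * (1/2) ^ h e \<le> 1"
      by (simp add: k_def h_def power_add power_one_over)
    have "(2::nat) ^ 1 \<le> 2 ^ (2 * e + b + 2)" by (rule power_increasing) auto
    then show "2 \<le> k e" by (simp add: k_def)
    show "kn (Suc j) n m" if "kn j n m" for j n m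
      using that desc_le_mono[of U "st j" m n "st (Suc j)" m] monoD[OF st(1), of j "Suc j"] by (simp add: kn_def)
    show "(\<Sum>v\<in>V. (1/2) ^ ln v) \<le> (1::real)" if "finite V" "\<And>v. v \<in> V \<Longrightarrow> Q j v" for V j
      by (rule Q_kraft[OF that])
  qed (use us_le Q_stab lenA conf sum_Kc_le[OF U] in \<open>auto simp: stab_def kn_def k_def\<close>)
  have cus: "computable us" and cyy: "computable yy" and cln: "computable ln"
    unfolding us_def[abs_def] yy_def[abs_def] ln_def[abs_def] by (intro comp_intros)+
  have cgame: "computable_game stab Q ln kn"
  proof
    note cA' = comp_comp[OF cA] comp_comp[OF cst]
    show "computable (\<lambda>p. stab (fst p) (snd p))"
      unfolding stab_def us_def by (intro comp_intros cA')
    show "computable (\<lambda>p. Q (fst p) (snd p))"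
      unfolding Q_def us_def yy_def by (intro comp_intros cA')
    show "computable ln" by (rule cln)
    show "computable (\<lambda>p. kn (fst p) (fst (snd p)) (snd (snd p)))"
      unfolding kn_def by (intro comp_intros cA')
  qed
  define S where "S e j = game.stack stab Q ln kn (k e) (h e) (2 * e) j" for e j
  have cS: "computable (\<lambda>x. S (e x) (j x))" if "computable e" "computable j"
    for e j :: "nat \<Rightarrow> nat"
    unfolding S_def k_def h_def
    by (rule computable_game.comp_stack[OF cgame]) (intro comp_intros that)+
  define act where "act e j \<longleftrightarrow> length (S e j) < k e \<and> length (S e (Suc j)) = k e" for e j
  define req where "req e j = goal (last (S e (Suc j)))" for e j
  have act: "game_inv.act stab Q ln kn (k e) (h e) (2 * e) = act e" for e
    unfolding act_def S_def by (rule ext) (rule game_inv.act_def[OF inv])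
  have req: "game_inv.req stab Q ln kn (k e) (h e) (2 * e) = req e" for e
    unfolding req_def S_def by (rule ext) (rule game_inv.req_def[OF inv])
  \<comment> \<open>A single sequence of requests serves all strategies: its index codes the
    strategy and the stage, and the discount adds e + 1 to the exponent.\<close>
  have "\<exists>c. \<forall>t. act (fst (prod_decode t)) (snd (prod_decode t)) \<longrightarrow>
     Kc U (dec (Suc (snd (prod_decode t)))) \<le>
       req (fst (prod_decode t)) (snd (prod_decode t)) + fst (prod_decode t) + 1 + c"
  proof (rule optimal_Kc[OF U])
    show "computable (\<lambda>t. act (fst (prod_decode t)) (snd (prod_decode t)))"
      unfolding act_def k_def by (intro comp_intros cS)
    show "computable (\<lambda>t. req (fst (prod_decode t)) (snd (prod_decode t)) + fst (prod_decode t) + 1)"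
      unfolding req_def by (intro comp_intros cS)
    show "computable (\<lambda>t. Suc (snd (prod_decode t)))" by (intro comp_intros)
    fix T
    define f where "f e j = (if act e j then (1/2) ^ (req e j + e + 1) else (0::real))" for e j
    have "(\<Sum>t<T. f (fst (prod_decode t)) (snd (prod_decode t))) \<le> 1"
    proof (rule sum_prod_decode_le)
      fix e T
      have "(\<Sum>j<T. f e j) = (\<Sum>j<T. (1/2) ^ Suc e * (if act e j then (1/2) ^ req e j else 0))"
        by (intro sum.cong) (auto simp: f_def power_add)
      also have "\<dots> = (1/2) ^ Suc e * (\<Sum>j<T. if act e j then (1/2) ^ req e j else 0)"
        by (simp add: sum_distrib_left)
      also have "\<dots> \<le> (1/2) ^ Suc e * 1"
        using game_inv.requests_bound[OF inv[of e], of T] unfolding act req by (intro mult_left_mono) auto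
      finally show "(\<Sum>j<T. f e j) \<le> (1/2) ^ Suc e" by simp
    qed (simp add: f_def)
    then show "(\<Sum>t<T. if act (fst (prod_decode t)) (snd (prod_decode t)) then
      (1/2) ^ (req (fst (prod_decode t)) (snd (prod_decode t)) + fst (prod_decode t) + 1) else (0::real)) \<le> 1"
      by (simp add: f_def)
  qed
  then obtain c where c: "\<And>e j. act e j \<Longrightarrow> Kc U (dec (Suc j)) \<le> req e j + e + 1 + c"
    by (metis fst_conv prod_encode_inverse snd_conv)
  \<comment> \<open>An answer exceeds the requested exponent by at most e + 1 for the discount and c
    for optimality; this e makes the sum equal to d = 2 * e.\<close>
  define e where "e = c + 1"
  interpret G: game_inv stab Q ln kn A us "Kc U" b "k e" "h e" "2 * e" by (rule inv)
  have "\<exists>J. \<forall>j\<ge>J. kn j (Suc i) (G.req i + 2 * e)" if "G.act i" for i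
  proof -
    have "Kc U (dec (Suc i)) \<le> req e i + 2 * e" using c[of e i] that unfolding act by (simp add: e_def)
    from Kc_desc_le[OF U this] obtain s where s: "desc_le U s (req e i + 2 * e) (Suc i)" by blast
    have "kn j (Suc i) (req e i + 2 * e)" if "s \<le> j" for j
      unfolding kn_def by (rule desc_le_mono[OF s]) (use that st(2)[of j] in auto)
    then show ?thesis unfolding req by blast
  qed
  then obtain g j0 where G: "G.golden g j0" using G.golden_exists by blast
  have gf: "G.gf g j = hd (drop g (S e j))" for j by (simp add: S_def)
  define out where "out o' v = (case fe U (us v) o' [yy v] of None \<Rightarrow> 0 | Some z \<Rightarrow> z)" for o' v
  have cSe: "computable (S e)" using cS[OF comp_const comp_id] .
  have cserved: "computable (G.served g)"
    unfolding G.served_def[abs_def] gf by (intro comp_intros comp_comp[OF cSe])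
  note comp_full = computable_game.comp_full[OF cgame]
  have cevent: "computable (G.event g)"
    unfolding G.event_def[abs_def] gf stab_def us_def
    by (intro comp_intros comp_full comp_comp[OF cA] comp_comp[OF cSe])
  have "\<exists>c. \<forall>j. j0 \<le> j \<and> G.event g j \<longrightarrow>
     Kc U (dec (out (orc (A (Suc j))) (G.served g j))) \<le> (ln (G.served g j) + h e + 2) + c"
  proof (rule optimal_Kc[OF U])
    show "computable (\<lambda>j. j0 \<le> j \<and> G.event g j)" by (intro comp_intros comp_comp[OF cevent])
    show "computable (\<lambda>j. ln (G.served g j) + h e + 2)"
      by (intro comp_intros comp_comp[OF cln] cserved)
    show "computable (\<lambda>j. out (orc (A (Suc j))) (G.served g j))"
      unfolding out_def
      by (intro comp_intros comp_comp[OF cus] comp_comp[OF cyy] comp_comp[OF cserved] comp_comp[OF cA] cserved)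
  qed (rule G.golden_bound[OF G])
  then obtain c2 where c2: "\<And>j. j0 \<le> j \<Longrightarrow> G.event g j \<Longrightarrow>
     Kc U (dec (out (orc (A (Suc j))) (G.served g j))) \<le> ln (G.served g j) + h e + 2 + c2" by blast
  \<comment> \<open>Computations already backed at \<open>j0\<close> may be full without any later
    event. They are finitely many, and \<open>c3\<close> bounds the complexity of their outputs
    along \<open>a\<close>.\<close>
  define V0 where "V0 = fst ` set (chs (G.gf g j0))"
  define c3 where "c3 = (\<Sum>v\<in>V0. Kc U (dec (out a v)))"
  have "Kc U x \<le> Krel U a x + (h e + 2 + c2 + c3)" for x
  proof -
    obtain p where p: "runs a U p x" "length p = Krel U a x" using Krel_attained[OF U] by blast
    define u where "u = (LEAST u. fe U u a [enc p] \<noteq> None)"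
    obtain u0 where u0: "fe U u0 a [enc p] = Some (enc x)" using p(1) eval_fe unfolding runs_def by blast
    have u: "fe U u a [enc p] \<noteq> None" unfolding u_def by (rule LeastI[of _ u0]) (simp add: u0)
    have least: "fe U w a [enc p] = None" if "w < u" for w
      using not_less_Least that unfolding u_def by blast
    obtain z where z: "fe U u a [enc p] = Some z" using u by blast
    have "z = enc x" using eval_det[OF fe_eval[OF z]] p(1) unfolding runs_def by blast
    define v where "v = prod_encode (u, enc p)"
    have v: "us v = u" "yy v = enc p" "ln v = length p" by (simp_all add: v_def us_def yy_def ln_def)
    have out_a: "dec (out a v) = x" using z \<open>z = enc x\<close> by (simp add: out_def v)
    show ?thesis
    proof (cases "v \<in> V0")
      case True
      have "Kc U (dec (out a v)) \<le> c3"
        unfolding c3_def by (rule member_le_sum[OF True]) (auto simp: V0_def)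
      then show ?thesis unfolding out_a by simp
    next
      case False
      obtain J where J: "\<And>j. J \<le> j \<Longrightarrow> take v (A j) = initseg a v" using lim by blast
      have path: "take w (A j) = initseg a w" if "J \<le> j" "w \<le> v" for w j
      proof -
        have "take w (A j) = take w (take v (A j))" using that(2) by (simp add: min_absorb1)
        then show ?thesis unfolding J[OF that(1)] take_initseg using that(2) by (simp add: min_absorb1)
      qed
      have agree: "fe U w (orc (A j)) [enc p] = fe U w a [enc p]"
        if "take u (A j) = initseg a u" "w \<le> u" for j w
      proof (rule fe_agree)
        fix i assume "i < w"
        then have "i < u" using that(2) by simp
        then show "orc (A j) i = a i" using orc_take[of i u "A j"] orc_initseg[of i u a] that(1) by simp
      qed
      have uv: "u \<le> v" using us_le[of v] v by simp
      have "\<exists>j\<ge>j0. G.event g j \<and> G.served g j = v \<and> (\<forall>i\<ge>j. stab i v)"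
      proof (rule G.golden_complete[OF G, where J = "max J u"])
        show "v \<notin> fst ` set (chs (G.gf g j0))" using False by (simp add: V0_def)
        show "Q j v" if "max J u \<le> j" for j
          unfolding Q_def v using agree[OF path] that uv u least by (auto simp: less_imp_le)
        show "stab j w" if "max J u \<le> j" "w \<le> v" for j w
        proof -
          have "us w \<le> v" using us_le[of w] that(2) by simp
          then show ?thesis unfolding stab_def using path[of j "us w"] path[of "Suc j" "us w"] that(1) by simp
        qed
      qed
      then obtain j where j: "j0 \<le> j" "G.event g j" "G.served g j = v" "\<And>i. j \<le> i \<Longrightarrow> stab i v" by blast
      \<comment> \<open>No later stage changes the use of \<open>v\<close>, and the approximation
        converges to \<open>a\<close>; hence the prefix seen at the event is already the true one
        and the description made there is that of x.\<close>
      have "take u (A (Suc j)) = take u (A i)" if "Suc j \<le> i" for i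
        using that
      proof (induction rule: dec_induct)
        case (step i)
        then show ?case using j(4)[of i] unfolding stab_def v by simp
      qed simp
      from this[of "max J (Suc j)"] have "take u (A (Suc j)) = initseg a u"
        using path[of "max J (Suc j)" u] uv by simp
      then have "out (orc (A (Suc j))) v = out a v" using agree by (simp add: out_def v)
      then have "Kc U x \<le> ln v + h e + 2 + c2" using c2[OF j(1,2)] unfolding j(3) using out_a by simp
      then show ?thesis using v p(2) by simp
    qed
  qed
  then show ?thesis unfolding K_low_def by blast
qed

end
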